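(* Let $\nu\ge-\tfrac12$ and $z\in\mathbb{C}\setminus(-\infty,0]$. Then $$\int_0^\infty J_\nu(cz)\,e^{-2/c}\,c^{-1}\,dc=2\,J_\nu\left(2\sqrt{z}\right)K_\nu\left(2\sqrt{z}\right).$$
   Context: $J_\nu:\mathbb{C}\setminus(-\infty,0]\to\mathbb{C}$ is the Bessel function of the first kind and $K_\nu:\mathbb{C}\setminus(-\infty,0]\to\mathbb{C}$ is the modified Bessel function of the second kind, of order $\nu$.
   Formalization: For non-real z the integral over real c diverges, since J_ν(cz) grows like exp(|Im z|c); the identity is stated literally for z > 0, and for general z with the integral from 0 to ∞ taken along the positive axis to any a > 0 and then in direction exp(-i Arg z). *)

theory Defs
  imports "HOL-Analysis.Analysis"
begin

text \<open>
  Bessel functions of real order on the slit plane, with all powers principal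
  (\<open>w powr \<nu> = exp (\<nu> * Ln w)\<close>). Using \<open>rGamma = 1 / \<Gamma>\<close>, an entire function, the coefficients
  whose Gamma factor has a pole vanish, as required by the series for negative orders.
\<close>

definition besselJ :: "real \<Rightarrow> complex \<Rightarrow> complex" where
  "besselJ \<nu> w = (w / 2) powr of_real \<nu> *
     (\<Sum>k. (-1) ^ k * rGamma (of_real \<nu> + of_nat k + 1) / fact k * (w / 2) ^ (2 * k))"

definition besselI :: "real \<Rightarrow> complex \<Rightarrow> complex" where
  "besselI \<nu> w = (w / 2) powr of_real \<nu> *
     (\<Sum>k. rGamma (of_real \<nu> + of_nat k + 1) / fact k * (w / 2) ^ (2 * k))"

definition besselK_nonint :: "real \<Rightarrow> complex \<Rightarrow> complex" where
  "besselK_nonint \<nu> w =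
     of_real (pi / 2) * (besselI (-\<nu>) w - besselI \<nu> w) / of_real (sin (\<nu> * pi))"

text \<open>At integer orders \<open>K\<^sub>\<nu>\<close> is the limit of the quotient over neighbouring non-integer orders.\<close>

definition besselK :: "real \<Rightarrow> complex \<Rightarrow> complex" where
  "besselK \<nu> w =
     (if \<nu> \<in> \<int> then Lim (at \<nu>) (\<lambda>\<mu>. besselK_nonint \<mu> w) else besselK_nonint \<nu> w)"

text \<open>
  For non-real \<open>z\<close>, \<open>J\<^sub>\<nu>(cz)\<close> grows like \<open>exp (\<bar>Im z\<bar> c)\<close> as the real variable \<open>c\<close> tends to infinity,
  so \<open>\<integral>\<^sub>0\<^sup>\<infinity> J\<^sub>\<nu>(cz) exp (-2/c) dc/c\<close> diverges along the positive axis and has to be read as a contour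
  integral. The contour must leave \<open>0\<close> along the positive axis, where \<open>exp (-2/c)\<close> decays, and
  go to infinity in the direction in which \<open>cz\<close> is eventually parallel to the positive axis, where
  \<open>J\<^sub>\<nu>(cz)\<close> decays. The path below follows the axis up to \<open>a\<close> and then turns by \<open>- Arg z\<close>; \<open>cz\<close>
  stays in the slit plane along it. For \<open>z > 0\<close> it is the positive axis itself, with
  the identity parametrisation.
\<close>

definition bessel_path :: "real \<Rightarrow> complex \<Rightarrow> real \<Rightarrow> complex" where
  "bessel_path a z t =
     (if t \<le> a then of_real t else of_real a + of_real (t - a) * cis (- Arg z))"

lemma bessel_path_pos_real:
  assumes "x > 0"
  shows "bessel_path a (of_real x) = of_real"
  using assms by (auto simp: bessel_path_def Arg_of_real fun_eq_iff)

end

theory Submission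
  imports Defs "HOL-Complex_Analysis.Complex_Analysis" "HOL-Real_Asymp.Real_Asymp"
begin

text \<open>
  For \<open>z > 0\<close> the formula is the case \<open>x = X = 2 \<surd>z\<close> of Macdonald's product formula
  \<open>J\<^sub>\<nu>(x) K\<^sub>\<nu>(X) = 1/2 \<integral>\<^sub>0\<^sup>\<infinity> exp (- t/2 - (X\<^sup>2 - x\<^sup>2) / (2t)) J\<^sub>\<nu>(x X / t) dt / t\<close> under \<open>t = 4/c\<close>. For small \<open>x\<close>
  the right-hand side can be expanded in powers of \<open>x\<^sup>2\<close>; the coefficients obey the recurrence of the
  Bessel series, and the constant term is the integral \<open>K\<^sub>\<nu>(X) = 1/2 \<integral> exp (- X cosh t - \<nu> t) dt\<close>.
  Both sides are analytic for \<open>\<bar>Re x\<bar> + \<bar>Im x\<bar> < X\<close>, and \<open>x \<rightarrow> X\<close> is a dominated limit because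
  \<open>w\<^sup>1\<^sup>/\<^sup>2 J\<^sub>\<nu>(w) = O(exp \<bar>Im w\<bar>)\<close>, an energy estimate for Bessel's equation along rays.
  The integral representation of \<open>K\<^sub>\<nu>\<close> follows from uniqueness for its differential equation at \<open>0\<close>
  when \<open>-1 < \<nu> < 0\<close>, then by differentiation for larger orders and by continuity for integers.

  For general \<open>z\<close>, parametrising \<open>w = c z\<close> by \<open>t z\<close> for \<open>t \<le> a\<close> and by \<open>a z + (t - a)\<close> for \<open>t > a\<close> makes the
  contour integral visibly analytic in \<open>z\<close>, so the identity extends from \<open>z > 0\<close> to the slit plane
  without any deformation of the contour.
\<close>

subsection \<open>Integrals depending on a parameter\<close>

text \<open>The obstacle is that the wanted case x = X is the worst one. Termwise integration, made
  absolute, replaces J_\<nu> by a modified Bessel function, whose exponential growth as t -> 0 beats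
  the decay of the kernel unless x is small against X. Beyond that range the oscillation of J_\<nu>
  has to be used, hence a growth bound in terms of |Im w|; and at x = X the exponential factors
  cancel, so that convergence rests on the factor w^(-1/2) alone. Since \<nu> \<ge> -1/2, that bound
  reaches down to w = 0.

  The same bound governs the contour: on its final ray Im (c z) is constant, so J_\<nu>(c z) decays
  like a power, and together with dc/c this is integrable.

  The normalisations q = w^2/4, X = 2 h and Y = x^2/4 remove all half-integer powers: apart from a
  factor (w/2)^\<nu>, the Bessel functions become entire in q.\<close>

lemma has_field_derivative_integral_param:
  fixes f :: "complex \<Rightarrow> 'b \<Rightarrow> complex"
  assumes "open S" "z0 \<in> S"
    and hol: "\<And>t. t \<in> space M \<Longrightarrow> (\<lambda>z. f z t) holomorphic_on S"
    and meas: "\<And>z. z \<in> S \<Longrightarrow> f z \<in> borel_measurable M"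
    and dom: "\<exists>r>0. \<exists>h. ball z0 r \<subseteq> S \<and> integrable M h \<and>
                (\<forall>z\<in>ball z0 r. \<forall>t\<in>space M. norm (f z t) \<le> h t)"
  shows "((\<lambda>z. \<integral>t. f z t \<partial>M) has_field_derivative (\<integral>t. deriv (\<lambda>z. f z t) z0 \<partial>M)) (at z0)"
proof -
  obtain r h where r: "r > 0" "ball z0 r \<subseteq> S" and h: "integrable M h"
    and bd: "\<And>z t. z \<in> ball z0 r \<Longrightarrow> t \<in> space M \<Longrightarrow> norm (f z t) \<le> h t"
    using dom by blast
  have int: "integrable M (f z)" if "z \<in> ball z0 r" for z
    by (rule Bochner_Integration.integrable_bound[OF h])
       (use that r meas bd in \<open>auto intro!: AE_I2 intro: order_trans[OF _ abs_ge_self]\<close>)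
  \<comment> \<open>Cauchy's inequality on discs of radius r/3, which stay inside
    \<open>ball z0 r\<close> because r/2 + r/3 < r. In this way a bound on \<open>f\<close> alone
    controls the difference quotients.\<close>
  have deriv_bd: "norm (deriv (\<lambda>z. f z t) w) \<le> 3 * h t / r"
    if t: "t \<in> space M" and w: "w \<in> ball z0 (r/2)" for t w
  proof -
    have sub: "cball w (r/3) \<subseteq> ball z0 r"
    proof
      fix x assume "x \<in> cball w (r/3)"
      then have "dist z0 x \<le> dist z0 w + r/3"
        using dist_triangle[of z0 x w] by simp
      with w r(1) show "x \<in> ball z0 r" by simp
    qed
    have h1: "(\<lambda>z. f z t) holomorphic_on cball w (r/3)"
      using hol[OF t] sub r(2) by (meson holomorphic_on_subset subset_trans)
    have "norm ((deriv ^^ 1) (\<lambda>z. f z t) w) \<le> fact 1 * h t / (r/3) ^ 1"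
    proof (rule Cauchy_inequality)
      show "(\<lambda>z. f z t) holomorphic_on ball w (r/3)"
        using h1 by (meson ball_subset_cball holomorphic_on_subset)
      show "continuous_on (cball w (r/3)) (\<lambda>z. f z t)"
        using h1 by (rule holomorphic_on_imp_continuous_on)
      fix x assume "norm (w - x) = r/3"
      then have "x \<in> cball w (r/3)" by (simp add: dist_norm)
      then show "norm (f x t) \<le> h t" using bd t sub by blast
    qed (use r in auto)
    then show ?thesis by (simp add: field_simps)
  qed
  have lip: "norm (f z t - f z0 t) \<le> 3 * h t / r * norm (z - z0)"
    if t: "t \<in> space M" and z: "z \<in> ball z0 (r/2)" for t z
  proof (rule field_differentiable_bound[where S="ball z0 (r/2)" and f'="deriv (\<lambda>z. f z t)"])
    fix w assume w: "w \<in> ball z0 (r/2)"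
    then have "w \<in> S" using r by auto
    then show "((\<lambda>z. f z t) has_field_derivative deriv (\<lambda>z. f z t) w) (at w within ball z0 (r/2))"
      using hol[OF t] \<open>open S\<close> by (meson has_field_derivative_at_within holomorphic_derivI)
    show "norm (deriv (\<lambda>z. f z t) w) \<le> 3 * h t / r" by (rule deriv_bd[OF t w])
  qed (use z r in auto)
  show ?thesis
    unfolding has_field_derivative_iff tendsto_at_iff_sequentially
  proof (intro allI impI)
    fix X :: "nat \<Rightarrow> complex"
    assume X: "\<forall>i. X i \<in> UNIV - {z0}" and lim: "X \<longlonglongrightarrow> z0"
    have "eventually (\<lambda>i. X i \<in> ball z0 (r/2)) sequentially"
      using lim r(1) by (metis centre_in_ball half_gt_zero open_ball topological_tendstoD)
    \<comment> \<open>Only a tail of the sequence lies in the half ball where the Lipschitz bound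
      holds; \<open>LIMSEQ_offset\<close> undoes the shift at the end.\<close>
    then obtain N where N: "\<And>i. i \<ge> N \<Longrightarrow> X i \<in> ball z0 (r/2)"
      by (auto simp: eventually_sequentially)
    have inr: "X (i + N) \<in> ball z0 r" for i using N[of "i+N"] r(1) by auto
    have "(\<lambda>i. \<integral>t. (f (X (i + N)) t - f z0 t) / (X (i + N) - z0) \<partial>M)
            \<longlonglongrightarrow> (\<integral>t. deriv (\<lambda>z. f z t) z0 \<partial>M)"
    proof (rule integral_dominated_convergence[where w = "\<lambda>t. 3 * h t / r"])
      have lim': "(\<lambda>i. (f (X (i + N)) t - f z0 t) / (X (i + N) - z0)) \<longlonglongrightarrow> deriv (\<lambda>z. f z t) z0"
        if "t \<in> space M" for t
      proof -
        have "((\<lambda>z. f z t) has_field_derivative deriv (\<lambda>z. f z t) z0) (at z0)"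
          using hol[OF that] assms(1,2) by (simp add: holomorphic_derivI)
        then have "\<forall>Y. (\<forall>i. Y i \<in> UNIV - {z0}) \<longrightarrow> Y \<longlonglongrightarrow> z0 \<longrightarrow>
            ((\<lambda>z. (f z t - f z0 t) / (z - z0)) \<circ> Y) \<longlonglongrightarrow> deriv (\<lambda>z. f z t) z0"
          unfolding has_field_derivative_iff tendsto_at_iff_sequentially .
        from this[rule_format, of "\<lambda>i. X (i + N)"]
        have "((\<lambda>z. (f z t - f z0 t) / (z - z0)) \<circ> (\<lambda>i. X (i + N))) \<longlonglongrightarrow> deriv (\<lambda>z. f z t) z0"
          using X LIMSEQ_ignore_initial_segment[OF lim, of N] by simp
        then show ?thesis by (simp add: o_def)
      qed
      show m: "(\<lambda>t. (f (X (i + N)) t - f z0 t) / (X (i + N) - z0)) \<in> borel_measurable M" for i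
        using meas[OF subsetD[OF r(2) inr]] meas[OF assms(2)] by (intro borel_measurable_divide borel_measurable_diff) auto
      show "(\<lambda>t. deriv (\<lambda>z. f z t) z0) \<in> borel_measurable M"
        by (rule borel_measurable_LIMSEQ_metric[OF m lim'])
      show "AE t in M. (\<lambda>i. (f (X (i + N)) t - f z0 t) / (X (i + N) - z0)) \<longlonglongrightarrow> deriv (\<lambda>z. f z t) z0"
        using lim' by auto
      show "integrable M (\<lambda>t. 3 * h t / r)" using h by simp
      show "AE t in M. norm ((f (X (i + N)) t - f z0 t) / (X (i + N) - z0)) \<le> 3 * h t / r" for i
      proof (rule AE_I2)
        fix t assume t: "t \<in> space M"
        have "norm (X (i+N) - z0) > 0" using X by auto
        with lip[OF t N[of "i+N"]] show "norm ((f (X (i + N)) t - f z0 t) / (X (i + N) - z0)) \<le> 3 * h t / r"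
          by (simp add: norm_divide divide_le_eq)
      qed
    qed
    moreover have "(\<integral>t. (f (X (i + N)) t - f z0 t) / (X (i + N) - z0) \<partial>M) =
         ((\<integral>t. f (X (i + N)) t \<partial>M) - (\<integral>t. f z0 t \<partial>M)) / (X (i + N) - z0)" for i
      using int[OF inr[of i]] int[of z0] r(1) by simp
    ultimately have "(\<lambda>i. ((\<integral>t. f (X (i + N)) t \<partial>M) - (\<integral>t. f z0 t \<partial>M)) / (X (i + N) - z0))
        \<longlonglongrightarrow> (\<integral>t. deriv (\<lambda>z. f z t) z0 \<partial>M)" by (simp only:)
    then have "(\<lambda>i. ((\<lambda>z. ((\<integral>t. f z t \<partial>M) - (\<integral>t. f z0 t \<partial>M)) / (z - z0)) \<circ> X) (i + N))
        \<longlonglongrightarrow> (\<integral>t. deriv (\<lambda>z. f z t) z0 \<partial>M)" by (simp add: o_def)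
    then show "((\<lambda>z. ((\<integral>t. f z t \<partial>M) - (\<integral>t. f z0 t \<partial>M)) / (z - z0)) \<circ> X)
        \<longlonglongrightarrow> (\<integral>t. deriv (\<lambda>z. f z t) z0 \<partial>M)"
      by (rule LIMSEQ_offset)
  qed
qed

lemma holomorphic_integral_param:
  fixes f :: "complex \<Rightarrow> 'b \<Rightarrow> complex"
  assumes "open S"
    and "\<And>t. t \<in> space M \<Longrightarrow> (\<lambda>z. f z t) holomorphic_on S"
    and "\<And>z. z \<in> S \<Longrightarrow> f z \<in> borel_measurable M"
    and "\<And>z0. z0 \<in> S \<Longrightarrow> \<exists>r>0. \<exists>h. ball z0 r \<subseteq> S \<and> integrable M h \<and>
                (\<forall>z\<in>ball z0 r. \<forall>t\<in>space M. norm (f z t) \<le> h t)"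
  shows "(\<lambda>z. \<integral>t. f z t \<partial>M) holomorphic_on S"
  unfolding holomorphic_on_open[OF assms(1)]
  using has_field_derivative_integral_param[OF assms(1) _ assms(2,3,4)] by blast

section \<open>The substitution c = exp t and Euler's integral\<close>

lemma range_exp_greaterThan: "range (exp :: real \<Rightarrow> real) = {0<..}"
proof (intro equalityI subsetI)
  fix x :: real assume "x \<in> {0<..}"
  then have "x = exp (ln x)" by simp
  then show "x \<in> range exp" by (rule range_eqI)
qed auto

lemma has_integral_exp_substitution_real:
  fixes f :: "real \<Rightarrow> real"
  assumes "integrable lborel (\<lambda>t. exp t * f (exp t))"
  shows "f absolutely_integrable_on {0<..}"
    and "integral {0<..} f = (\<integral>t. exp t * f (exp t) \<partial>lborel)"
proof -
  have "(\<lambda>t. exp t * f (exp t)) absolutely_integrable_on UNIV"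
    using assms unfolding absolutely_integrable_on_def set_integrable_def
    by (auto intro!: integrable_completion[THEN iffD2])
  moreover have "integral UNIV (\<lambda>t. exp t * f (exp t)) = (\<integral>t. exp t * f (exp t) \<partial>lborel)"
    using has_integral_integral_lborel[OF assms] by (rule integral_unique)
  moreover have "inj (exp :: real \<Rightarrow> real)" by (auto intro: injI)
  moreover have "range (exp :: real \<Rightarrow> real) = {0<..}"
    by (rule range_exp_greaterThan)
  ultimately show "f absolutely_integrable_on {0<..}" 
    and "integral {0<..} f = (\<integral>t. exp t * f (exp t) \<partial>lborel)"
    using has_absolute_integral_change_of_variables_1'[of UNIV exp exp f "\<integral>t. exp t * f (exp t) \<partial>lborel"]
    by (auto intro!: derivative_eq_intros)
qed

lemma has_integral_exp_substitution:
  fixes f :: "real \<Rightarrow> complex"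
  assumes "integrable lborel (\<lambda>t. of_real (exp t) * f (exp t))"
  shows "(f has_integral (\<integral>t. of_real (exp t) * f (exp t) \<partial>lborel)) {0<..}"
proof -
  have re: "integrable lborel (\<lambda>t. exp t * Re (f (exp t)))" and im: "integrable lborel (\<lambda>t. exp t * Im (f (exp t)))"
    using integrable_Re[OF assms] integrable_Im[OF assms] by simp_all
  let ?I = "\<integral>t. of_real (exp t) * f (exp t) \<partial>lborel"
  have "((\<lambda>c. Re (f c)) has_integral Re ?I) {0<..}"
    using has_integral_exp_substitution_real[OF re] integral_Re[OF assms]
    by (auto simp: has_integral_iff set_lebesgue_integral_eq_integral(1))
  moreover have "((\<lambda>c. Im (f c)) has_integral Im ?I) {0<..}"
    using has_integral_exp_substitution_real[OF im] integral_Im[OF assms]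
    by (auto simp: has_integral_iff set_lebesgue_integral_eq_integral(1))
  ultimately have "((\<lambda>c. of_real (Re (f c)) + \<i> * of_real (Im (f c))) has_integral
        (of_real (Re ?I) + \<i> * of_real (Im ?I))) {0<..}"
    by (intro has_integral_add has_integral_mult_right has_integral_of_real)
  then show ?thesis by (simp add: complex_eq[symmetric])
qed

text \<open>Euler's integral after s = exp t. It is the source of integrability for all double
  exponential kernels below and of the value of \<open>dexp_int\<close> in the limit a -> 0.\<close>

lemma Gamma_exp_integral:
  assumes "\<mu> > (0::real)"
  shows "integrable lborel (\<lambda>t. exp (- exp t + \<mu> * t))"
    and "(\<integral>t. exp (- exp t + \<mu> * t) \<partial>lborel) = Gamma \<mu>"
proof -
  let ?f = "\<lambda>s::real. s powr (\<mu> - 1) / exp s"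
  have hi: "(?f has_integral Gamma \<mu>) {0<..}"
    using Gamma_integral_real[OF assms] 
    by (subst has_integral_spike_set_eq[of _ "{0..}"]) (auto intro: negligible_subset[of "{0::real}"])
  have ai: "?f absolutely_integrable_on {0<..}"
    by (rule nonnegative_absolutely_integrable_1) (use hi in auto)
  have eq: "\<bar>exp t\<bar> * ?f (exp t) = exp (- exp t + \<mu> * t)" for t :: real
    by (simp add: powr_def exp_add[symmetric] exp_diff[symmetric] algebra_simps)
  have inj: "inj (exp :: real \<Rightarrow> real)" by (auto intro: injI)
  have rng: "range (exp :: real \<Rightarrow> real) = {0<..}"
    by (rule range_exp_greaterThan)
  have "(\<lambda>t. exp (- exp t + \<mu> * t)) absolutely_integrable_on UNIV \<and>
        integral UNIV (\<lambda>t. exp (- exp t + \<mu> * t)) = Gamma \<mu>"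
    using has_absolute_integral_change_of_variables_1'[of UNIV exp exp ?f "Gamma \<mu>"] inj ai hi 
    unfolding eq rng by (auto intro!: derivative_eq_intros)
  then show *: "integrable lborel (\<lambda>t. exp (- exp t + \<mu> * t))"
    and "(\<integral>t. exp (- exp t + \<mu> * t) \<partial>lborel) = Gamma \<mu>"
    by (auto simp: absolutely_integrable_on_def set_integrable_def lebesgue_on_UNIV_eq integrable_completion integral_lborel)
qed

subsection \<open>The power series of the Bessel functions\<close>

text \<open>The Bessel-Clifford function, that is, the regularised hypergeometric function 0F1 with
  parameter \<nu> + 1; it is entire in q. J_\<nu> and I_\<nu> are (w/2)^\<nu> times its values at -
  w^2/4 and w^2/4, so the branch cut is confined to the power.\<close>

definition bessel_ser :: "real \<Rightarrow> complex \<Rightarrow> complex" where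
  "bessel_ser \<nu> q = (\<Sum>k. rGamma (of_real \<nu> + of_nat k + 1) / fact k * q ^ k)"

text \<open>Once k \<ge> |\<nu>|, the factor \<nu> + k + 1 of the functional equation has modulus at
  least 1, so the moduli no longer increase; only finitely many terms precede.\<close>

lemma rGamma_shift_bounded:
  "\<exists>M. \<forall>k. norm (rGamma (of_real \<nu> + of_nat k + 1 :: complex)) \<le> M"
proof -
  let ?a = "\<lambda>k::nat. norm (rGamma (of_real \<nu> + of_nat k + 1 :: complex))"
  define N where "N = nat \<lceil>\<bar>\<nu>\<bar>\<rceil>"
  have N: "\<bar>\<nu>\<bar> \<le> real N" by (simp add: N_def)
  have step: "?a (Suc k) \<le> ?a k" if "k \<ge> N" for k
  proof -
    have "rGamma (of_real \<nu> + of_nat k + 1 :: complex)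
          = (of_real \<nu> + of_nat k + 1) * rGamma (of_real \<nu> + of_nat (Suc k) + 1)"
      using rGamma_plus1[of "of_real \<nu> + of_nat k + 1 :: complex"] by (simp add: add_ac)
    moreover have "norm (of_real \<nu> + of_nat k + 1 :: complex) \<ge> 1"
    proof -
      have "of_real \<nu> + of_nat k + 1 = (of_real (\<nu> + real k + 1) :: complex)" by simp
      then have "norm (of_real \<nu> + of_nat k + 1 :: complex) = \<bar>\<nu> + real k + 1\<bar>"
        by (simp only: norm_of_real)
      with N that show ?thesis by linarith
    qed
    ultimately show ?thesis
      by (simp add: norm_mult mult_le_cancel_right1)
  qed
  have dec: "?a (N + j) \<le> ?a N" for j
  proof (induction j)
    case (Suc j)
    then show ?case using step[of "N+j"] by simp
  qed simp
  have "?a k \<le> Max (?a ` {..N})" for k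
  proof (cases "k \<le> N")
    case True
    then show ?thesis by (intro Max_ge) auto
  next
    case False
    then have "?a k \<le> ?a N" using dec[of "k - N"] by simp
    also have "\<dots> \<le> Max (?a ` {..N})" by (intro Max_ge) auto
    finally show ?thesis .
  qed
  then show ?thesis by blast
qed

lemma summable_bessel_ser: "summable (\<lambda>k. rGamma (of_real \<nu> + of_nat k + 1) / fact k * (q::complex) ^ k)"
proof -
  obtain M where M: "\<And>k. norm (rGamma (of_real \<nu> + of_nat k + 1 :: complex)) \<le> M"
    using rGamma_shift_bounded by blast
  have "summable (\<lambda>k. M * (norm q ^ k /\<^sub>R fact k))"
    by (intro summable_mult summable_exp_generic)
  then show ?thesis
  proof (rule summable_comparison_test')
    fix k
    have "norm (rGamma (of_real \<nu> + of_nat k + 1) / fact k * q ^ k)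
        = norm (rGamma (of_real \<nu> + of_nat k + 1 :: complex)) * (norm q ^ k /\<^sub>R fact k)"
      by (simp add: norm_mult norm_divide norm_power field_simps)
    also have "\<dots> \<le> M * (norm q ^ k /\<^sub>R fact k)"
      by (intro mult_right_mono M) simp
    finally show "norm (rGamma (of_real \<nu> + of_nat k + 1) / fact k * q ^ k) \<le> M * (norm q ^ k /\<^sub>R fact k)" .
  qed
qed

lemma sums_bessel_ser: "(\<lambda>k. rGamma (of_real \<nu> + of_nat k + 1) / fact k * q ^ k) sums bessel_ser \<nu> q"
  unfolding bessel_ser_def by (rule summable_sums[OF summable_bessel_ser])

lemma bessel_ser_0 [simp]: "bessel_ser \<nu> 0 = rGamma (of_real \<nu> + 1)"
proof -
  have "(\<lambda>k. rGamma (of_real \<nu> + of_nat k + 1) / fact k * 0 ^ k) sums rGamma (complex_of_real \<nu> + 1)"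
    using powser_sums_zero[of "\<lambda>k. rGamma (complex_of_real \<nu> + of_nat k + 1) / fact k"] by simp
  then show ?thesis using sums_bessel_ser sums_unique2 by blast
qed

lemma has_field_derivative_bessel_ser [derivative_intros]:
  assumes "(f has_field_derivative f') (at q within A)"
  shows "((\<lambda>q. bessel_ser \<nu> (f q)) has_field_derivative bessel_ser (\<nu> + 1) (f q) * f') (at q within A)"
proof (rule DERIV_chain2[OF _ assms])
  let ?c = "\<lambda>\<nu> k. rGamma (of_real \<nu> + of_nat k + 1) / fact k :: complex"
  have "diffs (?c \<nu>) = ?c (\<nu> + 1)"
  proof
    fix k
    have eq: "of_real \<nu> + of_nat (Suc k) + 1 = (of_real (\<nu> + 1) + of_nat k + 1 :: complex)" by simp
    show "diffs (?c \<nu>) k = ?c (\<nu> + 1) k"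
      unfolding diffs_def eq fact_Suc by (simp del: of_nat_Suc)
  qed
  then show "(bessel_ser \<nu> has_field_derivative bessel_ser (\<nu> + 1) (f q)) (at (f q))"
    using termdiffs_strong_converges_everywhere[of "?c \<nu>" "f q"] summable_bessel_ser
    by (simp add: bessel_ser_def[abs_def])
qed

text \<open>As differentiation raises the order by one, this is the differential equation q y'' +
  (\<nu> + 1) y' = y. On coefficients it is the functional equation of Gamma with \<nu> + k + 1
  split as (\<nu> + 1) + k, the part k giving a shift of the index.\<close>

lemma bessel_ser_rec:
  "bessel_ser \<nu> q = of_real (\<nu> + 1) * bessel_ser (\<nu> + 1) q + q * bessel_ser (\<nu> + 2) q"
proof -
  let ?a = "\<lambda>k. rGamma (of_real (\<nu> + 1) + of_nat k + 1) * of_nat k / fact k * q ^ k"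
  have "(\<lambda>k. q * (rGamma (of_real (\<nu> + 2) + of_nat k + 1) / fact k * q ^ k)) sums (q * bessel_ser (\<nu> + 2) q)"
    by (intro sums_mult sums_bessel_ser)
  moreover have "q * (rGamma (of_real (\<nu> + 2) + of_nat k + 1) / fact k * q ^ k) = ?a (Suc k)" for k
  proof -
    have eq: "of_real (\<nu> + 1) + of_nat (Suc k) + 1 = (of_real (\<nu> + 2) + of_nat k + 1 :: complex)" by simp
    show ?thesis unfolding eq fact_Suc by (simp del: of_nat_Suc)
  qed
  ultimately have "(\<lambda>k. ?a (Suc k)) sums (q * bessel_ser (\<nu> + 2) q)" by (simp only:)
  \<comment> \<open>The factor \<open>of_nat k\<close> in \<open>?a\<close> kills the term k = 0, so
    the shift leaves the sum unchanged.\<close>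
  then have "?a sums (q * bessel_ser (\<nu> + 2) q)" by (subst (asm) sums_Suc_iff) simp
  from sums_add[OF sums_mult[OF sums_bessel_ser[of "\<nu>+1" q], of "of_real (\<nu> + 1)"] this]
  have "(\<lambda>k. of_real (\<nu> + 1) * (rGamma (of_real (\<nu> + 1) + of_nat k + 1) / fact k * q ^ k) + ?a k) sums
     (of_real (\<nu> + 1) * bessel_ser (\<nu> + 1) q + q * bessel_ser (\<nu> + 2) q)" .
  moreover have "of_real (\<nu> + 1) * (rGamma (of_real (\<nu> + 1) + of_nat k + 1) / fact k * q ^ k) + ?a k
      = rGamma (of_real \<nu> + of_nat k + 1) / fact k * q ^ k" for k
  proof -
    have "rGamma (of_real \<nu> + of_nat k + 1 :: complex)
          = (of_real \<nu> + of_nat k + 1) * rGamma (of_real (\<nu> + 1) + of_nat k + 1)"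
      using rGamma_plus1[of "of_real \<nu> + of_nat k + 1 :: complex"] by (simp add: add_ac)
    then show ?thesis by (simp add: field_simps)
  qed
  ultimately show ?thesis using sums_bessel_ser sums_unique2 by simp blast
qed

lemma besselJ_eq: "besselJ \<nu> w = (w / 2) powr of_real \<nu> * bessel_ser \<nu> (- (w\<^sup>2 / 4))"
proof -
  have "(-1) ^ k * c / d * (w / 2) ^ (2 * k) = c / d * (- (w\<^sup>2 / 4)) ^ k" for k and c d :: complex
    by (simp add: power_mult power_divide power_minus[of "w^2/4"])
  then show ?thesis
    by (simp only: besselJ_def bessel_ser_def)
qed

lemma besselI_eq: "besselI \<nu> w = (w / 2) powr of_real \<nu> * bessel_ser \<nu> (w\<^sup>2 / 4)"
  by (simp add: besselI_def bessel_ser_def power_mult power_divide)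

lemma holomorphic_on_bessel_ser [holomorphic_intros]:
  "f holomorphic_on S \<Longrightarrow> (\<lambda>z. bessel_ser \<nu> (f z)) holomorphic_on S"
  unfolding holomorphic_on_def field_differentiable_def
  using has_field_derivative_bessel_ser by blast

lemma continuous_on_bessel_ser [continuous_intros]:
  assumes "continuous_on S f"
  shows "continuous_on S (\<lambda>z. bessel_ser \<nu> (f z))"
proof (rule continuous_on_compose2[OF _ assms subset_UNIV])
  show "continuous_on UNIV (bessel_ser \<nu>)"
    by (intro holomorphic_on_imp_continuous_on holomorphic_on_bessel_ser) simp
qed

subsection \<open>The integral representation of the modified Bessel function\<close>

text \<open>For positive parameters this is 2 (b/a)^(\<nu>/2) K_\<nu>(2 sqrt (a b)). With b = 1 it
  is a function of q = a obeying the equation of \<open>bessel_ser\<close>; with b = a it is 2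
  K_\<nu>(2 a).\<close>

definition dexp_int :: "real \<Rightarrow> real \<Rightarrow> real \<Rightarrow> real" where
  "dexp_int b a \<nu> = (\<integral>t. exp (- (b * exp t) - a * exp (- t) - \<nu> * t) \<partial>lborel)"

lemma integrable_exp_exp:
  assumes "b > 0" "\<mu> > 0"
  shows "integrable lborel (\<lambda>t::real. exp (- (b * exp t) + \<mu> * t))"
proof -
  have "integrable lborel (\<lambda>t. exp (- exp (ln b + 1 * t) + \<mu> * (ln b + 1 * t)))"
    by (rule lborel_integrable_real_affine[OF Gamma_exp_integral(1)[OF assms(2)]]) simp
  moreover have "exp (- exp (ln b + 1 * t) + \<mu> * (ln b + 1 * t)) = exp (\<mu> * ln b) * exp (- (b * exp t) + \<mu> * t)" for t
    using assms by (simp add: exp_add[symmetric] algebra_simps) (simp add: exp_add)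
  ultimately show ?thesis by simp
qed

lemma integrable_exp_exp':
  assumes "a > 0" "\<mu> > 0"
  shows "integrable lborel (\<lambda>t::real. exp (- (a * exp (- t)) - \<mu> * t))"
  using lborel_integrable_real_affine[OF integrable_exp_exp[OF assms], of "-1" 0] by simp

lemma integrable_dexp:
  assumes "a > 0" "b > 0"
  shows "integrable lborel (\<lambda>t::real. exp (- (b * exp t) - a * exp (- t) - \<nu> * t))"
proof (rule Bochner_Integration.integrable_bound)
  \<comment> \<open>A positive exponent, as Euler's integral requires, that dominates - \<nu> for t
    \<ge> 0 and \<nu> for t < 0.\<close>
  let ?\<mu> = "\<bar>\<nu>\<bar> + 1"
  show "integrable lborel (\<lambda>t. exp (- (b * exp t) + ?\<mu> * t) + exp (- (a * exp (- t)) - ?\<mu> * t))"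
    using assms by (intro Bochner_Integration.integrable_add integrable_exp_exp integrable_exp_exp') auto
  show "AE t in lborel. norm (exp (- (b * exp t) - a * exp (- t) - \<nu> * t))
      \<le> norm (exp (- (b * exp t) + ?\<mu> * t) + exp (- (a * exp (- t)) - ?\<mu> * t))"
  proof (rule AE_I2)
    fix t :: real
    have nn: "b * exp t \<ge> 0" "a * exp (- t) \<ge> 0" using assms by auto
    have "exp (- (b * exp t) - a * exp (- t) - \<nu> * t) \<le> exp (- (b * exp t) + ?\<mu> * t) + exp (- (a * exp (- t)) - ?\<mu> * t)"
    proof (cases "t \<ge> 0")
      case True
      have "- \<nu> * t \<le> ?\<mu> * t" using True by (intro mult_right_mono) auto
      then have "exp (- (b * exp t) - a * exp (- t) - \<nu> * t) \<le> exp (- (b * exp t) + ?\<mu> * t)"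
        using nn by simp
      also have "\<dots> \<le> exp (- (b * exp t) + ?\<mu> * t) + exp (- (a * exp (- t)) - ?\<mu> * t)" by simp
      finally show ?thesis .
    next
      case False
      then have "\<nu> * (- t) \<le> ?\<mu> * (- t)" by (intro mult_right_mono) auto
      then have "- (\<nu> * t) \<le> - (?\<mu> * t)" by (simp only: mult_minus_right)
      then have "- (b * exp t) - a * exp (- t) - \<nu> * t \<le> - (a * exp (- t)) - ?\<mu> * t"
        using nn by linarith
      then have "exp (- (b * exp t) - a * exp (- t) - \<nu> * t) \<le> exp (- (a * exp (- t)) - ?\<mu> * t)"
        by (simp only: exp_le_cancel_iff)
      also have "\<dots> \<le> exp (- (b * exp t) + ?\<mu> * t) + exp (- (a * exp (- t)) - ?\<mu> * t)" by simp
      finally show ?thesis .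
    qed
    then show "norm (exp (- (b * exp t) - a * exp (- t) - \<nu> * t))
      \<le> norm (exp (- (b * exp t) + ?\<mu> * t) + exp (- (a * exp (- t)) - ?\<mu> * t))" by simp
  qed
qed simp

text \<open>The integral over the line of the derivative of the integrand of order \<nu>, which
  vanishes at both ends; multiplication by exp t or exp (-t) shifts the order by one.\<close>

lemma dexp_int_rec:
  assumes "a > 0" "b > 0"
  shows "b * dexp_int b a (\<nu> - 1) + \<nu> * dexp_int b a \<nu> = a * dexp_int b a (\<nu> + 1)"
proof -
  let ?e = "\<lambda>\<nu> t. exp (- (b * exp t) - a * exp (- t) - \<nu> * t) :: real"
  let ?f = "\<lambda>t. a * ?e (\<nu> + 1) t - b * ?e (\<nu> - 1) t - \<nu> * ?e \<nu> t"
  have int: "integrable lborel ?f"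
    using assms by (intro Bochner_Integration.integrable_diff integrable_mult_right integrable_dexp)
  have "(LBINT t=-\<infinity>..\<infinity>. ?f t) = 0 - 0"
  proof (rule interval_integral_FTC_integrable)
    show "(?e \<nu> has_vector_derivative ?f t) (at t)" for t
      unfolding has_real_derivative_iff_has_vector_derivative[symmetric]
      by (auto intro!: derivative_eq_intros simp: algebra_simps exp_add[symmetric] exp_diff[symmetric])
    show "set_integrable lborel (einterval (-\<infinity>) \<infinity>) ?f"
      using int by (simp add: set_integrable_def)
    have "(?e \<nu> \<longlongrightarrow> 0) at_top" using assms by real_asymp
    then show "((?e \<nu> \<circ> real_of_ereal) \<longlongrightarrow> 0) (at_left \<infinity>)"
      by (simp add: ereal_tendsto_simps)
    have "(?e \<nu> \<longlongrightarrow> 0) at_bot" using assms by real_asymp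
    then show "((?e \<nu> \<circ> real_of_ereal) \<longlongrightarrow> 0) (at_right (-\<infinity>))"
      by (simp add: ereal_tendsto_simps)
  qed (auto intro!: continuous_intros)
  then have "(\<integral>t. ?f t \<partial>lborel) = 0"
    by (simp add: interval_lebesgue_integral_def set_lebesgue_integral_def)
  then show ?thesis
    unfolding dexp_int_def using integrable_dexp[OF assms] by simp
qed

text \<open>The substitution t -> ln a - t exchanges the two exponentials; this is K_(-\<nu>) =
  K_\<nu>. It gives access to the limit a -> 0 at positive orders, where the integral itself blows
  up.\<close>

lemma dexp_int_reflect:
  assumes "a > 0"
  shows "dexp_int 1 a (- \<nu>) = a powr \<nu> * dexp_int 1 a \<nu>"
proof -
  have "dexp_int 1 a (- \<nu>) = \<bar>-1\<bar> *\<^sub>R (\<integral>t. exp (- (1 * exp (ln a + (-1) * t)) - a * exp (- (ln a + (-1) * t)) - (- \<nu>) * (ln a + (-1) * t)) \<partial>lborel)"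
    unfolding dexp_int_def by (rule lborel_integral_real_affine) simp
  also have "(\<lambda>t. exp (- (1 * exp (ln a + (-1) * t)) - a * exp (- (ln a + (-1) * t)) - (- \<nu>) * (ln a + (-1) * t)))
    = (\<lambda>t. a powr \<nu> * exp (- (1 * exp t) - a * exp (- t) - \<nu> * t))"
    using assms by (simp add: fun_eq_iff powr_def exp_add[symmetric] exp_diff exp_minus field_simps)
  finally show ?thesis by (simp add: dexp_int_def)
qed

lemma dexp_int_scale:
  assumes "x > 0"
  shows "dexp_int x x \<nu> = x powr \<nu> * dexp_int 1 (x\<^sup>2) \<nu>"
proof -
  have "dexp_int 1 (x\<^sup>2) \<nu> = \<bar>1\<bar> *\<^sub>R (\<integral>t. exp (- (1 * exp (ln x + 1 * t)) - x\<^sup>2 * exp (- (ln x + 1 * t)) - \<nu> * (ln x + 1 * t)) \<partial>lborel)"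
    unfolding dexp_int_def by (rule lborel_integral_real_affine) simp
  also have "(\<lambda>t. exp (- (1 * exp (ln x + 1 * t)) - x\<^sup>2 * exp (- (ln x + 1 * t)) - \<nu> * (ln x + 1 * t)))
    = (\<lambda>t. x powr (- \<nu>) * exp (- (x * exp t) - x * exp (- t) - \<nu> * t))"
    using assms by (simp add: fun_eq_iff powr_def exp_add[symmetric])
      (simp add: exp_add exp_diff exp_minus field_simps power2_eq_square)
  finally have "dexp_int 1 (x\<^sup>2) \<nu> = x powr (- \<nu>) * dexp_int x x \<nu>" by (simp add: dexp_int_def)
  then show ?thesis using assms by (simp add: powr_minus field_simps)
qed

lemma has_real_derivative_Re_of_real:
  fixes f :: "complex \<Rightarrow> complex"
  assumes "(f has_field_derivative D) (at (of_real x))"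
  shows "((\<lambda>x. Re (f (of_real x))) has_real_derivative Re D) (at x)"
  unfolding has_real_derivative_iff_has_vector_derivative
  by (intro bounded_linear.has_vector_derivative[OF bounded_linear_Re] has_vector_derivative_real_field assms)

text \<open>The parameter is made complex so that differentiation under the integral needs only a
  bound on the integrand: on the disc of radius a/2 around a, the real part stays above a/2.\<close>

lemma DERIV_dexp_int:
  assumes "a > 0"
  shows "((\<lambda>a. dexp_int 1 a \<nu>) has_real_derivative - dexp_int 1 a (\<nu> + 1)) (at a)"
proof -
  let ?f = "\<lambda>(q::complex) t. exp (- of_real (exp t) - q * of_real (exp (- t)) - of_real (\<nu> * t))"
  let ?S = "{q. Re q > 0}"
  have fr: "?f (of_real q) t = of_real (exp (- (1 * exp t) - q * exp (- t) - \<nu> * t))" for q t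
    by (simp add: exp_of_real[symmetric])
  have fI: "(\<integral>t. ?f (of_real q) t \<partial>lborel) = of_real (dexp_int 1 q \<nu>)" for q
    unfolding fr dexp_int_def by (rule integral_complex_of_real)
  have "((\<lambda>q. \<integral>t. ?f q t \<partial>lborel) has_field_derivative (\<integral>t. deriv (\<lambda>q. ?f q t) (of_real a) \<partial>lborel)) (at (of_real a))"
  proof (rule has_field_derivative_integral_param[where S = ?S])
    show "open ?S" by (rule open_halfspace_Re_gt)
    show "of_real a \<in> ?S" using assms by simp
    show "(\<lambda>q. ?f q t) holomorphic_on ?S" for t by (intro holomorphic_intros)
    show "?f q \<in> borel_measurable lborel" for q by measurable
    show "\<exists>r>0. \<exists>h. ball (of_real a) r \<subseteq> ?S \<and> integrable lborel h \<and>
                (\<forall>q\<in>ball (of_real a) r. \<forall>t\<in>space lborel. norm (?f q t) \<le> h t)"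
    proof (intro exI conjI ballI)
      show "a / 2 > 0" using assms by simp
      have re: "Re q > a / 2" if "q \<in> ball (of_real a) (a / 2)" for q
        using that abs_Re_le_cmod[of "of_real a - q"] by (simp add: dist_norm)
      show "ball (of_real a) (a / 2) \<subseteq> ?S"
      proof
        fix q :: complex assume "q \<in> ball (of_real a) (a / 2)"
        from re[OF this] assms show "q \<in> ?S" by simp
      qed
      show "integrable lborel (\<lambda>t. exp (- (1 * exp t) - a / 2 * exp (- t) - \<nu> * t))"
        using assms by (intro integrable_dexp) auto
      fix q t assume q: "q \<in> ball (complex_of_real a) (a / 2)"
      have "a / 2 * exp (- t) \<le> Re q * exp (- t)" using re[OF q] by (intro mult_right_mono) auto
      then show "norm (?f q t) \<le> exp (- (1 * exp t) - a / 2 * exp (- t) - \<nu> * t)"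
        by simp
    qed
  qed
  moreover have "deriv (\<lambda>q. ?f q t) (of_real a) = - of_real (exp (- (1 * exp t) - a * exp (- t) - (\<nu> + 1) * t))" for t
  proof (rule DERIV_imp_deriv)
    have e: "exp (- t) * exp (- (1 * exp t) - a * exp (- t) - \<nu> * t) = exp (- (1 * exp t) - a * exp (- t) - (\<nu> + 1) * t)"
      unfolding exp_add[symmetric] by (simp add: algebra_simps)
    have "((\<lambda>q. ?f q t) has_field_derivative - of_real (exp (- t)) * ?f (of_real a) t) (at (of_real a))"
      by (auto intro!: derivative_eq_intros)
    then show "((\<lambda>q. ?f q t) has_field_derivative - of_real (exp (- (1 * exp t) - a * exp (- t) - (\<nu> + 1) * t))) (at (of_real a))"
      unfolding fr by (simp only: e minus_mult_left[symmetric] of_real_mult[symmetric])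
  qed
  ultimately have "((\<lambda>q. \<integral>t. ?f q t \<partial>lborel) has_field_derivative - of_real (dexp_int 1 a (\<nu> + 1))) (at (of_real a))"
    by (simp only: dexp_int_def integral_complex_of_real integral_minus)
  then have "((\<lambda>x. Re (\<integral>t. ?f (of_real x) t \<partial>lborel)) has_real_derivative Re (- of_real (dexp_int 1 a (\<nu> + 1)))) (at a)"
    by (rule has_real_derivative_Re_of_real)
  then show ?thesis unfolding fI by simp
qed

lemma tendsto_dexp_int_0:
  assumes "\<nu> < 0"
  shows "((\<lambda>a. dexp_int 1 a \<nu>) \<longlongrightarrow> Gamma (- \<nu>)) (at_right 0)"
proof -
  have "((\<lambda>a. \<integral>t. exp (- (1 * exp t) - a * exp (- t) - \<nu> * t) \<partial>lborel) \<longlongrightarrow> (\<integral>t. exp (- exp t + (- \<nu>) * t) \<partial>lborel)) (at_right 0)"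
    unfolding tendsto_at_iff_sequentially o_def
  proof (intro allI impI)
    fix X :: "nat \<Rightarrow> real" assume X: "\<forall>i. X i \<in> {0<..} - {0}" "X \<longlonglongrightarrow> 0"
    show "(\<lambda>i. \<integral>t. exp (- (1 * exp t) - X i * exp (- t) - \<nu> * t) \<partial>lborel) \<longlonglongrightarrow> (\<integral>t. exp (- exp t + (- \<nu>) * t) \<partial>lborel)"
    proof (rule integral_dominated_convergence)
      show "integrable lborel (\<lambda>t. exp (- exp t + (- \<nu>) * t))"
        using assms by (intro Gamma_exp_integral) simp
      show "AE t in lborel. (\<lambda>i. exp (- (1 * exp t) - X i * exp (- t) - \<nu> * t)) \<longlonglongrightarrow> exp (- exp t + (- \<nu>) * t)"
      proof (rule AE_I2)
        fix t
        have "(\<lambda>i. exp (- (1 * exp t) - X i * exp (- t) - \<nu> * t)) \<longlonglongrightarrow> exp (- (1 * exp t) - 0 * exp (- t) - \<nu> * t)"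
          by (intro tendsto_intros X)
        then show "(\<lambda>i. exp (- (1 * exp t) - X i * exp (- t) - \<nu> * t)) \<longlonglongrightarrow> exp (- exp t + (- \<nu>) * t)" by simp
      qed
      show "AE t in lborel. norm (exp (- (1 * exp t) - X i * exp (- t) - \<nu> * t)) \<le> exp (- exp t + (- \<nu>) * t)" for i
        using X by (auto intro!: AE_I2 mult_nonneg_nonneg simp: less_imp_le)
    qed simp_all
  qed
  then show ?thesis using Gamma_exp_integral(2)[of "- \<nu>"] assms by (simp add: dexp_int_def)
qed

section \<open>Uniqueness for the modified Bessel equation at its singular point\<close>

lemma nonneg_of_deriv_nonneg_at_right:
  fixes f :: "real \<Rightarrow> real"
  assumes "\<And>x. 0 < x \<Longrightarrow> x \<le> b \<Longrightarrow> (f has_real_derivative f' x) (at x)"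
    and "\<And>x. 0 < x \<Longrightarrow> x \<le> b \<Longrightarrow> 0 \<le> f' x"
    and "(f \<longlongrightarrow> 0) (at_right 0)" and "b > 0"
  shows "f b \<ge> 0"
proof (rule tendsto_upperbound[OF assms(3)])
  have "eventually (\<lambda>x. x \<in> {0<..<b}) (at_right 0)"
    using \<open>b > 0\<close> by (rule eventually_at_right_real)
  then show "eventually (\<lambda>x. f x \<le> f b) (at_right 0)"
  proof eventually_elim
    case (elim x)
    show ?case
      by (rule DERIV_nonneg_imp_nondecreasing) (use elim assms(1,2) in \<open>force+\<close>)
  qed
qed simp

text \<open>Solutions of \<open>q D'' + m D' = D\<close> vanishing at \<open>0\<close>, written as a first-order system with
  \<open>D\<^sub>1 = - D'\<close>. The products \<open>D D'\<close> are nonnegative, so \<open>D\<^sup>2\<close> increases; this bounds \<open>D'\<close> by a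
  multiple of \<open>D\<close>, and Gronwall's argument applies although the equation is singular at \<open>0\<close>.\<close>

lemma bessel_ode_unique:
  fixes D0 D1 :: "real \<Rightarrow> real"
  assumes m: "m > 0"
    and d0: "\<And>q. q > 0 \<Longrightarrow> (D0 has_real_derivative - D1 q) (at q)"
    and d1: "\<And>q. q > 0 \<Longrightarrow> ((\<lambda>q. q powr m * D1 q) has_real_derivative - (q powr (m - 1) * D0 q)) (at q)"
    and l0: "(D0 \<longlongrightarrow> 0) (at_right 0)" and l1: "((\<lambda>q. q powr m * D1 q) \<longlongrightarrow> 0) (at_right 0)"
    and b: "b > 0"
  shows "D0 b = 0"
proof -
  have prod: "- (D0 q * D1 q) \<ge> 0" if q: "q > 0" for q
  proof -
    have "- (D0 q * (q powr m * D1 q)) \<ge> 0"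
    proof (rule nonneg_of_deriv_nonneg_at_right[where f = "\<lambda>q. - (D0 q * (q powr m * D1 q))"
             and f' = "\<lambda>q. q powr m * D1 q ^ 2 + q powr (m - 1) * D0 q ^ 2"])
      show "((\<lambda>q. - (D0 q * (q powr m * D1 q))) has_real_derivative q powr m * D1 q ^ 2 + q powr (m - 1) * D0 q ^ 2) (at q)"
        if "q > 0" for q
        by (rule derivative_eq_intros d0[OF that] d1[OF that] refl)+ (simp add: power2_eq_square)
      have "((\<lambda>q. - (D0 q * (q powr m * D1 q))) \<longlongrightarrow> - (0 * 0)) (at_right 0)"
        by (intro tendsto_intros l0 l1)
      then show "((\<lambda>q. - (D0 q * (q powr m * D1 q))) \<longlongrightarrow> 0) (at_right 0)" by simp
    qed (use q in auto)
    then have "q powr m * - (D0 q * D1 q) \<ge> 0" by (simp add: mult_ac)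
    moreover have "q powr m > 0" using q by simp
    ultimately show ?thesis by (metis zero_le_mult_iff less_le_not_le)
  qed
  have mono: "D0 p ^ 2 \<le> D0 q ^ 2" if "0 < p" "p \<le> q" for p q
  proof (rule DERIV_nonneg_imp_nondecreasing[OF that(2)])
    fix x assume x: "p \<le> x" "x \<le> q"
    have "((\<lambda>x. D0 x ^ 2) has_real_derivative 2 * - (D0 x * D1 x)) (at x)"
      using x that by (auto intro!: derivative_eq_intros d0)
    then show "\<exists>y. ((\<lambda>x. D0 x ^ 2) has_real_derivative y) (at x) \<and> 0 \<le> y"
      using prod[of x] x that by (intro exI[of _ "2 * - (D0 x * D1 x)"]) auto
  qed
  have bound: "\<bar>D1 q\<bar> \<le> \<bar>D0 q\<bar> / m" if q: "q > 0" for q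
  proof -
    have D0: "\<bar>D0 x\<bar> \<le> \<bar>D0 q\<bar>" if "0 < x" "x \<le> q" for x
      using mono[OF that] by (simp add: abs_le_square_iff)
    have lim: "((\<lambda>x. \<bar>D0 q\<bar> * x powr m / m + s * (x powr m * D1 x)) \<longlongrightarrow> 0) (at_right 0)" for s
    proof -
      have "((\<lambda>x. x powr m) \<longlongrightarrow> 0) (at_right 0)" using m by real_asymp
      then have "((\<lambda>x. \<bar>D0 q\<bar> * x powr m / m + s * (x powr m * D1 x)) \<longlongrightarrow> \<bar>D0 q\<bar> * 0 / m + s * 0) (at_right 0)"
        using m by (intro tendsto_intros l1) auto
      then show ?thesis by simp
    qed
    \<comment> \<open>By \<open>D0\<close>, the derivative of x^m D1 is at most |D0 q| x^(m-1) in
      modulus on (0, q]; integrating from 0 yields the factor 1/m. The two signs s = 1 and s = -1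
      together bound |D1 q|.\<close>
    have "\<bar>D0 q\<bar> * q powr m / m + s * (q powr m * D1 q) \<ge> 0" if s: "\<bar>s\<bar> = 1" for s
    proof (rule nonneg_of_deriv_nonneg_at_right[where f' = "\<lambda>x. \<bar>D0 q\<bar> * x powr (m - 1) + s * - (x powr (m - 1) * D0 x)", OF _ _ lim])
      fix x assume x: "0 < x" "x \<le> q"
      show "((\<lambda>x. \<bar>D0 q\<bar> * x powr m / m + s * (x powr m * D1 x)) has_real_derivative
          \<bar>D0 q\<bar> * x powr (m - 1) + s * - (x powr (m - 1) * D0 x)) (at x)"
        by (rule derivative_eq_intros d1 refl | use x m in force)+
      have "s * D0 x \<le> \<bar>s * D0 x\<bar>" by simp
      also have "\<dots> \<le> \<bar>D0 q\<bar>" using s D0[OF x] by (simp add: abs_mult)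
      finally have "0 \<le> (\<bar>D0 q\<bar> - s * D0 x) * x powr (m - 1)" by simp
      then show "0 \<le> \<bar>D0 q\<bar> * x powr (m - 1) + s * - (x powr (m - 1) * D0 x)"
        by (simp add: algebra_simps)
    qed (rule q)
    from this[of 1] this[of "-1"] have "q powr m * \<bar>D1 q\<bar> \<le> q powr m * (\<bar>D0 q\<bar> / m)"
      by (auto simp: abs_if mult_ac)
    then show ?thesis by (rule mult_left_le_imp_le) (use q in simp)
  qed
  \<comment> \<open>The bound gives (D0^2)' = - 2 D0 D1 \<le> (2/m) D0^2, so D0^2 exp (- 2 q/m)
    decreases from its limit 0 although it is nonnegative.\<close>
  have "- (D0 b ^ 2 * exp (- (2 / m) * b)) \<ge> 0"
  proof (rule nonneg_of_deriv_nonneg_at_right[where f = "\<lambda>q. - (D0 q ^ 2 * exp (- (2 / m) * q))"])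
    fix q :: real assume q: "0 < q"
    show "((\<lambda>q. - (D0 q ^ 2 * exp (- (2 / m) * q))) has_real_derivative
        2 * exp (- (2 / m) * q) * (D0 q ^ 2 / m + D0 q * D1 q)) (at q)"
      by (rule derivative_eq_intros d0[OF q] refl)+ (simp add: power2_eq_square algebra_simps)
    have "- (D0 q * D1 q) \<le> \<bar>D0 q\<bar> * \<bar>D1 q\<bar>" by (metis abs_ge_minus_self abs_mult)
    also have "\<dots> \<le> \<bar>D0 q\<bar> * (\<bar>D0 q\<bar> / m)" by (intro mult_left_mono bound q) simp
    also have "\<dots> = D0 q ^ 2 / m" by (simp add: power2_eq_square)
    finally show "0 \<le> 2 * exp (- (2 / m) * q) * (D0 q ^ 2 / m + D0 q * D1 q)" by simp
  next
    have "((\<lambda>q. - (D0 q ^ 2 * exp (- (2 / m) * q))) \<longlongrightarrow> - (0 ^ 2 * exp (- (2 / m) * 0))) (at_right 0)"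
      by (intro tendsto_intros l0)
    then show "((\<lambda>q. - (D0 q ^ 2 * exp (- (2 / m) * q))) \<longlongrightarrow> 0) (at_right 0)" by simp
  qed (rule b)
  then have "D0 b ^ 2 * exp (- (2 / m) * b) \<le> 0" by linarith
  then have "D0 b ^ 2 \<le> 0" by (simp add: mult_le_0_iff)
  then show ?thesis by simp
qed

section \<open>K_\<nu> on the positive axis: comparison of series and integral\<close>

lemma bessel_ser_of_real: "bessel_ser \<nu> (of_real q) = of_real (Re (bessel_ser \<nu> (of_real q)))"
proof -
  have "complex_of_real (Re (rGamma (of_real \<nu> + of_nat k + 1) / fact k * of_real q ^ k))
      = rGamma (of_real \<nu> + of_nat k + 1) / fact k * of_real q ^ k" for k
  proof -
    have "rGamma (of_real \<nu> + of_nat k + 1) / fact k * (of_real q :: complex) ^ k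
        = of_real (rGamma (\<nu> + real k + 1) / fact k * q ^ k)"
      by (simp flip: rGamma_complex_of_real)
    then show ?thesis by (simp only: Re_complex_of_real)
  qed
  moreover have "(\<lambda>k. complex_of_real (Re (rGamma (of_real \<nu> + of_nat k + 1) / fact k * of_real q ^ k)))
      sums of_real (Re (bessel_ser \<nu> (of_real q)))"
    by (intro sums_of_real sums_Re sums_bessel_ser)
  ultimately show ?thesis using sums_bessel_ser sums_unique2 by simp blast
qed

abbreviation bessel_ser_real :: "real \<Rightarrow> real \<Rightarrow> real" where
  "bessel_ser_real \<nu> q \<equiv> Re (bessel_ser \<nu> (of_real q))"

lemma DERIV_bessel_ser_real: "(bessel_ser_real \<nu> has_real_derivative bessel_ser_real (\<nu> + 1) q) (at q)"
  using has_real_derivative_Re_of_real[OF has_field_derivative_bessel_ser[OF DERIV_ident]] by simp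

lemma bessel_ser_real_rec:
  "bessel_ser_real \<nu> q = (\<nu> + 1) * bessel_ser_real (\<nu> + 1) q + q * bessel_ser_real (\<nu> + 2) q"
  using arg_cong[OF bessel_ser_rec[of \<nu> "of_real q"], of Re] by simp

lemma tendsto_bessel_ser_real_0: "(bessel_ser_real \<nu> \<longlongrightarrow> rGamma (\<nu> + 1)) (at_right 0)"
proof -
  have "isCont (bessel_ser_real \<nu>) 0" by (rule DERIV_isCont[OF DERIV_bessel_ser_real])
  moreover have "bessel_ser_real \<nu> 0 = rGamma (\<nu> + 1)"
    using rGamma_complex_of_real[of "\<nu> + 1"] by simp
  ultimately show ?thesis
    by (metis filterlim_at_split isCont_def)
qed

text \<open>This is 2 q^(-\<nu>/2) K_\<nu>(2 sqrt q) for noninteger \<nu>, the counterpart of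
  \<open>dexp_int 1 q \<nu>\<close>. At integers division by zero makes it 0, which satisfies the
  relations below trivially, so they need no condition on \<nu>.\<close>

definition besselK_ser :: "real \<Rightarrow> real \<Rightarrow> real" where
  "besselK_ser \<nu> q = pi / sin (\<nu> * pi) * (q powr (- \<nu>) * bessel_ser_real (- \<nu>) q - bessel_ser_real \<nu> q)"

lemma besselK_ser_Suc:
  "besselK_ser (\<nu> + 1) q = - pi / sin (\<nu> * pi) * (q powr (- \<nu> - 1) * bessel_ser_real (- \<nu> - 1) q - bessel_ser_real (\<nu> + 1) q)"
proof -
  have "sin ((\<nu> + 1) * pi) = - sin (\<nu> * pi)" by (simp add: ring_distribs)
  then show ?thesis by (simp add: besselK_ser_def)
qed

text \<open>The product rule leaves terms of orders - \<nu> and - \<nu> + 1, which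
  \<open>bessel_ser_real_rec\<close> at order - \<nu> - 1 merges into one. The sign comes from sin
  ((\<nu> + 1) pi) = - sin (\<nu> pi).\<close>

lemma DERIV_besselK_ser:
  assumes "q > 0"
  shows "(besselK_ser \<nu> has_real_derivative - besselK_ser (\<nu> + 1) q) (at q)"
proof -
  have "((\<lambda>q. q powr (- \<nu>)) has_real_derivative - \<nu> * q powr (- \<nu> - 1)) (at q)"
    using assms by (auto intro!: derivative_eq_intros)
  from DERIV_mult[OF this DERIV_bessel_ser_real[of "- \<nu>" q]]
  have "((\<lambda>q. q powr (- \<nu>) * bessel_ser_real (- \<nu>) q) has_real_derivative
          - \<nu> * q powr (- \<nu> - 1) * bessel_ser_real (- \<nu>) q + bessel_ser_real (- \<nu> + 1) q * q powr (- \<nu>)) (at q)" .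
  also have "- \<nu> * q powr (- \<nu> - 1) * bessel_ser_real (- \<nu>) q + bessel_ser_real (- \<nu> + 1) q * q powr (- \<nu>)
     = q powr (- \<nu> - 1) * bessel_ser_real (- \<nu> - 1) q"
  proof -
    have p: "q powr (- \<nu>) = q * q powr (- \<nu> - 1)" using assms by (simp add: powr_diff)
    have r: "bessel_ser_real (- \<nu> - 1) q = - \<nu> * bessel_ser_real (- \<nu>) q + q * bessel_ser_real (- \<nu> + 1) q"
      using bessel_ser_real_rec[of "- \<nu> - 1" q] by simp
    show ?thesis unfolding p r by (simp add: algebra_simps)
  qed
  finally have "((\<lambda>q. pi / sin (\<nu> * pi) * (q powr (- \<nu>) * bessel_ser_real (- \<nu>) q - bessel_ser_real \<nu> q))
     has_real_derivative pi / sin (\<nu> * pi) * (q powr (- \<nu> - 1) * bessel_ser_real (- \<nu> - 1) q - bessel_ser_real (\<nu> + 1) q)) (at q)"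
    by (intro DERIV_cmult DERIV_diff DERIV_bessel_ser_real)
  then show ?thesis unfolding besselK_ser_Suc unfolding besselK_ser_def[abs_def] by simp
qed

text \<open>The relation that \<open>dexp_int_rec\<close> provides for \<open>dexp_int 1 q\<close>;
  with the derivative rule it makes the difference of the two functions a solution of the system in
  \<open>bessel_ode_unique\<close>.\<close>

lemma besselK_ser_rec:
  assumes "q > 0"
  shows "besselK_ser \<nu> q + (\<nu> + 1) * besselK_ser (\<nu> + 1) q = q * besselK_ser (\<nu> + 2) q"
proof -
  define s where "s = pi / sin (\<nu> * pi)"
  define A where "A = bessel_ser_real (- \<nu> - 2) q"
  have e2: "besselK_ser (\<nu> + 2) q = s * (q powr (- \<nu> - 2) * A - bessel_ser_real (\<nu> + 2) q)"
  proof -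
    have "sin ((\<nu> + 2) * pi) = sin (\<nu> * pi)" by (simp add: ring_distribs sin_add)
    then show ?thesis by (simp add: besselK_ser_def s_def A_def)
  qed
  have e1: "besselK_ser (\<nu> + 1) q = - s * (q powr (- \<nu> - 1) * bessel_ser_real (- \<nu> - 1) q - bessel_ser_real (\<nu> + 1) q)"
    unfolding besselK_ser_Suc s_def by simp
  have r1: "bessel_ser_real \<nu> q = (\<nu> + 1) * bessel_ser_real (\<nu> + 1) q + q * bessel_ser_real (\<nu> + 2) q"
    by (rule bessel_ser_real_rec)
  have r2: "A = (- \<nu> - 1) * bessel_ser_real (- \<nu> - 1) q + q * bessel_ser_real (- \<nu>) q"
  proof -
    have "- \<nu> - 2 + 1 = - \<nu> - 1" "- \<nu> - 2 + 2 = - \<nu>" by simp_all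
    with bessel_ser_real_rec[of "- \<nu> - 2" q] show ?thesis by (simp only: A_def)
  qed
  have p: "q powr (- \<nu>) = q * q powr (- \<nu> - 1)" "q * q powr (- \<nu> - 2) = q powr (- \<nu> - 1)"
    using assms by (simp_all add: powr_diff power2_eq_square)
  have "q * besselK_ser (\<nu> + 2) q = s * (q powr (- \<nu> - 1) * A - q * bessel_ser_real (\<nu> + 2) q)"
    unfolding e2 p(2)[symmetric] by (simp add: algebra_simps)
  also have "\<dots> = s * (q * q powr (- \<nu> - 1) * bessel_ser_real (- \<nu>) q - bessel_ser_real \<nu> q)
      + (\<nu> + 1) * besselK_ser (\<nu> + 1) q"
    unfolding e1 r2 r1 by (simp add: algebra_simps)
  also have "s * (q * q powr (- \<nu> - 1) * bessel_ser_real (- \<nu>) q - bessel_ser_real \<nu> q) = besselK_ser \<nu> q"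
    unfolding besselK_ser_def s_def p(1) ..
  finally show ?thesis by simp
qed

text \<open>In this strip both boundary conditions of \<open>bessel_ode_unique\<close> with m =
  \<nu> + 1 can be checked: - \<nu> > 0 gives the integral a finite limit at 0, and \<nu> + 1 > 0
  does the same for the reflected next order.\<close>

lemma dexp_int_eq_besselK_ser_strip:
  assumes "-1 < \<nu>" "\<nu> < 0" "q > 0"
  shows "dexp_int 1 q \<nu> = besselK_ser \<nu> q"
proof -
  define D where "D = (\<lambda>\<nu> q. dexp_int 1 q \<nu> - besselK_ser \<nu> q)"
  have sin: "sin (\<nu> * pi) \<noteq> 0"
  proof -
    have "- \<nu> * pi < 1 * pi" "0 < - \<nu> * pi"
      using assms by (intro mult_strict_right_mono mult_pos_pos; simp)+
    then have "sin (- \<nu> * pi) > 0" by (intro sin_gt_zero) auto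
    then show ?thesis by simp
  qed
  \<comment> \<open>Euler's reflection formula: it identifies the limits at 0 of the integral and of
    the series.\<close>
  have refl: "pi / sin (\<nu> * pi) * (rGamma (- \<nu>) * rGamma (\<nu> + 1)) = - 1"
  proof -
    have "complex_of_real (rGamma (- \<nu>) * rGamma (\<nu> + 1)) = of_real (sin (pi * - \<nu>) / pi)"
      using rGamma_reflection_complex[of "of_real (- \<nu>)"] rGamma_complex_of_real[of "- \<nu>"] rGamma_complex_of_real[of "\<nu> + 1"]
        sin_of_real[of "pi * - \<nu>", where 'a = complex] by (simp add: add.commute)
    then have "rGamma (- \<nu>) * rGamma (\<nu> + 1) = sin (pi * - \<nu>) / pi" by (simp only: of_real_eq_iff)
    then show ?thesis using sin by (simp add: field_simps)
  qed
  have G: "Gamma (- \<nu>) = - pi / sin (\<nu> * pi) * rGamma (\<nu> + 1)" "Gamma (\<nu> + 1) = - pi / sin (\<nu> * pi) * rGamma (- \<nu>)"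
  proof -
    have "rGamma (- \<nu>) \<noteq> 0" "rGamma (\<nu> + 1) \<noteq> 0" using refl by auto
    then show "Gamma (- \<nu>) = - pi / sin (\<nu> * pi) * rGamma (\<nu> + 1)" "Gamma (\<nu> + 1) = - pi / sin (\<nu> * pi) * rGamma (- \<nu>)"
      using refl sin by (auto simp: Gamma_def field_simps)
  qed
  have DD: "(D \<nu> has_real_derivative - D (\<nu> + 1) q) (at q)" if "q > 0" for \<nu> q
    unfolding D_def by (rule derivative_eq_intros DERIV_dexp_int DERIV_besselK_ser that refl)+ simp
  have rec: "D \<nu> q + (\<nu> + 1) * D (\<nu> + 1) q = q * D (\<nu> + 2) q" if "q > 0" for q
  proof -
    have "dexp_int 1 q \<nu> + (\<nu> + 1) * dexp_int 1 q (\<nu> + 1) = q * dexp_int 1 q (\<nu> + 2)"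
      using dexp_int_rec[OF that zero_less_one, of "\<nu> + 1"] by (simp add: add_ac)
    with besselK_ser_rec[OF that, of \<nu>] show ?thesis by (simp add: D_def algebra_simps)
  qed
  have "D \<nu> q = 0"
  proof (rule bessel_ode_unique[where m = "\<nu> + 1" and ?D0.0 = "D \<nu>" and ?D1.0 = "D (\<nu> + 1)"])
    show "((\<lambda>q. q powr (\<nu> + 1) * D (\<nu> + 1) q) has_real_derivative - (q powr (\<nu> + 1 - 1) * D \<nu> q)) (at q)" if q: "q > 0" for q
    proof -
      have "((\<lambda>q. q powr (\<nu> + 1) * D (\<nu> + 1) q) has_real_derivative
          (\<nu> + 1) * q powr \<nu> * D (\<nu> + 1) q + q powr (\<nu> + 1) * - D (\<nu> + 2) q) (at q)"
      proof -
        have "((\<lambda>q. q powr (\<nu> + 1)) has_real_derivative (\<nu> + 1) * q powr \<nu>) (at q)"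
          using q by (auto intro!: derivative_eq_intros)
        from DERIV_mult[OF this, of "D (\<nu> + 1)" "- D (\<nu> + 2) q"] show ?thesis
          using DD[OF q, of "\<nu> + 1"] by (simp add: add_ac mult.commute)
      qed
      moreover have "(\<nu> + 1) * q powr \<nu> * D (\<nu> + 1) q + q powr (\<nu> + 1) * - D (\<nu> + 2) q = - (q powr (\<nu> + 1 - 1) * D \<nu> q)"
        using rec[OF q] q by (simp add: powr_add) algebra
      ultimately show ?thesis by simp
    qed
    have "((\<lambda>q. q powr (- \<nu>)) \<longlongrightarrow> 0) (at_right 0)" using assms by real_asymp
    then have "(besselK_ser \<nu> \<longlongrightarrow> pi / sin (\<nu> * pi) * (0 * rGamma (- \<nu> + 1) - rGamma (\<nu> + 1))) (at_right 0)"
      unfolding besselK_ser_def[abs_def] by (intro tendsto_intros tendsto_bessel_ser_real_0)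
    then have "(D \<nu> \<longlongrightarrow> Gamma (- \<nu>) - pi / sin (\<nu> * pi) * (0 * rGamma (- \<nu> + 1) - rGamma (\<nu> + 1))) (at_right 0)"
      unfolding D_def using assms by (intro tendsto_intros tendsto_dexp_int_0)
    then show "(D \<nu> \<longlongrightarrow> 0) (at_right 0)" using G(1) by simp
    \<comment> \<open>The second boundary condition: by reflection, q^(\<nu> + 1) turns order \<nu>
      + 1 of the integral into order - \<nu> - 1, which is negative, so the limit is again a value
      of Gamma.\<close>
    have "((\<lambda>q. q powr (\<nu> + 1)) \<longlongrightarrow> 0) (at_right 0)" using assms by real_asymp
    then have "((\<lambda>q. dexp_int 1 q (- \<nu> - 1) - - pi / sin (\<nu> * pi) * (bessel_ser_real (- \<nu> - 1) q - q powr (\<nu> + 1) * bessel_ser_real (\<nu> + 1) q))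
       \<longlongrightarrow> Gamma (- (- \<nu> - 1)) - - pi / sin (\<nu> * pi) * (rGamma (- \<nu> - 1 + 1) - 0 * rGamma (\<nu> + 1 + 1))) (at_right 0)"
      using assms by (intro tendsto_intros tendsto_dexp_int_0 tendsto_bessel_ser_real_0) auto
    then have "((\<lambda>q. dexp_int 1 q (- \<nu> - 1) - - pi / sin (\<nu> * pi) * (bessel_ser_real (- \<nu> - 1) q - q powr (\<nu> + 1) * bessel_ser_real (\<nu> + 1) q)) \<longlongrightarrow> 0) (at_right 0)"
      using G(2) by (simp add: add.commute)
    moreover have "eventually (\<lambda>q. dexp_int 1 q (- \<nu> - 1) - - pi / sin (\<nu> * pi) * (bessel_ser_real (- \<nu> - 1) q - q powr (\<nu> + 1) * bessel_ser_real (\<nu> + 1) q) = q powr (\<nu> + 1) * D (\<nu> + 1) q) (at_right 0)"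
      using eventually_at_right_less[of 0]
    proof eventually_elim
      case (elim q)
      have "dexp_int 1 q (- \<nu> - 1) = q powr (\<nu> + 1) * dexp_int 1 q (\<nu> + 1)"
        using dexp_int_reflect[OF elim, of "\<nu> + 1"] by simp
      moreover have "q powr (\<nu> + 1) * q powr (- \<nu> - 1) = 1"
        using elim by (simp flip: powr_add)
      ultimately show ?case unfolding D_def besselK_ser_Suc by (simp add: algebra_simps)
    qed
    ultimately show "((\<lambda>q. q powr (\<nu> + 1) * D (\<nu> + 1) q) \<longlongrightarrow> 0) (at_right 0)"
      by (rule Lim_transform_eventually)
  qed (use assms DD in auto)
  then show ?thesis by (simp add: D_def)
qed

text \<open>Differentiating the identity in q raises the order by one on both sides, so it climbs
  from the strip in unit steps.\<close>

lemma dexp_int_eq_besselK_ser_shift: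
  assumes "-1 < \<nu>" "\<nu> < 0"
  shows "q > 0 \<Longrightarrow> dexp_int 1 q (\<nu> + real n) = besselK_ser (\<nu> + real n) q"
proof (induction n arbitrary: q)
  case 0
  then show ?case using dexp_int_eq_besselK_ser_strip assms by simp
next
  case (Suc n)
  have "((\<lambda>q. dexp_int 1 q (\<nu> + real n)) has_real_derivative - besselK_ser (\<nu> + real n + 1) q) (at q)"
  proof (rule has_field_derivative_transform_within_open[OF DERIV_besselK_ser[OF Suc.prems]])
    show "open {0::real<..}" "q \<in> {0<..}" using Suc.prems by auto
  qed (use Suc.IH in auto)
  then have "- besselK_ser (\<nu> + real n + 1) q = - dexp_int 1 q (\<nu> + real n + 1)"
    using DERIV_dexp_int[OF Suc.prems] by (rule DERIV_unique)
  then show ?case by (simp add: add_ac)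
qed

lemma dexp_int_eq_besselK_ser:
  assumes "\<nu> > -1" "\<nu> \<notin> \<int>" "q > 0"
  shows "dexp_int 1 q \<nu> = besselK_ser \<nu> q"
proof -
  \<comment> \<open>As \<nu> > -1, the integer under \<open>nat\<close> is nonnegative; as \<nu> is
    not an integer, \<nu> - n lies strictly between -1 and 0.\<close>
  define n where "n = nat (\<lfloor>\<nu>\<rfloor> + 1)"
  have n: "real n = of_int \<lfloor>\<nu>\<rfloor> + 1" using assms(1) by (simp add: n_def) linarith
  have "of_int \<lfloor>\<nu>\<rfloor> \<noteq> \<nu>" using assms(2) by (metis Ints_of_int)
  then have "-1 < \<nu> - real n" "\<nu> - real n < 0"
    unfolding n using of_int_floor_le[of \<nu>] by linarith+
  from dexp_int_eq_besselK_ser_shift[OF this assms(3), of n] show ?thesis by simp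
qed

section \<open>The integral for K_\<nu> at complex argument and at integer orders\<close>

definition besselK_int :: "real \<Rightarrow> complex \<Rightarrow> complex" where
  "besselK_int \<nu> w = (\<integral>t. exp (- w * of_real (cosh t) - of_real \<nu> * of_real t) \<partial>lborel) / 2"

lemma cosh_split: "- x * cosh t - \<nu> * t = - (x / 2 * exp t) - x / 2 * exp (- t) - \<nu> * (t::real)"
  by (simp add: cosh_def field_simps)

lemma besselK_int_of_real: "besselK_int \<nu> (of_real x) = of_real (dexp_int (x / 2) (x / 2) \<nu> / 2)"
proof -
  have "exp (- complex_of_real x * of_real (cosh t) - of_real \<nu> * of_real t)
      = of_real (exp (- (x / 2 * exp t) - x / 2 * exp (- t) - \<nu> * t))" for t
    unfolding cosh_split[symmetric] by (simp flip: exp_of_real)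
  then show ?thesis
    by (simp only: besselK_int_def dexp_int_def integral_complex_of_real of_real_divide of_real_numeral)
qed

lemma holomorphic_on_besselK_int: "besselK_int \<nu> holomorphic_on {w. Re w > 0}"
proof -
  let ?f = "\<lambda>w t. exp (- w * of_real (cosh t) - of_real \<nu> * of_real t) :: complex"
  have "(\<lambda>w. \<integral>t. ?f w t \<partial>lborel) holomorphic_on {w. Re w > 0}"
  proof (rule holomorphic_integral_param)
    show "open {w. Re w > 0}" by (rule open_halfspace_Re_gt)
    show "(\<lambda>w. ?f w t) holomorphic_on {w. Re w > 0}" for t by (intro holomorphic_intros)
    show "?f w \<in> borel_measurable lborel" for w
      unfolding measurable_lborel2 by (intro borel_measurable_continuous_onI continuous_intros)
    fix w0 :: complex assume "w0 \<in> {w. Re w > 0}"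
    then have w0: "Re w0 > 0" by simp
    show "\<exists>r>0. \<exists>h. ball w0 r \<subseteq> {w. Re w > 0} \<and> integrable lborel h \<and>
                (\<forall>w\<in>ball w0 r. \<forall>t\<in>space lborel. norm (?f w t) \<le> h t)"
    proof (intro exI conjI ballI)
      show "Re w0 / 2 > 0" using w0 by simp
      have re: "Re w > Re w0 / 2" if "w \<in> ball w0 (Re w0 / 2)" for w
        using that abs_Re_le_cmod[of "w0 - w"] by (simp add: dist_norm)
      show "ball w0 (Re w0 / 2) \<subseteq> {w. Re w > 0}"
      proof
        fix w assume "w \<in> ball w0 (Re w0 / 2)"
        from re[OF this] w0 show "w \<in> {w. Re w > 0}" by simp
      qed
      show "integrable lborel (\<lambda>t. exp (- (Re w0 / 2 / 2 * exp t) - Re w0 / 2 / 2 * exp (- t) - \<nu> * t))"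
        using w0 by (intro integrable_dexp) auto
      fix w t assume w: "w \<in> ball w0 (Re w0 / 2)"
      have "- Re w * cosh t \<le> - (Re w0 / 2) * cosh t"
        using re[OF w] cosh_real_pos[of t] by (intro mult_right_mono) auto
      then show "norm (?f w t) \<le> exp (- (Re w0 / 2 / 2 * exp t) - Re w0 / 2 / 2 * exp (- t) - \<nu> * t)"
        unfolding cosh_split[symmetric] by simp
    qed
  qed
  then show ?thesis unfolding besselK_int_def[abs_def] by (intro holomorphic_intros) auto
qed

text \<open>Needed at integer orders, where \<open>besselK\<close> is a limit over orders. The order
  is made complex; within distance 1 of \<nu> the integrand is bounded by the sum of the kernels of
  orders \<nu> + 1 and \<nu> - 1, one for each sign of t.\<close>

lemma isCont_besselK_int_order:
  assumes "Re w > 0"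
  shows "isCont (\<lambda>\<nu>. besselK_int \<nu> w) \<nu>"
proof -
  let ?f = "\<lambda>s t. exp (- w * of_real (cosh t) - s * of_real t) :: complex"
  let ?x = "Re w"
  let ?h = "\<lambda>\<sigma> t. exp (- (?x / 2 * exp t) - ?x / 2 * exp (- t) - \<sigma> * t)"
  have "((\<lambda>s. \<integral>t. ?f s t \<partial>lborel) has_field_derivative (\<integral>t. deriv (\<lambda>s. ?f s t) (of_real \<nu>) \<partial>lborel)) (at (of_real \<nu>))"
  proof (rule has_field_derivative_integral_param[where S = UNIV])
    show "(\<lambda>s. ?f s t) holomorphic_on UNIV" for t by (intro holomorphic_intros)
    show "?f s \<in> borel_measurable lborel" for s
      unfolding measurable_lborel2 by (intro borel_measurable_continuous_onI continuous_intros)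
    show "\<exists>r>0. \<exists>h. ball (of_real \<nu>) r \<subseteq> UNIV \<and> integrable lborel h \<and>
                (\<forall>s\<in>ball (of_real \<nu>) r. \<forall>t\<in>space lborel. norm (?f s t) \<le> h t)"
    proof (intro exI conjI ballI)
      show "(1::real) > 0" by simp
      show "integrable lborel (\<lambda>t. ?h (\<nu> + 1) t + ?h (\<nu> - 1) t)"
        using assms by (intro Bochner_Integration.integrable_add integrable_dexp) auto
      fix s :: complex and t :: real assume s: "s \<in> ball (of_real \<nu>) 1"
      then have "\<bar>\<nu> - Re s\<bar> < 1"
        using abs_Re_le_cmod[of "of_real \<nu> - s"] by (simp add: dist_norm)
      then have "- (Re s * t) \<le> - ((\<nu> + 1) * t) \<or> - (Re s * t) \<le> - ((\<nu> - 1) * t)"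
      proof (cases "t \<ge> 0")
        case True
        then have "(\<nu> - 1) * t \<le> Re s * t"
          using \<open>\<bar>\<nu> - Re s\<bar> < 1\<close> by (intro mult_right_mono) linarith+
        then show ?thesis by simp
      next
        case False
        then have "(\<nu> + 1) * t \<le> Re s * t"
          using \<open>\<bar>\<nu> - Re s\<bar> < 1\<close> by (intro mult_right_mono_neg) linarith+
        then show ?thesis by simp
      qed
      then have "exp (- ?x * cosh t - Re s * t) \<le> exp (- ?x * cosh t - (\<nu> + 1) * t)
              \<or> exp (- ?x * cosh t - Re s * t) \<le> exp (- ?x * cosh t - (\<nu> - 1) * t)"
        by auto
      then have "exp (- ?x * cosh t - Re s * t) \<le> ?h (\<nu> + 1) t + ?h (\<nu> - 1) t"
        unfolding cosh_split by (auto intro: add_increasing add_increasing2)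
      then show "norm (?f s t) \<le> ?h (\<nu> + 1) t + ?h (\<nu> - 1) t" by simp
    qed auto
  qed auto
  from DERIV_isCont[OF this] have "isCont (\<lambda>\<nu>. \<integral>t. ?f (of_real \<nu>) t \<partial>lborel) \<nu>"
    by (intro isCont_o2[where g = "\<lambda>s. \<integral>t. ?f s t \<partial>lborel" and f = of_real]) (auto intro: continuous_intros)
  then show ?thesis unfolding besselK_int_def[abs_def] by (intro continuous_intros) auto
qed

lemma holomorphic_on_besselI: "besselI \<nu> holomorphic_on (- \<real>\<^sub>\<le>\<^sub>0)"
proof -
  have "(\<lambda>w. (w / 2) powr of_real \<nu> * bessel_ser \<nu> (w\<^sup>2 / 4)) holomorphic_on (- \<real>\<^sub>\<le>\<^sub>0)"
    by (intro holomorphic_intros) (auto simp: complex_nonpos_Reals_iff)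
  then show ?thesis by (simp add: besselI_eq[abs_def])
qed

lemma besselK_nonint_of_real:
  assumes "\<nu> > -1" "\<nu> \<notin> \<int>" "x > 0"
  shows "besselK_nonint \<nu> (of_real x) = besselK_int \<nu> (of_real x)"
proof -
  define y where "y = x / 2"
  have y: "y > 0" "(complex_of_real x)\<^sup>2 / 4 = of_real (y\<^sup>2)" "complex_of_real x / 2 = of_real y"
    using assms by (simp_all add: y_def power_divide)
  have I: "besselI \<mu> (of_real x) = of_real (y powr \<mu> * bessel_ser_real \<mu> (y\<^sup>2))" for \<mu>
    unfolding besselI_eq y(2,3) by (subst bessel_ser_of_real) (use y(1) in \<open>simp add: powr_of_real\<close>)
  have "y powr \<nu> * (y\<^sup>2) powr (- \<nu>) = y powr (- \<nu>)"
    using y by (simp add: powr_powr flip: powr_numeral powr_add)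
  then have "pi / 2 * (y powr (- \<nu>) * bessel_ser_real (- \<nu>) (y\<^sup>2) - y powr \<nu> * bessel_ser_real \<nu> (y\<^sup>2)) / sin (\<nu> * pi)
      = y powr \<nu> * besselK_ser \<nu> (y\<^sup>2) / 2"
    unfolding besselK_ser_def by (simp add: field_simps)
  also have "\<dots> = y powr \<nu> * dexp_int 1 (y\<^sup>2) \<nu> / 2"
    using dexp_int_eq_besselK_ser[OF assms(1,2), of "y\<^sup>2"] y by simp
  also have "\<dots> = dexp_int y y \<nu> / 2"
    using dexp_int_scale[OF y(1)] by simp
  finally show ?thesis
    unfolding besselK_int_of_real besselK_nonint_def I y_def[symmetric]
    by (simp flip: of_real_mult of_real_diff of_real_divide)
qed

text \<open>Being connected with more than one point, the positive axis has 1 as a limit point, as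
  the identity theorem demands.\<close>

lemma analytic_continuation_pos_real:
  assumes "f holomorphic_on S" "g holomorphic_on S" "open S" "connected S"
    and sub: "complex_of_real ` {0<..} \<subseteq> S"
    and eq: "\<And>x. x > 0 \<Longrightarrow> f (of_real x) = g (of_real x)" and "w \<in> S"
  shows "f w = g w"
proof -
  have "connected (complex_of_real ` {0<..})"
    by (intro connected_continuous_image continuous_intros) auto
  moreover have one: "1 \<in> complex_of_real ` {0<..}" by (rule image_eqI[of _ _ 1]) auto
  moreover have "2 \<in> complex_of_real ` {0<..}" by (rule image_eqI[of _ _ 2]) auto
  then have "complex_of_real ` {0<..} \<noteq> {x}" for x
    using one by (metis one_eq_numeral_iff singletonD semiring_norm(83))
  ultimately have lim: "1 islimpt complex_of_real ` {0<..}" by (rule connected_imp_perfect)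
  have "f w - g w = 0"
    by (rule analytic_continuation[where f = "\<lambda>w. f w - g w" and S = S and U = "complex_of_real ` {0<..}" and \<xi> = 1])
      (use assms lim one in \<open>auto intro!: holomorphic_intros\<close>)
  then show ?thesis by simp
qed

lemma besselK_nonint_eq_int:
  assumes "\<nu> > -1" "\<nu> \<notin> \<int>" "Re w > 0"
  shows "besselK_nonint \<nu> w = besselK_int \<nu> w"
proof (rule analytic_continuation_pos_real[OF _ holomorphic_on_besselK_int open_halfspace_Re_gt])
  have sub: "{w. Re w > 0} \<subseteq> - \<real>\<^sub>\<le>\<^sub>0" by (auto simp: complex_nonpos_Reals_iff)
  have nz: "sin (\<nu> * pi) \<noteq> 0"
    using assms(2) by (auto simp: sin_zero_iff_int2)
  show "besselK_nonint \<nu> holomorphic_on {w. Re w > 0}"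
    unfolding besselK_nonint_def[abs_def]
    by (intro holomorphic_intros holomorphic_on_subset[OF holomorphic_on_besselI sub]) (use nz in auto)
qed (use besselK_nonint_of_real assms in \<open>auto intro: convex_connected convex_halfspace_Re_gt\<close>)

lemma besselK_eq_int:
  assumes "\<nu> > -1" "Re w > 0"
  shows "besselK \<nu> w = besselK_int \<nu> w"
proof (cases "\<nu> \<in> \<int>")
  case True
  have "((\<lambda>\<mu>. besselK_nonint \<mu> w) \<longlongrightarrow> besselK_int \<nu> w) (at \<nu>)"
  proof (rule Lim_transform_eventually)
    show "((\<lambda>\<mu>. besselK_int \<mu> w) \<longlongrightarrow> besselK_int \<nu> w) (at \<nu>)"
      using isCont_besselK_int_order[OF assms(2)] by (simp add: isCont_def)
    \<comment> \<open>The radius keeps \<mu> above -1 and away from all integers other than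
      \<nu>.\<close>
    have "eventually (\<lambda>\<mu>. \<mu> \<noteq> \<nu> \<and> \<bar>\<mu> - \<nu>\<bar> < min 1 (\<nu> + 1)) (at \<nu>)"
      unfolding eventually_at using assms(1) by (intro exI[of _ "min 1 (\<nu> + 1)"]) (auto simp: dist_real_def)
    then show "eventually (\<lambda>\<mu>. besselK_int \<mu> w = besselK_nonint \<mu> w) (at \<nu>)"
    proof eventually_elim
      case (elim \<mu>)
      have "\<mu> \<notin> \<int>"
      proof
        assume "\<mu> \<in> \<int>"
        then obtain i j where "\<mu> = of_int i" "\<nu> = of_int j" using True by (auto elim!: Ints_cases)
        with elim show False by (auto simp flip: of_int_diff of_int_abs)
      qed
      then show ?case using besselK_nonint_eq_int[of \<mu> w] elim assms(2) by auto
    qed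
  qed
  then show ?thesis unfolding besselK_def using True tendsto_Lim[OF at_neq_bot] by auto
next
  case False
  then show ?thesis using besselK_nonint_eq_int[OF assms(1) _ assms(2)] by (simp add: besselK_def)
qed

subsection \<open>Growth of the Bessel function of the first kind\<close>

lemma bessel_ser_bounded_cball:
  obtains M where "M \<ge> 0" "\<And>q. norm q \<le> 1 \<Longrightarrow> norm (bessel_ser \<nu> q) \<le> M"
proof -
  have "compact (bessel_ser \<nu> ` cball 0 1)"
    by (intro compact_continuous_image continuous_on_bessel_ser continuous_intros compact_cball)
  then have "bounded (bessel_ser \<nu> ` cball 0 1)" by (rule compact_imp_bounded)
  then obtain M where M: "\<forall>x\<in>bessel_ser \<nu> ` cball 0 1. norm x \<le> M" unfolding bounded_iff by blast
  then have "norm (bessel_ser \<nu> q) \<le> M" if "norm q \<le> 1" for q using that by simp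
  moreover from this[of 0] have "M \<ge> 0" using order_trans[OF norm_ge_zero] by simp
  ultimately show ?thesis using that by blast
qed

text \<open>The energy \<open>\<bar>v\<bar>\<^sup>2 + \<bar>v'\<bar>\<^sup>2\<close> of \<open>v(s) = s\<^sup>1\<^sup>/\<^sup>2 J\<^sub>\<nu>(s e)\<close> along the ray in direction \<open>e\<close>, up to a constant
  factor. As \<open>v'' = ((\<nu>\<^sup>2 - 1/4) / s\<^sup>2 - e\<^sup>2) v\<close>, its logarithmic derivative is at most
  \<open>2 \<bar>Im e\<bar> + \<bar>\<nu>\<^sup>2 - 1/4\<bar> / s\<^sup>2\<close>.\<close>

lemma bessel_ray_energy:
  fixes e :: complex and \<nu> :: real
  assumes e: "norm e = 1" and s: "s \<ge> 1"
  defines "m \<equiv> \<nu> + 1/2" and "\<kappa> \<equiv> \<nu>\<^sup>2 - 1/4" and "c \<equiv> - (e\<^sup>2 / 4)"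
  shows "(norm (s powr m *\<^sub>R bessel_ser \<nu> (c * (of_real s)\<^sup>2)))\<^sup>2 \<le>
     ((norm (bessel_ser \<nu> c))\<^sup>2 + (norm (m *\<^sub>R bessel_ser \<nu> c + 2 * c * bessel_ser (\<nu> + 1) c))\<^sup>2) *
       exp \<bar>\<kappa>\<bar> * exp (2 * \<bar>Im e\<bar> * s)"
proof -
  define B where "B = (\<lambda>k s. bessel_ser (\<nu> + k) (c * (complex_of_real s)\<^sup>2))"
  define v where "v = (\<lambda>s. s powr m *\<^sub>R B 0 s)"
  \<comment> \<open>This is v' written out; 2 s c is the inner derivative of c s^2.\<close>
  define u where "u = (\<lambda>s. (m * s powr (m - 1)) *\<^sub>R B 0 s + (2 * s powr (m + 1)) *\<^sub>R (c * B 1 s))"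
  define E where "E = (\<lambda>s. v s \<bullet> v s + u s \<bullet> u s)"
  have Bd: "(B k has_vector_derivative (2 * s) *\<^sub>R (c * B (k + 1) s)) (at s)" for k s
  proof -
    have "((\<lambda>z. bessel_ser (\<nu> + k) (c * z\<^sup>2)) has_field_derivative
        bessel_ser (\<nu> + k + 1) (c * (of_real s)\<^sup>2) * (c * (2 * of_real s))) (at (of_real s))"
      by (auto intro!: derivative_eq_intros)
    from has_vector_derivative_real_field[OF this] show ?thesis
      by (simp add: B_def scaleR_conv_of_real mult_ac add_ac)
  qed
  have vd: "(v has_vector_derivative u s) (at s)" if "s > 0" for s
  proof -
    have "((\<lambda>s. s powr m) has_real_derivative m * s powr (m - 1)) (at s)"
      using that by (auto intro!: derivative_eq_intros)
    from has_vector_derivative_scaleR[OF this Bd[of 0 s]] show ?thesis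
      using that by (simp add: v_def u_def powr_add mult_ac add_ac)
  qed
  have ud: "(u has_vector_derivative (of_real (\<kappa> / s\<^sup>2) - e\<^sup>2) * v s) (at s)" if s: "s > 0" for s
  proof -
    have 1: "((\<lambda>s. m * s powr (m - 1)) has_real_derivative m * ((m - 1) * s powr (m - 2))) (at s)"
      using that by (auto intro!: derivative_eq_intros)
    have 2: "((\<lambda>s. 2 * s powr (m + 1)) has_real_derivative 2 * ((m + 1) * s powr m)) (at s)"
      using that by (auto intro!: derivative_eq_intros)
    have 3: "((\<lambda>s. c * B 1 s) has_vector_derivative c * ((2 * s) *\<^sub>R (c * B 2 s))) (at s)"
      using has_vector_derivative_mult_right[OF Bd[of 1 s], of c] by simp
    define p where "p = s powr (m - 2)"
    have p: "s powr (m - 1) = p * s" "s powr m = p * s\<^sup>2" "s powr (m + 1) = p * s ^ 3"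
      using s powr_add[of s "m - 2" 1] powr_add[of s "m - 2" 2] powr_add[of s "m - 2" 3] by (simp_all add: p_def add_ac)
    have rec: "B 0 s = of_real (\<nu> + 1) * B 1 s + c * (of_real s)\<^sup>2 * B 2 s"
      using bessel_ser_rec[of \<nu> "c * (of_real s)\<^sup>2"] by (simp add: B_def)
    have e2: "e\<^sup>2 = - 4 * c" by (simp add: c_def)
    \<comment> \<open>Both derivatives are collected over the common factor s^(m-2). The recurrence
      then absorbs \<open>B 1 s\<close> and \<open>B 2 s\<close> into \<open>B 0 s\<close>, and m (m
      - 1) = \<kappa>.\<close>
    have "((m * s powr (m - 1)) *\<^sub>R ((2 * s) *\<^sub>R (c * B (0 + 1) s)) + (m * ((m - 1) * s powr (m - 2))) *\<^sub>R B 0 s) +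
        ((2 * s powr (m + 1)) *\<^sub>R (c * ((2 * s) *\<^sub>R (c * B 2 s))) + (2 * ((m + 1) * s powr m)) *\<^sub>R (c * B 1 s))
        = of_real p * (of_real (m * (m - 1)) * B 0 s + 4 * c * (of_real s)\<^sup>2 * (c * (of_real s)\<^sup>2 * B 2 s)
              + of_real (4 * m + 2) * c * (of_real s)\<^sup>2 * B 1 s)"
      unfolding p p_def[symmetric] by (simp add: scaleR_conv_of_real algebra_simps power2_eq_square power3_eq_cube)
    also have "of_real (4 * m + 2) = (4 * of_real (\<nu> + 1) :: complex)" by (simp add: m_def)
    also have "of_real p * (of_real (m * (m - 1)) * B 0 s + 4 * c * (of_real s)\<^sup>2 * (c * (of_real s)\<^sup>2 * B 2 s)
              + 4 * of_real (\<nu> + 1) * c * (of_real s)\<^sup>2 * B 1 s)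
       = of_real p * (of_real (m * (m - 1)) + 4 * c * (of_real s)\<^sup>2) * B 0 s"
      unfolding rec by (simp add: algebra_simps)
    also have "\<dots> = (of_real (\<kappa> / s\<^sup>2) - e\<^sup>2) * v s"
    proof -
      have "m * (m - 1) = \<kappa>" by (simp add: m_def \<kappa>_def algebra_simps power2_eq_square)
      then show ?thesis using s unfolding e2 v_def p(2) by (simp add: scaleR_conv_of_real field_simps)
    qed
    finally show ?thesis
      using has_vector_derivative_add[OF has_vector_derivative_scaleR[OF 1 Bd[of 0 s]] has_vector_derivative_scaleR[OF 2 3]]
      unfolding u_def by simp
  qed
  have Ed: "(E has_real_derivative 2 * (u s \<bullet> ((1 - e\<^sup>2 + of_real (\<kappa> / s\<^sup>2)) * v s))) (at s)" if "s > 0" for s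
  proof -
    have "(E has_vector_derivative (v s \<bullet> u s + u s \<bullet> v s) +
        (u s \<bullet> ((of_real (\<kappa> / s\<^sup>2) - e\<^sup>2) * v s) + ((of_real (\<kappa> / s\<^sup>2) - e\<^sup>2) * v s) \<bullet> u s)) (at s)"
      unfolding E_def
      by (intro has_vector_derivative_add bounded_bilinear.has_vector_derivative[OF bounded_bilinear_inner] vd ud that)
    moreover have "(v s \<bullet> u s + u s \<bullet> v s) +
        (u s \<bullet> ((of_real (\<kappa> / s\<^sup>2) - e\<^sup>2) * v s) + ((of_real (\<kappa> / s\<^sup>2) - e\<^sup>2) * v s) \<bullet> u s)
      = 2 * (u s \<bullet> (v s + (of_real (\<kappa> / s\<^sup>2) - e\<^sup>2) * v s))"
      by (simp add: inner_add_right inner_commute)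
    moreover have "v s + (of_real (\<kappa> / s\<^sup>2) - e\<^sup>2) * v s = (1 - e\<^sup>2 + of_real (\<kappa> / s\<^sup>2)) * v s"
      by (simp add: algebra_simps)
    ultimately show ?thesis by (simp add: has_real_derivative_iff_has_vector_derivative)
  qed
  \<comment> \<open>The source of exp |Im w|: the energy is conserved for frequency 1, and |1 - e^2|
    measures the deviation of the frequency e. As 1/e = cnj e, it equals |cnj e - e|.\<close>
  have n1: "norm (1 - e\<^sup>2) = 2 * \<bar>Im e\<bar>"
  proof -
    have "e * cnj e = 1" using e by (simp add: complex_norm_square[symmetric])
    then have "1 - e\<^sup>2 = e * (cnj e - e)" by (simp add: algebra_simps power2_eq_square)
    also have "cnj e - e = of_real (- 2 * Im e) * \<i>" by (simp add: complex_eq_iff)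
    finally show ?thesis using e by (simp add: norm_mult)
  qed
  have Eb: "2 * (u s \<bullet> ((1 - e\<^sup>2 + of_real (\<kappa> / s\<^sup>2)) * v s)) \<le> (2 * \<bar>Im e\<bar> + \<bar>\<kappa>\<bar> / s\<^sup>2) * E s" for s
  proof -
    let ?w = "1 - e\<^sup>2 + of_real (\<kappa> / s\<^sup>2)"
    have "2 * (u s \<bullet> (?w * v s)) \<le> 2 * (norm (u s) * norm (?w * v s))"
      using norm_cauchy_schwarz by simp
    also have "\<dots> = norm ?w * (2 * norm (u s) * norm (v s))" by (simp add: norm_mult)
    also have "\<dots> \<le> norm ?w * E s"
    proof (rule mult_left_mono)
      have "0 \<le> (norm (u s) - norm (v s))\<^sup>2" by simp
      then show "2 * norm (u s) * norm (v s) \<le> E s"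
        unfolding E_def power2_norm_eq_inner[symmetric] by (simp add: power2_diff)
    qed simp
    also have "\<dots> \<le> (2 * \<bar>Im e\<bar> + \<bar>\<kappa>\<bar> / s\<^sup>2) * E s"
    proof (rule mult_right_mono)
      have "norm ?w \<le> norm (1 - e\<^sup>2) + norm (complex_of_real (\<kappa> / s\<^sup>2))" by (rule norm_triangle_ineq)
      then show "norm ?w \<le> 2 * \<bar>Im e\<bar> + \<bar>\<kappa>\<bar> / s\<^sup>2" unfolding n1 norm_of_real by simp
      show "E s \<ge> 0" by (simp add: E_def)
    qed
    finally show ?thesis .
  qed
  \<comment> \<open>The logarithmic derivative of this integrating factor is the negative of the
    rate in \<open>Eb\<close>. On s \<ge> 1 the part with \<kappa> costs at most a factor exp
    |\<kappa>|.\<close>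
  have "E s * exp (- 2 * \<bar>Im e\<bar> * s + \<bar>\<kappa>\<bar> / s) \<le> E 1 * exp (- 2 * \<bar>Im e\<bar> * 1 + \<bar>\<kappa>\<bar> / 1)"
  proof (rule DERIV_nonpos_imp_nonincreasing[OF s])
    fix x assume x: "1 \<le> x" "x \<le> s"
    let ?D = "2 * (u x \<bullet> ((1 - e\<^sup>2 + of_real (\<kappa> / x\<^sup>2)) * v x))"
    have "((\<lambda>s. E s * exp (- 2 * \<bar>Im e\<bar> * s + \<bar>\<kappa>\<bar> / s)) has_real_derivative
        (?D - (2 * \<bar>Im e\<bar> + \<bar>\<kappa>\<bar> / x\<^sup>2) * E x) * exp (- 2 * \<bar>Im e\<bar> * x + \<bar>\<kappa>\<bar> / x)) (at x)"
      by (rule derivative_eq_intros Ed refl | use x in force)+ (use x in \<open>simp add: field_simps power2_eq_square\<close>)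
    moreover have "(?D - (2 * \<bar>Im e\<bar> + \<bar>\<kappa>\<bar> / x\<^sup>2) * E x) * exp (- 2 * \<bar>Im e\<bar> * x + \<bar>\<kappa>\<bar> / x) \<le> 0"
      using Eb[of x] by (intro mult_nonpos_nonneg) auto
    ultimately show "\<exists>y. ((\<lambda>s. E s * exp (- 2 * \<bar>Im e\<bar> * s + \<bar>\<kappa>\<bar> / s)) has_real_derivative y) (at x) \<and> y \<le> 0"
      by blast
  qed
  then have "E s \<le> E 1 * exp (- 2 * \<bar>Im e\<bar> + \<bar>\<kappa>\<bar>) / exp (- 2 * \<bar>Im e\<bar> * s + \<bar>\<kappa>\<bar> / s)"
    by (simp add: field_simps)
  also have "\<dots> = E 1 * exp (\<bar>\<kappa>\<bar> + 2 * \<bar>Im e\<bar> * s + (- 2 * \<bar>Im e\<bar> - \<bar>\<kappa>\<bar> / s))"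
    unfolding times_divide_eq_right[symmetric] exp_diff[symmetric] by (simp add: algebra_simps)
  also have "\<dots> \<le> E 1 * exp (\<bar>\<kappa>\<bar> + 2 * \<bar>Im e\<bar> * s)"
  proof -
    have "\<bar>\<kappa>\<bar> / s \<ge> 0" using s by simp
    then have "- 2 * \<bar>Im e\<bar> - \<bar>\<kappa>\<bar> / s \<le> 0" by linarith
    then show ?thesis by (intro mult_left_mono) (auto simp: E_def)
  qed
  finally have "E s \<le> E 1 * exp \<bar>\<kappa>\<bar> * exp (2 * \<bar>Im e\<bar> * s)" by (simp add: exp_add)
  moreover have "(norm (v s))\<^sup>2 \<le> E s" unfolding E_def power2_norm_eq_inner by simp
  moreover have "E 1 = (norm (bessel_ser \<nu> c))\<^sup>2 + (norm (m *\<^sub>R bessel_ser \<nu> c + 2 * c * bessel_ser (\<nu> + 1) c))\<^sup>2"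
    unfolding E_def power2_norm_eq_inner[symmetric] v_def u_def B_def by (simp add: scaleR_conv_of_real mult_ac)
  ultimately show ?thesis by (simp add: v_def B_def)
qed

text \<open>Up to the factor 2^\<nu> the left side is |w^(1/2) J_\<nu>(w)|. In the unit disc it is
  bounded by compactness, since \<nu> + 1/2 \<ge> 0; outside, the energy estimate runs along the ray
  through w from s = 1, where the initial energy is bounded uniformly in the direction.\<close>

lemma bessel_ser_growth:
  assumes "\<nu> \<ge> -1/2"
  obtains C where "C \<ge> 0"
    "\<And>w. norm w powr (\<nu> + 1/2) * norm (bessel_ser \<nu> (- (w\<^sup>2 / 4))) \<le> C * exp \<bar>Im w\<bar>"
proof -
  define m where "m = \<nu> + 1/2"
  define \<kappa> where "\<kappa> = \<nu>\<^sup>2 - 1/4"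
  obtain M0 where M0: "M0 \<ge> 0" "\<And>q. norm q \<le> 1 \<Longrightarrow> norm (bessel_ser \<nu> q) \<le> M0"
    using bessel_ser_bounded_cball by blast
  obtain M1 where M1: "M1 \<ge> 0" "\<And>q. norm q \<le> 1 \<Longrightarrow> norm (bessel_ser (\<nu> + 1) q) \<le> M1"
    using bessel_ser_bounded_cball by blast
  define K where "K = (M0\<^sup>2 + (m * M0 + M1)\<^sup>2) * exp \<bar>\<kappa>\<bar>"
  define C where "C = max M0 (sqrt K)"
  have m: "m \<ge> 0" using assms by (simp add: m_def)
  have "norm w powr m * norm (bessel_ser \<nu> (- (w\<^sup>2 / 4))) \<le> C * exp \<bar>Im w\<bar>" for w
  proof (cases "norm w \<le> 1")
    case True
    have "norm w powr m \<le> 1 powr m" using m True by (intro powr_mono2) auto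
    moreover have "norm (- (w\<^sup>2 / 4)) \<le> 1"
      using True power_le_one[of "norm w" 2] by (simp add: norm_divide norm_power)
    ultimately have "norm w powr m * norm (bessel_ser \<nu> (- (w\<^sup>2 / 4))) \<le> 1 * M0"
      using M0(2) by (intro mult_mono) auto
    also have "\<dots> \<le> C * exp \<bar>Im w\<bar>"
      using mult_mono[of M0 C 1 "exp \<bar>Im w\<bar>"] M0(1) by (simp add: C_def)
    finally show ?thesis .
  next
    case False
    define s where "s = norm w"
    define e where "e = w / of_real s"
    have s: "s > 1" using False by (simp add: s_def)
    have e: "norm e = 1" "w = of_real s * e" using s by (auto simp: e_def s_def norm_divide)
    let ?c = "- (e\<^sup>2 / 4)"
    have c: "norm ?c \<le> 1" "norm (2 * ?c) \<le> 1" using e by (simp_all add: norm_divide norm_power norm_mult)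
    have arg: "?c * (of_real s)\<^sup>2 = - (w\<^sup>2 / 4)" unfolding e(2) by (simp add: power_mult_distrib)
    have "(norm (m *\<^sub>R bessel_ser \<nu> ?c + 2 * ?c * bessel_ser (\<nu> + 1) ?c)) \<le> m * M0 + M1"
    proof (rule norm_triangle_le[OF add_mono])
      show "norm (m *\<^sub>R bessel_ser \<nu> ?c) \<le> m * M0" using m M0(2)[OF c(1)] by (simp add: mult_left_mono)
      have "norm (2 * ?c) * norm (bessel_ser (\<nu> + 1) ?c) \<le> 1 * M1"
        using M1 c by (intro mult_mono) auto
      then show "norm (2 * ?c * bessel_ser (\<nu> + 1) ?c) \<le> M1" by (simp add: norm_mult)
    qed
    then have K: "((norm (bessel_ser \<nu> ?c))\<^sup>2 + (norm (m *\<^sub>R bessel_ser \<nu> ?c + 2 * ?c * bessel_ser (\<nu> + 1) ?c))\<^sup>2) * exp \<bar>\<kappa>\<bar> \<le> K"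
      unfolding K_def using M0(2)[OF c(1)] by (intro mult_right_mono add_mono power_mono) auto
    have "(norm (s powr m *\<^sub>R bessel_ser \<nu> (- (w\<^sup>2 / 4))))\<^sup>2 \<le> K * exp (2 * \<bar>Im e\<bar> * s)"
      using s by (intro order_trans[OF bessel_ray_energy[OF e(1), of s \<nu>, folded m_def \<kappa>_def, unfolded arg] mult_right_mono[OF K]]) auto
    also have "exp (2 * \<bar>Im e\<bar> * s) = (exp \<bar>Im w\<bar>)\<^sup>2"
      using s unfolding e(2) by (simp add: abs_mult mult_ac flip: exp_double)
    finally have "norm (s powr m *\<^sub>R bessel_ser \<nu> (- (w\<^sup>2 / 4))) \<le> sqrt (K * (exp \<bar>Im w\<bar>)\<^sup>2)"
      by (rule real_le_rsqrt)
    also have "\<dots> = sqrt K * exp \<bar>Im w\<bar>" by (simp add: real_sqrt_mult)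
    also have "\<dots> \<le> C * exp \<bar>Im w\<bar>" by (simp add: C_def)
    finally show ?thesis by (simp add: s_def)
  qed
  moreover have "C \<ge> 0" using M0(1) by (simp add: C_def)
  ultimately show ?thesis using that by (simp add: m_def)
qed

subsection \<open>Macdonald's product formula on the diagonal\<close>

text \<open>As \<nu> \<ge> -1/2 gives \<nu> + k + 1 \<ge> (k + 1)/2, each step of the functional
  equation gains that factor. The second factorial bounds \<open>bessel_ser\<close> by the
  exponential of a square root of its argument.\<close>

lemma rGamma_shift_fact_bound:
  assumes "\<nu> \<ge> -1/2"
  shows "norm (rGamma (of_real \<nu> + of_nat k + 1 :: complex)) \<le> norm (rGamma (of_real \<nu> + 1 :: complex)) * 2 ^ k / fact k"
proof (induction k)
  case (Suc k)
  have "rGamma (of_real \<nu> + of_nat k + 1 :: complex)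
          = of_real (\<nu> + real k + 1) * rGamma (of_real \<nu> + of_nat (Suc k) + 1)"
    using rGamma_plus1[of "of_real \<nu> + of_nat k + 1 :: complex"] by (simp add: add_ac)
  then have "norm (rGamma (of_real \<nu> + of_nat k + 1 :: complex))
      = \<bar>\<nu> + real k + 1\<bar> * norm (rGamma (of_real \<nu> + of_nat (Suc k) + 1 :: complex))"
    by (simp only: norm_mult norm_of_real)
  then have eq: "norm (rGamma (of_real \<nu> + of_nat k + 1 :: complex))
      = (\<nu> + real k + 1) * norm (rGamma (of_real \<nu> + of_nat (Suc k) + 1 :: complex))"
    using assms by simp
  have "(real k + 1) / 2 * norm (rGamma (of_real \<nu> + of_nat (Suc k) + 1 :: complex))
      \<le> (\<nu> + real k + 1) * norm (rGamma (of_real \<nu> + of_nat (Suc k) + 1 :: complex))"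
    using assms by (intro mult_right_mono) auto
  also have "\<dots> \<le> norm (rGamma (of_real \<nu> + 1 :: complex)) * 2 ^ k / fact k"
    unfolding eq[symmetric] by (rule Suc.IH)
  finally have "norm (rGamma (of_real \<nu> + of_nat (Suc k) + 1 :: complex))
      \<le> norm (rGamma (of_real \<nu> + 1 :: complex)) * 2 ^ k / fact k / ((real k + 1) / 2)"
    by (subst pos_le_divide_eq) (auto simp: mult.commute)
  then show ?case by (simp add: add_ac mult_ac)
qed simp

section \<open>Power series of the Macdonald integral in Y, and its continuation to the
  diagonal\<close>

context
  fixes h \<nu> :: real
  assumes h: "h > 0" and nu: "\<nu> \<ge> -1/2"
begin

text \<open>The kernel at x = 0 with X = 2 h and t = 2 h exp u; exp (- \<nu> u) is what the power (x
  X/(2 t))^\<nu> of J_\<nu> leaves once Y^(\<nu>/2) is divided out.\<close>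

definition macdonald_kernel :: "real \<Rightarrow> real" where
  "macdonald_kernel u = exp (- (h * exp u) - h * exp (- u) - \<nu> * u)"

text \<open>The coefficient of Y^n exp (- (n + k) u) in the product of exp (Y exp (-u)/h) and
  \<open>bessel_ser \<nu>\<close> at - Y exp (- 2 u): k counts powers from the Bessel series, n - k
  those from the exponential.\<close>

definition heat_coeff :: "nat \<Rightarrow> nat \<Rightarrow> real" where
  "heat_coeff n k = (1 / h) ^ (n - k) / fact (n - k) * ((-1) ^ k * rGamma (\<nu> + real k + 1) / fact k)"

definition heat_moment :: "nat \<Rightarrow> real" where
  "heat_moment n = (\<Sum>k\<le>n. heat_coeff n k * dexp_int h h (\<nu> + real (n + k)))"

lemma heat_coeff_Suc_left: "k \<le> n \<Longrightarrow> real (Suc n - k) * heat_coeff (Suc n) k = heat_coeff n k / h"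
  by (simp add: heat_coeff_def Suc_diff_le field_simps del: of_nat_Suc)

lemma heat_coeff_Suc_Suc: "real (Suc k) * (\<nu> + real k + 1) * heat_coeff (Suc n) (Suc k) = - heat_coeff n k"
proof -
  have "rGamma (\<nu> + real k + 1) = (\<nu> + real k + 1) * rGamma (\<nu> + real (Suc k) + 1)"
    using rGamma_plus1[of "\<nu> + real k + 1"] by (simp add: add_ac)
  moreover define G where "G = rGamma (\<nu> + real (Suc k) + 1)"
  moreover define A where "A = (1 / h) ^ (n - k) / fact (n - k)"
  ultimately have "heat_coeff n k = A * ((-1) ^ k * ((\<nu> + real k + 1) * G) / fact k)"
    by (simp only: heat_coeff_def)
  moreover define s where "s = real (Suc k)"
  have "heat_coeff (Suc n) (Suc k) = - (A * ((-1) ^ k * G / (s * fact k)))"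
    by (simp add: heat_coeff_def A_def G_def s_def del: of_nat_Suc)
  moreover have "s \<noteq> 0" by (simp add: s_def)
  ultimately show ?thesis unfolding s_def[symmetric] by simp
qed

text \<open>The recurrence comes from the heat equation \<open>Y G\<^sub>Y\<^sub>Y + (\<nu> + 1) G\<^sub>Y + G = \<partial>\<^sub>u(\<dots>)\<close> satisfied by
  \<open>G = macdonald_integrand Y u\<close> below: integrating over \<open>u\<close> leaves the
  differential equation of \<open>Y \<mapsto> bessel_ser \<nu> (- Y)\<close>.\<close>

lemma heat_moment_Suc: "real (Suc n) * (\<nu> + real n + 1) * heat_moment (Suc n) = - heat_moment n"
proof -
  let ?M = "\<lambda>j. dexp_int h h (\<nu> + real j)"
  let ?S = "\<lambda>k. heat_coeff (Suc n) k * ?M (Suc n + k)"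
  \<comment> \<open>The factor splits as (n + 1) (\<nu> + n + 1) = (n + 1 - k) (\<nu> + n + k + 1) +
    k (\<nu> + k). \<open>heat_coeff_Suc_left\<close> handles the first part, vanishing at k = n +
    1; \<open>heat_coeff_Suc_Suc\<close> the second, vanishing at k = 0.\<close>
  have "real (Suc n) * (\<nu> + real n + 1) * heat_moment (Suc n)
     = (\<Sum>k\<le>Suc n. (real (Suc n - k) * (\<nu> + real (n + k) + 1) + real k * (\<nu> + real k)) * ?S k)"
    unfolding heat_moment_def sum_distrib_left
  proof (rule sum.cong)
    fix k assume "k \<in> {..Suc n}"
    then have "real (Suc n - k) = real n + 1 - real k" by (simp add: of_nat_diff)
    then have "real (Suc n - k) * (\<nu> + real (n + k) + 1) + real k * (\<nu> + real k) = real (Suc n) * (\<nu> + real n + 1)"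
      by (simp add: algebra_simps)
    then show "real (Suc n) * (\<nu> + real n + 1) * ?S k
      = (real (Suc n - k) * (\<nu> + real (n + k) + 1) + real k * (\<nu> + real k)) * ?S k" by simp
  qed simp
  also have "\<dots> = (\<Sum>k\<le>Suc n. real (Suc n - k) * (\<nu> + real (n + k) + 1) * ?S k) + (\<Sum>k\<le>Suc n. real k * (\<nu> + real k) * ?S k)"
    by (simp only: distrib_right sum.distrib)
  also have "(\<Sum>k\<le>Suc n. real (Suc n - k) * (\<nu> + real (n + k) + 1) * ?S k)
     = (\<Sum>k\<le>n. real (Suc n - k) * (\<nu> + real (n + k) + 1) * ?S k)" by simp
  also have "\<dots> = (\<Sum>k\<le>n. heat_coeff n k / h * (\<nu> + real (n + k) + 1) * ?M (Suc (n + k)))"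
  proof (rule sum.cong)
    fix k assume "k \<in> {..n}"
    then have r: "real (Suc n - k) * heat_coeff (Suc n) k = heat_coeff n k / h" by (intro heat_coeff_Suc_left) simp
    have "real (Suc n - k) * (\<nu> + real (n + k) + 1) * ?S k
        = (real (Suc n - k) * heat_coeff (Suc n) k) * (\<nu> + real (n + k) + 1) * ?M (Suc n + k)"
      by (simp only: mult_ac)
    then show "real (Suc n - k) * (\<nu> + real (n + k) + 1) * ?S k = heat_coeff n k / h * (\<nu> + real (n + k) + 1) * ?M (Suc (n + k))"
      unfolding r by (simp only: add_Suc)
  qed simp
  also have "(\<Sum>k\<le>Suc n. real k * (\<nu> + real k) * ?S k) = (\<Sum>k\<le>n. real (Suc k) * (\<nu> + real (Suc k)) * ?S (Suc k))"
    by (subst sum.atMost_Suc_shift) simp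
  also have "\<dots> = (\<Sum>k\<le>n. - heat_coeff n k * ?M (Suc (Suc (n + k))))"
  proof (rule sum.cong)
    fix k
    show "real (Suc k) * (\<nu> + real (Suc k)) * ?S (Suc k) = - heat_coeff n k * ?M (Suc (Suc (n + k)))"
      unfolding heat_coeff_Suc_Suc[of k n, symmetric] by (simp add: add_ac)
  qed simp
  also have "(\<Sum>k\<le>n. heat_coeff n k / h * (\<nu> + real (n + k) + 1) * ?M (Suc (n + k))) + (\<Sum>k\<le>n. - heat_coeff n k * ?M (Suc (Suc (n + k))))
    = (\<Sum>k\<le>n. - (heat_coeff n k * ?M (n + k)))"
    unfolding sum.distrib[symmetric]
  proof (rule sum.cong)
    fix k
    \<comment> \<open>Integration by parts at order \<nu> + n + k + 1, after which the terms of the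
      highest order cancel.\<close>
    have "h * ?M (n + k) + (\<nu> + real (n + k) + 1) * ?M (Suc (n + k)) = h * ?M (Suc (Suc (n + k)))"
      using dexp_int_rec[OF h h, of "\<nu> + real (n + k) + 1"] by (simp add: add_ac)
    then have "(\<nu> + real (n + k) + 1) * ?M (Suc (n + k)) = h * (?M (Suc (Suc (n + k))) - ?M (n + k))"
      by (simp add: right_diff_distrib)
    then have eq: "heat_coeff n k / h * ((\<nu> + real (n + k) + 1) * ?M (Suc (n + k))) = heat_coeff n k * (?M (Suc (Suc (n + k))) - ?M (n + k))"
      using h by simp
    show "heat_coeff n k / h * (\<nu> + real (n + k) + 1) * ?M (Suc (n + k)) + - heat_coeff n k * ?M (Suc (Suc (n + k))) = - (heat_coeff n k * ?M (n + k))"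
      unfolding mult.assoc eq by (simp add: right_diff_distrib)
  qed simp
  finally show ?thesis by (simp add: heat_moment_def sum_negf)
qed

text \<open>The coefficients of \<open>bessel_ser \<nu>\<close> at - Y obey the same recurrence, and
  \<nu> + n + 1 > 0 lets it determine every moment from n = 0.\<close>

lemma heat_moment_eq: "heat_moment n = (-1) ^ n * rGamma (\<nu> + real n + 1) / fact n * dexp_int h h \<nu>"
proof (induction n)
  case 0
  then show ?case by (simp add: heat_moment_def heat_coeff_def)
next
  case (Suc n)
  have "rGamma (\<nu> + real n + 1) = (\<nu> + real n + 1) * rGamma (\<nu> + real (Suc n) + 1)"
    using rGamma_plus1[of "\<nu> + real n + 1"] by (simp add: add_ac)
  with Suc have "real (Suc n) * (\<nu> + real n + 1) * heat_moment (Suc n) =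
     - ((-1) ^ n * ((\<nu> + real n + 1) * rGamma (\<nu> + real (Suc n) + 1)) / fact n * dexp_int h h \<nu>)"
    using heat_moment_Suc[of n] by simp
  also have "\<dots> = real (Suc n) * (\<nu> + real n + 1) * ((-1) ^ Suc n * rGamma (\<nu> + real (Suc n) + 1) / fact (Suc n) * dexp_int h h \<nu>)"
    by (simp add: field_simps del: of_nat_Suc)
  finally have "real (Suc n) * (\<nu> + real n + 1) * heat_moment (Suc n)
    = real (Suc n) * (\<nu> + real n + 1) * ((-1) ^ Suc n * rGamma (\<nu> + real (Suc n) + 1) / fact (Suc n) * dexp_int h h \<nu>)" .
  moreover have "real (Suc n) * (\<nu> + real n + 1) \<noteq> 0" using nu by simp
  ultimately show ?case using mult_left_cancel by blast
qed

text \<open>Here Y = x^2/4. Without the factor Y^(\<nu>/2) the integrand is entire in Y, so complex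
  x can be used without choosing a branch.\<close>

definition macdonald_integrand :: "complex \<Rightarrow> real \<Rightarrow> complex" where
  "macdonald_integrand Y u = of_real (macdonald_kernel u) * exp (Y * of_real (exp (- u) / h)) * bessel_ser \<nu> (- (Y * (of_real (exp (- u)))\<^sup>2))"

lemma macdonald_integrand_measurable [measurable]: "macdonald_integrand Y \<in> borel_measurable lborel"
  unfolding measurable_lborel2 macdonald_integrand_def[abs_def] macdonald_kernel_def
  by (intro borel_measurable_continuous_onI continuous_intros) (use h in auto)

text \<open>Termwise integration of a Cauchy product by dominated convergence of its partial sums.
  The bound on Y keeps the series of absolute values below a multiple of exp (h/2 exp (-u)), half of
  the decay of the kernel.\<close>

lemma macdonald_integral_small:
  assumes Y: "norm Y \<le> h\<^sup>2 / 64"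
  shows "(\<integral>u. macdonald_integrand Y u \<partial>lborel) = of_real (dexp_int h h \<nu>) * bessel_ser \<nu> (- Y)"
proof -
  define a where "a = (\<lambda>u j. (Y * of_real (exp (- u) / h)) ^ j / fact j)"
  define b where "b = (\<lambda>u k. rGamma (of_real \<nu> + of_nat k + 1) / fact k * (- (Y * (of_real (exp (- u)))\<^sup>2)) ^ k)"
  define c where "c = (\<lambda>u n. \<Sum>k\<le>n. b u k * a u (n - k))"
  define R where "R = norm (rGamma (of_real \<nu> + 1 :: complex))"
  define S where "S = (\<lambda>N u. of_real (macdonald_kernel u) * (\<Sum>n<N. c u n))"
  have a_sums: "(\<lambda>j. a u j) sums exp (Y * of_real (exp (- u) / h))" for u
    using exp_converges[of "Y * of_real (exp (- u) / h)"]
    by (simp add: a_def scaleR_conv_of_real field_simps)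
  have na_sums: "(\<lambda>j. norm (a u j)) sums exp (norm Y * exp (- u) / h)" for u
    using exp_converges[of "norm Y * exp (- u) / h"] h
    by (simp add: a_def norm_divide norm_mult norm_power field_simps)
  have b_sums: "(\<lambda>k. b u k) sums bessel_ser \<nu> (- (Y * (of_real (exp (- u)))\<^sup>2))" for u
    unfolding b_def by (rule sums_bessel_ser)
  have nb_partial: "(\<Sum>k<N. norm (b u k)) \<le> R * exp (2 * (sqrt (2 * norm Y) * exp (- u)))" for u N
  proof -
    \<comment> \<open>Chosen so that the k-th term is at most R (z^k/k!)^2, the 2 under the root
      being the 2^k of \<open>rGamma_shift_fact_bound\<close>. A sum of squares of nonnegative
      numbers is at most the square of their sum, whence exp (2 z).\<close>
    define z where "z = sqrt (2 * norm Y) * exp (- u)"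
    have z: "z \<ge> 0" "z\<^sup>2 = 2 * norm Y * (exp (- u))\<^sup>2" by (simp_all add: z_def power_mult_distrib)
    have "norm (b u k) \<le> R * (z ^ k / fact k)\<^sup>2" for k
    proof -
      have "norm (b u k) = norm (rGamma (of_real \<nu> + of_nat k + 1 :: complex)) / fact k * (norm Y * (exp (- u))\<^sup>2) ^ k"
        by (simp add: b_def norm_mult norm_divide norm_power)
      also have "\<dots> \<le> (R * 2 ^ k / fact k) / fact k * (norm Y * (exp (- u))\<^sup>2) ^ k"
        unfolding R_def by (intro mult_right_mono divide_right_mono rGamma_shift_fact_bound nu) auto
      also have "\<dots> = R * ((z\<^sup>2) ^ k / (fact k)\<^sup>2)"
        unfolding z(2) by (simp add: power_mult_distrib power2_eq_square)
      also have "(z\<^sup>2) ^ k / (fact k)\<^sup>2 = (z ^ k / fact k)\<^sup>2"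
        by (simp add: power_divide power_mult[symmetric] mult.commute)
      finally show ?thesis .
    qed
    then have "(\<Sum>k<N. norm (b u k)) \<le> (\<Sum>k<N. R * (z ^ k / fact k)\<^sup>2)" by (rule sum_mono)
    also have "\<dots> = R * (L2_set (\<lambda>k. z ^ k / fact k) {..<N})\<^sup>2"
      by (simp add: L2_set_def sum_distrib_left sum_nonneg)
    also have "\<dots> \<le> R * (\<Sum>k<N. z ^ k / fact k)\<^sup>2"
      using z(1) by (intro mult_left_mono power_mono L2_set_le_sum) (auto simp: R_def)
    also have "\<dots> \<le> R * (exp z)\<^sup>2"
    proof (intro mult_left_mono power_mono)
      have "(\<lambda>k. z ^ k / fact k) sums exp z"
        using exp_converges[of z] by (simp add: field_simps)
      then show "(\<Sum>k<N. z ^ k / fact k) \<le> exp z"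
        using z(1) by (intro sum_le_suminf[THEN order_trans]) (auto simp: sums_iff)
    qed (use z(1) in \<open>auto simp: R_def sum_nonneg\<close>)
    finally show ?thesis by (simp add: z_def exp_double)
  qed
  have nb_summable: "summable (\<lambda>k. norm (b u k))" for u
    by (rule summableI_nonneg_bounded[OF _ nb_partial]) simp
  have c_sums: "c u sums (bessel_ser \<nu> (- (Y * (of_real (exp (- u)))\<^sup>2)) * exp (Y * of_real (exp (- u) / h)))" for u
    using Cauchy_product_sums[OF nb_summable[of u] sums_summable[OF na_sums[of u]]] b_sums[of u] a_sums[of u]
    unfolding c_def by (simp add: sums_iff)
  have c_bound: "norm (\<Sum>n<N. c u n) \<le> R * exp (2 * (sqrt (2 * norm Y) * exp (- u))) * exp (norm Y * exp (- u) / h)" for u N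
  proof -
    let ?c = "\<lambda>n. \<Sum>k\<le>n. norm (b u k) * norm (a u (n - k))"
    have "(\<lambda>n. ?c n) sums ((\<Sum>k. norm (b u k)) * (\<Sum>j. norm (a u j)))"
      by (rule Cauchy_product_sums) (use nb_summable[of u] sums_summable[OF na_sums[of u]] in auto)
    moreover have "norm (\<Sum>n<N. c u n) \<le> (\<Sum>n<N. ?c n)"
      unfolding c_def by (intro sum_norm_le order_trans[OF norm_sum] sum_mono) (simp add: norm_mult)
    moreover have "(\<Sum>n<N. ?c n) \<le> (\<Sum>n. ?c n)"
      using calculation(1) by (intro sum_le_suminf) (auto simp: sums_iff intro!: sum_nonneg)
    ultimately have "norm (\<Sum>n<N. c u n) \<le> (\<Sum>k. norm (b u k)) * (\<Sum>j. norm (a u j))"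
      by (simp add: sums_iff)
    also have "(\<Sum>j. norm (a u j)) = exp (norm Y * exp (- u) / h)"
      using na_sums[of u] by (simp add: sums_iff)
    also have "(\<Sum>k. norm (b u k)) * exp (norm Y * exp (- u) / h) \<le> R * exp (2 * (sqrt (2 * norm Y) * exp (- u))) * exp (norm Y * exp (- u) / h)"
      by (intro mult_right_mono suminf_le_const nb_summable nb_partial) auto
    finally show ?thesis .
  qed
  have S_int: "integrable lborel (S N)" and S_val: "(\<integral>u. S N u \<partial>lborel) = (\<Sum>n<N. Y ^ n * of_real (heat_moment n))" for N
  proof -
    have term_eq: "of_real (macdonald_kernel u) * (b u k * a u (n - k)) = Y ^ n * of_real (heat_coeff n k) *
        of_real (exp (- (h * exp u) - h * exp (- u) - (\<nu> + real (n + k)) * u))" if "k \<le> n" for n k u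
    proof -
      have e1: "exp (- (h * exp u) - h * exp (- u) - (\<nu> + real (n + k)) * u) = macdonald_kernel u * exp (- u) ^ (n + k)"
        unfolding macdonald_kernel_def exp_of_nat_mult[symmetric] exp_add[symmetric] by (simp add: algebra_simps)
      have e2: "exp (- u) ^ (n + k) = exp (- u) ^ (n - k) * (exp (- u))\<^sup>2 ^ k"
        using that by (simp add: power_mult[symmetric] power_add[symmetric] add.commute)
      have e3: "Y ^ n = Y ^ (n - k) * Y ^ k" using that by (simp add: power_add[symmetric])
      have e4: "rGamma (of_real \<nu> + of_nat k + 1) = complex_of_real (rGamma (\<nu> + real k + 1))"
        by (simp flip: rGamma_complex_of_real)
      show ?thesis
        unfolding e1 e2 e3 a_def b_def heat_coeff_def e4
        by (simp add: power_mult_distrib power_divide power_minus[of "Y * _"] mult_ac)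
    qed
    have S_eq: "S N = (\<lambda>u. \<Sum>n<N. \<Sum>k\<le>n. Y ^ n * of_real (heat_coeff n k) *
        of_real (exp (- (h * exp u) - h * exp (- u) - (\<nu> + real (n + k)) * u)))"
      unfolding S_def c_def sum_distrib_left by (intro ext sum.cong refl term_eq) simp
    have int: "integrable lborel (\<lambda>u. complex_of_real (exp (- (h * exp u) - h * exp (- u) - (\<nu> + real (n + k)) * u)))" for n k
      by (intro integrable_of_real integrable_dexp h)
    show "integrable lborel (S N)"
      unfolding S_eq by (intro Bochner_Integration.integrable_sum integrable_mult_right int)
    have "(\<integral>u. S N u \<partial>lborel) = (\<Sum>n<N. \<integral>u. (\<Sum>k\<le>n. Y ^ n * of_real (heat_coeff n k) *
        complex_of_real (exp (- (h * exp u) - h * exp (- u) - (\<nu> + real (n + k)) * u))) \<partial>lborel)"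
      unfolding S_eq
      by (intro Bochner_Integration.integral_sum Bochner_Integration.integrable_sum integrable_mult_right int)
    also have "\<dots> = (\<Sum>n<N. \<Sum>k\<le>n. \<integral>u. Y ^ n * of_real (heat_coeff n k) *
        complex_of_real (exp (- (h * exp u) - h * exp (- u) - (\<nu> + real (n + k)) * u)) \<partial>lborel)"
      by (intro sum.cong refl Bochner_Integration.integral_sum integrable_mult_right int)
    also have "\<dots> = (\<Sum>n<N. \<Sum>k\<le>n. Y ^ n * of_real (heat_coeff n k) *
        (\<integral>u. complex_of_real (exp (- (h * exp u) - h * exp (- u) - (\<nu> + real (n + k)) * u)) \<partial>lborel))"
      by (intro sum.cong refl integral_mult_right_zero)
    also have "\<dots> = (\<Sum>n<N. Y ^ n * of_real (heat_moment n))"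
      unfolding integral_complex_of_real dexp_int_def[symmetric] heat_moment_def
      by (simp add: sum_distrib_left mult_ac)
    finally show "(\<integral>u. S N u \<partial>lborel) = (\<Sum>n<N. Y ^ n * of_real (heat_moment n))" .
  qed
  have "(\<lambda>N. \<integral>u. S N u \<partial>lborel) \<longlonglongrightarrow> (\<integral>u. macdonald_integrand Y u \<partial>lborel)"
  proof (rule integral_dominated_convergence)
    show "S N \<in> borel_measurable lborel" for N using S_int by auto
    show "integrable lborel (\<lambda>u. R * exp (- (h * exp u) - h / 2 * exp (- u) - \<nu> * u))"
      using h by (intro integrable_mult_right integrable_dexp) auto
    have "(\<lambda>N. S N u) \<longlonglongrightarrow> macdonald_integrand Y u" for u
      unfolding S_def macdonald_integrand_def mult.assoc
      using c_sums[of u] unfolding sums_def by (intro tendsto_mult_left) (simp add: mult.commute)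
    then show "AE u in lborel. (\<lambda>N. S N u) \<longlonglongrightarrow> macdonald_integrand Y u" by simp
    show "AE u in lborel. norm (S N u) \<le> R * exp (- (h * exp u) - h / 2 * exp (- u) - \<nu> * u)" for N
    proof (rule AE_I2)
      fix u
      \<comment> \<open>Here 2 |Y| \<le> h^2/32 = 8 h^2/256, just below this square; so the two
        growth rates add up to at most 3 h/8 + h/64 < h/2.\<close>
      have "(3 * h / 16)\<^sup>2 = 9 * h\<^sup>2 / 256" by (simp add: power_divide power_mult_distrib)
      then have "2 * norm Y \<le> (3 * h / 16)\<^sup>2" using Y zero_le_power2[of h] by linarith
      then have "sqrt (2 * norm Y) \<le> 3 * h / 16" using h by (intro real_le_lsqrt) auto
      moreover have "norm Y / h \<le> h / 64" using Y h by (simp add: divide_le_eq power2_eq_square)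
      ultimately have "2 * sqrt (2 * norm Y) + norm Y / h \<le> h / 2" using h by linarith
      then have "(2 * sqrt (2 * norm Y) + norm Y / h) * exp (- u) \<le> h / 2 * exp (- u)" by (intro mult_right_mono) auto
      moreover have "2 * (sqrt (2 * norm Y) * exp (- u)) + norm Y * exp (- u) / h = (2 * sqrt (2 * norm Y) + norm Y / h) * exp (- u)"
        by (simp add: ring_distribs)
      moreover have "h * exp (- u) = h / 2 * exp (- u) + h / 2 * exp (- u)" by simp
      ultimately have le: "- (h * exp u) - h * exp (- u) - \<nu> * u + 2 * (sqrt (2 * norm Y) * exp (- u)) + norm Y * exp (- u) / h
          \<le> - (h * exp u) - h / 2 * exp (- u) - \<nu> * u"
        by linarith
      have "norm (S N u) \<le> macdonald_kernel u * (R * exp (2 * (sqrt (2 * norm Y) * exp (- u))) * exp (norm Y * exp (- u) / h))"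
        unfolding S_def norm_mult by (intro mult_mono c_bound) (auto simp: macdonald_kernel_def)
      also have "\<dots> = R * exp (- (h * exp u) - h * exp (- u) - \<nu> * u + 2 * (sqrt (2 * norm Y) * exp (- u)) + norm Y * exp (- u) / h)"
        unfolding macdonald_kernel_def by (simp add: exp_add)
      also have "\<dots> \<le> R * exp (- (h * exp u) - h / 2 * exp (- u) - \<nu> * u)"
        using le by (intro mult_left_mono) (auto simp: R_def)
      finally show "norm (S N u) \<le> R * exp (- (h * exp u) - h / 2 * exp (- u) - \<nu> * u)" .
    qed
  qed measurable
  moreover have "(\<lambda>n. Y ^ n * of_real (heat_moment n)) sums (of_real (dexp_int h h \<nu>) * bessel_ser \<nu> (- Y))"
  proof -
    have "Y ^ n * of_real (heat_moment n) = of_real (dexp_int h h \<nu>) * (rGamma (of_real \<nu> + of_nat n + 1) / fact n * (- Y) ^ n)" for n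
    proof -
      have "complex_of_real (rGamma (\<nu> + real n + 1)) = rGamma (of_real \<nu> + of_nat n + 1)"
        by (simp flip: rGamma_complex_of_real)
      then show ?thesis unfolding heat_moment_eq power_minus[of Y] by (simp add: mult_ac)
    qed
    then show ?thesis using sums_mult[OF sums_bessel_ser] by simp
  qed
  ultimately show ?thesis unfolding S_val sums_def by (rule LIMSEQ_unique)
qed

text \<open>Past the range of the absolute series, with y in place of x, the growth bound for the
  Bessel factor keeps the integral convergent and analytic. The diamond contains the real interval
  up to 2 h and is convex, so the identity spreads from small y.\<close>

lemma macdonald_integral_diamond:
  assumes "\<bar>Re y\<bar> + \<bar>Im y\<bar> < 2 * h"
  shows "(\<integral>u. macdonald_integrand (y\<^sup>2 / 4) u \<partial>lborel) = of_real (dexp_int h h \<nu>) * bessel_ser \<nu> (- (y\<^sup>2 / 4))"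
proof -
  let ?D = "{y :: complex. \<bar>Re y\<bar> + \<bar>Im y\<bar> < 2 * h}"
  obtain C where C: "C \<ge> 0"
    "\<And>w. norm w powr (\<nu> + 1/2) * norm (bessel_ser \<nu> (- (w\<^sup>2 / 4))) \<le> C * exp \<bar>Im w\<bar>"
    using bessel_ser_growth[OF nu] by blast
  obtain M where M: "M \<ge> 0" "\<And>q. norm q \<le> 1 \<Longrightarrow> norm (bessel_ser \<nu> q) \<le> M"
    using bessel_ser_bounded_cball by blast
  have growth: "norm (bessel_ser \<nu> (- (w\<^sup>2 / 4))) \<le> max C M * exp \<bar>Im w\<bar>" for w
  proof (cases "norm w \<ge> 1")
    case True
    have "norm (bessel_ser \<nu> (- (w\<^sup>2 / 4))) \<le> norm w powr (\<nu> + 1/2) * norm (bessel_ser \<nu> (- (w\<^sup>2 / 4)))"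
      using True nu ge_one_powr_ge_zero[of "norm w" "\<nu> + 1/2"] by (simp add: mult_le_cancel_right1)
    also have "\<dots> \<le> C * exp \<bar>Im w\<bar>" by (rule C)
    also have "\<dots> \<le> max C M * exp \<bar>Im w\<bar>" by simp
    finally show ?thesis .
  next
    case False
    then have "norm (- (w\<^sup>2 / 4)) \<le> 1"
      using power_le_one[of "norm w" 2] by (simp add: norm_divide norm_power)
    then have "norm (bessel_ser \<nu> (- (w\<^sup>2 / 4))) \<le> max C M * 1" using M(2) by (simp add: le_max_iff_disj)
    also have "\<dots> \<le> max C M * exp \<bar>Im w\<bar>" using C(1) by (intro mult_left_mono) auto
    finally show ?thesis .
  qed
  \<comment> \<open>The part of the decay rate h left after the growth rates Re (y^2)/(4 h) of the
    exponential and |Im y| of the Bessel factor; 4 h \<delta> y is the difference of squares (2 h -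
    |Im y|)^2 - (Re y)^2.\<close>
  define \<delta> where "\<delta> = (\<lambda>y. h - ((Re y)\<^sup>2 - (Im y)\<^sup>2) / (4 * h) - \<bar>Im y\<bar>)"
  have \<delta>_pos: "\<delta> y > 0" if "y \<in> ?D" for y
  proof -
    have "\<bar>Re y\<bar> < 2 * h - \<bar>Im y\<bar>" using that by simp
    then have "\<bar>Re y\<bar>\<^sup>2 < (2 * h - \<bar>Im y\<bar>)\<^sup>2" by (intro power_strict_mono) auto
    then have "0 < (2 * h - \<bar>Im y\<bar>)\<^sup>2 - (Re y)\<^sup>2" by simp
    also have "\<dots> = 4 * h * \<delta> y"
      using h by (simp add: \<delta>_def power2_diff field_simps) (simp add: power2_eq_square)
    finally show ?thesis using h by (simp add: zero_less_mult_iff)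
  qed
  have bound: "norm (macdonald_integrand (y\<^sup>2 / 4) u) \<le> max C M * exp (- (h * exp u) - \<delta> y * exp (- u) - \<nu> * u)" for y u
  proof -
    have "norm (bessel_ser \<nu> (- (y\<^sup>2 / 4 * (of_real (exp (- u)))\<^sup>2))) \<le> max C M * exp (\<bar>Im y\<bar> * exp (- u))"
      using growth[of "y * of_real (exp (- u))"] by (simp add: power_mult_distrib abs_mult)
    moreover have "Re (y\<^sup>2 / 4 * of_real (exp (- u) / h)) = ((Re y)\<^sup>2 - (Im y)\<^sup>2) / (4 * h) * exp (- u)"
      by (simp add: power2_eq_square field_simps)
    then have "norm (exp (y\<^sup>2 / 4 * of_real (exp (- u) / h))) = exp (((Re y)\<^sup>2 - (Im y)\<^sup>2) / (4 * h) * exp (- u))"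
      by (simp only: norm_exp_eq_Re)
    ultimately have "norm (macdonald_integrand (y\<^sup>2 / 4) u) \<le>
      macdonald_kernel u * exp (((Re y)\<^sup>2 - (Im y)\<^sup>2) / (4 * h) * exp (- u)) * (max C M * exp (\<bar>Im y\<bar> * exp (- u)))"
      unfolding macdonald_integrand_def norm_mult by (intro mult_mono) (auto simp: macdonald_kernel_def)
    also have "\<dots> = max C M * exp (- (h * exp u) - h * exp (- u) - \<nu> * u
        + ((Re y)\<^sup>2 - (Im y)\<^sup>2) / (4 * h) * exp (- u) + \<bar>Im y\<bar> * exp (- u))"
      unfolding macdonald_kernel_def exp_add by (simp only: mult_ac)
    also have "- (h * exp u) - h * exp (- u) - \<nu> * u + ((Re y)\<^sup>2 - (Im y)\<^sup>2) / (4 * h) * exp (- u) + \<bar>Im y\<bar> * exp (- u)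
      = - (h * exp u) - \<delta> y * exp (- u) - \<nu> * u"
      by (simp add: \<delta>_def ring_distribs)
    finally show ?thesis .
  qed
  have cont\<delta>: "continuous_on UNIV \<delta>"
    unfolding \<delta>_def using h by (intro continuous_intros) auto
  have openD: "open ?D"
    by (intro open_Collect_less continuous_intros)
  have convD: "convex ?D"
  proof (rule convexI, clarsimp)
    fix x y :: complex and a b :: real
    assume xy: "\<bar>Re x\<bar> + \<bar>Im x\<bar> < 2 * h" "\<bar>Re y\<bar> + \<bar>Im y\<bar> < 2 * h" and ab: "0 \<le> a" "0 \<le> b" "a + b = 1"
    have "\<bar>a * Re x + b * Re y\<bar> + \<bar>a * Im x + b * Im y\<bar> \<le> (a * \<bar>Re x\<bar> + b * \<bar>Re y\<bar>) + (a * \<bar>Im x\<bar> + b * \<bar>Im y\<bar>)"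
      using ab by (intro add_mono order_trans[OF abs_triangle_ineq]) (auto simp: abs_mult)
    also have "\<dots> = a * (\<bar>Re x\<bar> + \<bar>Im x\<bar>) + b * (\<bar>Re y\<bar> + \<bar>Im y\<bar>)" by (simp add: algebra_simps)
    also have "\<dots> < 2 * h" using xy ab by (intro convex_bound_lt)
    finally show "\<bar>a * Re x + b * Re y\<bar> + \<bar>a * Im x + b * Im y\<bar> < 2 * h" .
  qed
  have hol: "(\<lambda>y. \<integral>u. macdonald_integrand (y\<^sup>2 / 4) u \<partial>lborel) holomorphic_on ?D"
  proof (rule holomorphic_integral_param[OF openD])
    show "(\<lambda>y. macdonald_integrand (y\<^sup>2 / 4) u) holomorphic_on ?D" for u
      unfolding macdonald_integrand_def by (intro holomorphic_intros) auto
    show "macdonald_integrand (y\<^sup>2 / 4) \<in> borel_measurable lborel" for y by measurable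
    fix y0 assume y0: "y0 \<in> ?D"
    have "open (?D \<inter> {y. \<delta> y0 / 2 < \<delta> y})"
      by (intro open_Int openD open_Collect_less cont\<delta> continuous_intros)
    moreover have "y0 \<in> ?D \<inter> {y. \<delta> y0 / 2 < \<delta> y}" using y0 \<delta>_pos[OF y0] by simp
    ultimately obtain r where r: "r > 0" "ball y0 r \<subseteq> ?D \<inter> {y. \<delta> y0 / 2 < \<delta> y}"
      by (meson open_contains_ball)
    show "\<exists>r>0. \<exists>g. ball y0 r \<subseteq> ?D \<and> integrable lborel g \<and>
        (\<forall>y\<in>ball y0 r. \<forall>u\<in>space lborel. norm (macdonald_integrand (y\<^sup>2 / 4) u) \<le> g u)"
    proof (intro exI conjI ballI)
      show "integrable lborel (\<lambda>u. max C M * exp (- (h * exp u) - \<delta> y0 / 2 * exp (- u) - \<nu> * u))"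
        using \<delta>_pos[OF y0] h by (intro integrable_mult_right integrable_dexp) auto
      fix y u assume "y \<in> ball y0 r"
      then have "\<delta> y0 / 2 \<le> \<delta> y" using r(2) by force
      then have "\<delta> y0 / 2 * exp (- u) \<le> \<delta> y * exp (- u)" by (intro mult_right_mono) auto
      then have "max C M * exp (- (h * exp u) - \<delta> y * exp (- u) - \<nu> * u) \<le> max C M * exp (- (h * exp u) - \<delta> y0 / 2 * exp (- u) - \<nu> * u)"
        using C(1) by (intro mult_left_mono) auto
      with bound[of y u] show "norm (macdonald_integrand (y\<^sup>2 / 4) u) \<le> max C M * exp (- (h * exp u) - \<delta> y0 / 2 * exp (- u) - \<nu> * u)"
        by linarith
    qed (use r in auto)
  qed
  show ?thesis
  \<comment> \<open>The radius h/4 gives |y^2/4| \<le> h^2/64, the range of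
    \<open>macdonald_integral_small\<close>.\<close>
  proof (rule analytic_continuation_open[where s = "ball 0 (h / 4)" and s' = ?D and z = y
        and f = "\<lambda>y. \<integral>u. macdonald_integrand (y\<^sup>2 / 4) u \<partial>lborel"
        and g = "\<lambda>y. of_real (dexp_int h h \<nu>) * bessel_ser \<nu> (- (y\<^sup>2 / 4))"])
    show "ball 0 (h / 4) \<subseteq> ?D"
    proof
      fix y :: complex assume "y \<in> ball 0 (h / 4)"
      then have "norm y < h / 4" by simp
      with abs_Re_le_cmod[of y] abs_Im_le_cmod[of y] h have "\<bar>Re y\<bar> + \<bar>Im y\<bar> < 2 * h" by linarith
      then show "y \<in> ?D" by simp
    qed
    fix y :: complex assume "y \<in> ball 0 (h / 4)"
    then have "(norm y)\<^sup>2 \<le> (h / 4)\<^sup>2" by (intro power_mono) auto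
    then have "norm (y\<^sup>2 / 4) \<le> h\<^sup>2 / 64" by (simp add: norm_divide norm_power power_divide)
    then show "(\<integral>u. macdonald_integrand (y\<^sup>2 / 4) u \<partial>lborel) = of_real (dexp_int h h \<nu>) * bessel_ser \<nu> (- (y\<^sup>2 / 4))"
      by (rule macdonald_integral_small)
  qed (use assms h openD convD hol in \<open>auto intro!: holomorphic_intros convex_connected\<close>)
qed

text \<open>The case Y = h^2, that is x = X, in which exp (Y exp (-u)/h) cancels exp (- h exp
  (-u)).\<close>

definition macdonald_diagonal :: "real \<Rightarrow> complex" where
  "macdonald_diagonal u = of_real (exp (- (h * exp u) - \<nu> * u)) * bessel_ser \<nu> (- (of_real (h * exp (- u)))\<^sup>2)"

text \<open>By \<open>bessel_ser_growth\<close> at w = x exp (-u), the Bessel factor is O(exp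
  ((\<nu> + 1/2) u)); with exp (- \<nu> u) this leaves exp (u/2), integrable at u -> -\<infinity>
  and uniform for h \<le> x \<le> 2 h.\<close>

lemma macdonald_integral_diagonal:
  "integrable lborel macdonald_diagonal" "(\<integral>u. macdonald_diagonal u \<partial>lborel) = of_real (dexp_int h h \<nu>) * bessel_ser \<nu> (- (of_real h)\<^sup>2)"
proof -
  obtain C where C: "C \<ge> 0"
    "\<And>w. norm w powr (\<nu> + 1/2) * norm (bessel_ser \<nu> (- (w\<^sup>2 / 4))) \<le> C * exp \<bar>Im w\<bar>"
    using bessel_ser_growth[OF nu] by blast
  \<comment> \<open>The shift n + 2 starts the sequence at h, so all terms lie in [h, 2 h), where
    the bound is uniform and the diamond identity holds.\<close>
  define y where "y = (\<lambda>n. 2 * h * (1 - 1 / real (n + 2)))"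
  define K where "K = C * h powr (- \<nu> - 1/2)"
  have y_bounds: "h \<le> y n" "y n < 2 * h" for n
    using h by (simp_all add: y_def field_simps)
  have bound: "norm (macdonald_integrand (of_real (x\<^sup>2 / 4)) u) \<le> K * exp (- (h * exp u) + 1/2 * u)" if x: "h \<le> x" "x \<le> 2 * h" for x u
  proof -
    let ?w = "complex_of_real (x * exp (- u))"
    have C': "norm ?w powr (\<nu> + 1/2) * norm (bessel_ser \<nu> (- (?w\<^sup>2 / 4))) \<le> C" using C(2)[of ?w] by simp
    have p: "norm ?w powr (\<nu> + 1/2) = x powr (\<nu> + 1/2) * exp (- (\<nu> + 1/2) * u)"
    proof -
      have "norm ?w = x * exp (- u)" unfolding norm_of_real using x h by simp
      then show ?thesis using x h by (simp add: powr_mult) (simp add: powr_def algebra_simps)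
    qed
    have "h powr (\<nu> + 1/2) \<le> x powr (\<nu> + 1/2)" using x h nu by (intro powr_mono2) auto
    then have "h powr (\<nu> + 1/2) * exp (- (\<nu> + 1/2) * u) * norm (bessel_ser \<nu> (- (?w\<^sup>2 / 4)))
        \<le> x powr (\<nu> + 1/2) * exp (- (\<nu> + 1/2) * u) * norm (bessel_ser \<nu> (- (?w\<^sup>2 / 4)))"
      by (intro mult_right_mono) auto
    also have "\<dots> \<le> C" using C' unfolding p .
    finally have "h powr (\<nu> + 1/2) * exp (- (\<nu> + 1/2) * u) * norm (bessel_ser \<nu> (- (?w\<^sup>2 / 4))) \<le> C" .
    then have "exp (- (\<nu> + 1/2) * u) * norm (bessel_ser \<nu> (- (?w\<^sup>2 / 4))) \<le> C / h powr (\<nu> + 1/2)"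
      using h by (simp add: pos_le_divide_eq mult_ac)
    also have "C / h powr (\<nu> + 1/2) = K"
    proof -
      have "- \<nu> - 1/2 = - (\<nu> + 1/2)" by simp
      then show ?thesis by (simp only: K_def powr_minus divide_inverse)
    qed
    finally have B: "exp (- (\<nu> + 1/2) * u) * norm (bessel_ser \<nu> (- (?w\<^sup>2 / 4))) \<le> K" .
    have ex: "macdonald_kernel u * exp (x\<^sup>2 / 4 * (exp (- u) / h)) \<le> exp (- (h * exp u) + 1/2 * u) * exp (- (\<nu> + 1/2) * u)"
    proof -
      have "x\<^sup>2 \<le> (2 * h)\<^sup>2" using x h by (intro power_mono) auto
      then have "x\<^sup>2 / 4 * (exp (- u) / h) \<le> (2 * h)\<^sup>2 / 4 * (exp (- u) / h)"
        using h by (intro mult_right_mono) auto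
      also have "\<dots> = h * exp (- u)" using h by (simp add: power2_eq_square)
      finally show ?thesis
        unfolding macdonald_kernel_def exp_add[symmetric] by (simp add: algebra_simps)
    qed
    have "norm (macdonald_integrand (of_real (x\<^sup>2 / 4)) u) = macdonald_kernel u * exp (x\<^sup>2 / 4 * (exp (- u) / h)) * norm (bessel_ser \<nu> (- (?w\<^sup>2 / 4)))"
    proof -
      have a: "of_real (x\<^sup>2 / 4) * (complex_of_real (exp (- u)))\<^sup>2 = ?w\<^sup>2 / 4" by (simp add: power_mult_distrib)
      have "norm (exp (complex_of_real (x\<^sup>2 / 4) * of_real (exp (- u) / h))) = exp (x\<^sup>2 / 4 * (exp (- u) / h))"
        by (simp flip: of_real_mult)
      then show ?thesis unfolding macdonald_integrand_def norm_mult a by (simp add: macdonald_kernel_def)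
    qed
    also have "\<dots> \<le> exp (- (h * exp u) + 1/2 * u) * exp (- (\<nu> + 1/2) * u) * norm (bessel_ser \<nu> (- (?w\<^sup>2 / 4)))"
      using ex by (rule mult_right_mono) simp
    also have "\<dots> \<le> exp (- (h * exp u) + 1/2 * u) * K"
      unfolding mult.assoc using B by (intro mult_left_mono) auto
    finally show ?thesis by (simp add: mult.commute)
  qed
  have dom: "integrable lborel (\<lambda>u. K * exp (- (h * exp u) + 1/2 * u))"
    using h by (intro integrable_mult_right integrable_exp_exp) auto
  have diag_eq: "macdonald_diagonal u = macdonald_integrand (of_real ((2 * h)\<^sup>2 / 4)) u" for u
  proof -
    have "macdonald_kernel u * exp ((2 * h)\<^sup>2 / 4 * (exp (- u) / h)) = exp (- (h * exp u) - \<nu> * u)"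
      using h unfolding macdonald_kernel_def exp_add[symmetric] by (simp add: power2_eq_square)
    moreover have "of_real ((2 * h)\<^sup>2 / 4) * (complex_of_real (exp (- u)))\<^sup>2 = (of_real (h * exp (- u)))\<^sup>2"
      by (simp add: power_mult_distrib)
    moreover have "exp (of_real ((2 * h)\<^sup>2 / 4) * complex_of_real (exp (- u) / h)) = of_real (exp ((2 * h)\<^sup>2 / 4 * (exp (- u) / h)))"
      by (simp flip: exp_of_real)
    ultimately show ?thesis unfolding macdonald_diagonal_def macdonald_integrand_def by (metis of_real_mult)
  qed
  have diag_meas: "macdonald_diagonal \<in> borel_measurable lborel" unfolding diag_eq[abs_def] by measurable
  show "integrable lborel macdonald_diagonal"
  proof (rule Bochner_Integration.integrable_bound[OF dom diag_meas])
    show "AE u in lborel. norm (macdonald_diagonal u) \<le> norm (K * exp (- (h * exp u) + 1/2 * u))"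
      unfolding diag_eq using bound[of "2 * h"] h by (intro AE_I2 order_trans[OF bound]) auto
  qed
  have lim_y: "y \<longlonglongrightarrow> 2 * h"
  proof -
    have "(\<lambda>n. 2 * h * (1 - 1 / real (n + 2))) \<longlonglongrightarrow> 2 * h * (1 - 0)"
      by (intro tendsto_intros) real_asymp
    then show ?thesis by (simp add: y_def)
  qed
  have "(\<lambda>n. \<integral>u. macdonald_integrand (of_real ((y n)\<^sup>2 / 4)) u \<partial>lborel) \<longlonglongrightarrow> (\<integral>u. macdonald_diagonal u \<partial>lborel)"
  proof (rule integral_dominated_convergence[OF diag_meas _ dom])
    show "AE u in lborel. norm (macdonald_integrand (of_real ((y n)\<^sup>2 / 4)) u) \<le> K * exp (- (h * exp u) + 1/2 * u)" for n
      using bound y_bounds[of n] by (intro AE_I2) auto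
    have "(\<lambda>n. macdonald_integrand (of_real ((y n)\<^sup>2 / 4)) u) \<longlonglongrightarrow> macdonald_diagonal u" for u
    proof -
      have "continuous_on UNIV (\<lambda>x. macdonald_integrand (of_real (x\<^sup>2 / 4)) u)"
        unfolding macdonald_integrand_def by (intro continuous_intros) auto
      then show ?thesis unfolding diag_eq by (rule continuous_on_tendsto_compose[OF _ lim_y]) auto
    qed
    then show "AE u in lborel. (\<lambda>n. macdonald_integrand (of_real ((y n)\<^sup>2 / 4)) u) \<longlonglongrightarrow> macdonald_diagonal u" by simp
  qed measurable
  moreover have "(\<integral>u. macdonald_integrand (of_real ((y n)\<^sup>2 / 4)) u \<partial>lborel)
      = of_real (dexp_int h h \<nu>) * bessel_ser \<nu> (- of_real ((y n)\<^sup>2 / 4))" for n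
    using macdonald_integral_diamond[of "of_real (y n)"] y_bounds[of n] h by simp
  moreover have "(\<lambda>n. of_real (dexp_int h h \<nu>) * bessel_ser \<nu> (- of_real ((y n)\<^sup>2 / 4)))
      \<longlonglongrightarrow> of_real (dexp_int h h \<nu>) * bessel_ser \<nu> (- of_real ((2 * h)\<^sup>2 / 4))"
  proof -
    have "continuous_on UNIV (\<lambda>x. of_real (dexp_int h h \<nu>) * bessel_ser \<nu> (- of_real (x\<^sup>2 / 4)))"
      by (intro continuous_intros) auto
    then show ?thesis by (rule continuous_on_tendsto_compose[OF _ lim_y]) auto
  qed
  ultimately have "(\<integral>u. macdonald_diagonal u \<partial>lborel) = of_real (dexp_int h h \<nu>) * bessel_ser \<nu> (- of_real ((2 * h)\<^sup>2 / 4))"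
    by (auto dest: LIMSEQ_unique)
  then show "(\<integral>u. macdonald_diagonal u \<partial>lborel) = of_real (dexp_int h h \<nu>) * bessel_ser \<nu> (- (of_real h)\<^sup>2)"
    by (simp add: power_mult_distrib)
qed

end

subsection \<open>The contour integral\<close>

lemma besselJ_integral_pos_real:
  assumes nu: "\<nu> \<ge> -1/2" and x: "x > 0"
  shows "((\<lambda>c. besselJ \<nu> (of_real c * of_real x) * exp (-2 / of_real c) / of_real c)
           has_integral 2 * besselJ \<nu> (2 * csqrt (of_real x)) * besselK \<nu> (2 * csqrt (of_real x))) {0<..}"
proof -
  define h where "h = sqrt x"
  have h: "h > 0" "h\<^sup>2 = x" using x by (simp_all add: h_def)
  let ?f = "\<lambda>c::real. besselJ \<nu> (of_real c * of_real x) * exp (-2 / of_real c) / of_real c"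
  \<comment> \<open>Combining t = 4/c with t = 2 h exp u gives exp u = 2/(h c): then h exp u = 2/c
    and h exp (-u) = c x/2. The prefactor h^\<nu> becomes the power in J_\<nu>(2 h).\<close>
  have sub: "of_real (exp t) * ?f (exp t) = of_real (h powr \<nu>) * macdonald_diagonal h \<nu> (ln (2 / h) + (-1) * t)" for t
  proof -
    have e1: "exp (ln (2 / h) + (-1) * t) = 2 / h * exp (- t)" "exp (- (ln (2 / h) + (-1) * t)) = h / 2 * exp t"
      using h by (simp_all add: exp_add exp_diff exp_minus field_simps)
    have e2: "h * (2 / h * exp (- t)) = 2 * exp (- t)" "h * (h / 2 * exp t) = x * exp t / 2"
      using h by (simp_all add: power2_eq_square field_simps)
    have "h powr \<nu> * exp (- \<nu> * (ln (2 / h) + (-1) * t)) = (x * exp t / 2) powr \<nu>"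
    proof -
      have "x * exp t / 2 = h * exp (- (ln (2 / h) + (-1) * t))" unfolding e1 e2 by simp
      then show ?thesis using h by (simp add: powr_mult) (simp add: powr_def algebra_simps)
    qed
    moreover have "- (h * exp (ln (2 / h) + (-1) * t)) - \<nu> * (ln (2 / h) + (-1) * t)
        = - \<nu> * (ln (2 / h) + (-1) * t) + (- 2 * exp (- t))"
      unfolding e1 e2 by simp
    ultimately have eq: "h powr \<nu> * exp (- (h * exp (ln (2 / h) + (-1) * t)) - \<nu> * (ln (2 / h) + (-1) * t))
        = (x * exp t / 2) powr \<nu> * exp (- 2 * exp (- t))"
      by (simp only: exp_add mult.assoc[symmetric])
    have "h * exp (- (ln (2 / h) + (-1) * t)) = x * exp t / 2" unfolding e1 e2 by simp
    then have "of_real (h powr \<nu>) * macdonald_diagonal h \<nu> (ln (2 / h) + (-1) * t)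
       = of_real (h powr \<nu> * exp (- (h * exp (ln (2 / h) + (-1) * t)) - \<nu> * (ln (2 / h) + (-1) * t)))
          * bessel_ser \<nu> (- (of_real (x * exp t / 2))\<^sup>2)"
      by (simp only: macdonald_diagonal_def[OF h(1) nu] of_real_mult mult.assoc)
    also have "\<dots> = of_real ((x * exp t / 2) powr \<nu> * exp (- 2 * exp (- t))) * bessel_ser \<nu> (- (of_real (x * exp t / 2))\<^sup>2)"
      unfolding eq ..
    also have "\<dots> = (of_real (exp t * x) / 2) powr of_real \<nu> * bessel_ser \<nu> (- ((of_real (exp t * x))\<^sup>2 / 4)) * exp (-2 / of_real (exp t))"
    proof -
      have "exp (-2 / of_real (exp t)) = complex_of_real (exp (- 2 * exp (- t)))"
        by (simp add: exp_minus divide_inverse flip: exp_of_real)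
      moreover have "(of_real (exp t * x) / 2) powr of_real \<nu> = complex_of_real ((x * exp t / 2) powr \<nu>)"
        using x powr_of_real[of "x * exp t / 2" \<nu>] by (simp add: mult.commute)
      moreover have "(complex_of_real (exp t * x))\<^sup>2 / 4 = (of_real (x * exp t / 2))\<^sup>2"
        by (simp add: power_divide mult.commute)
      ultimately show ?thesis by simp
    qed
    finally show ?thesis by (simp add: besselJ_eq)
  qed
  have int: "integrable lborel (\<lambda>t. of_real (exp t) * ?f (exp t))"
    unfolding sub
    by (intro integrable_mult_right lborel_integrable_real_affine macdonald_integral_diagonal(1) h nu) simp
  have "(?f has_integral (\<integral>t. of_real (exp t) * ?f (exp t) \<partial>lborel)) {0<..}"
    by (rule has_integral_exp_substitution[OF int])
  also have "(\<integral>t. of_real (exp t) * ?f (exp t) \<partial>lborel) = of_real (h powr \<nu>) * (\<integral>t. macdonald_diagonal h \<nu> (ln (2 / h) + (-1) * t) \<partial>lborel)"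
    unfolding sub by simp
  also have "(\<integral>t. macdonald_diagonal h \<nu> (ln (2 / h) + (-1) * t) \<partial>lborel) = (\<integral>t. macdonald_diagonal h \<nu> t \<partial>lborel)"
    using lborel_integral_real_affine[of "-1" "macdonald_diagonal h \<nu>" "ln (2 / h)"] by simp
  also have "\<dots> = of_real (dexp_int h h \<nu>) * bessel_ser \<nu> (- (of_real h)\<^sup>2)"
    by (rule macdonald_integral_diagonal(2)[OF h(1) nu])
  also have "of_real (h powr \<nu>) * (of_real (dexp_int h h \<nu>) * bessel_ser \<nu> (- (of_real h)\<^sup>2))
      = 2 * besselJ \<nu> (2 * csqrt (of_real x)) * besselK \<nu> (2 * csqrt (of_real x))"
  proof -
    have w: "2 * csqrt (of_real x) = of_real (2 * h)" using x by (simp add: h_def)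
    have J: "besselJ \<nu> (of_real (2 * h)) = of_real (h powr \<nu>) * bessel_ser \<nu> (- (of_real h)\<^sup>2)"
      using h by (simp add: besselJ_eq powr_of_real power_mult_distrib)
    have K: "besselK \<nu> (of_real (2 * h)) = of_real (dexp_int h h \<nu> / 2)"
      using besselK_eq_int[of \<nu> "of_real (2 * h)"] besselK_int_of_real[of \<nu> "2 * h"] h nu by simp
    show ?thesis unfolding w J K by simp
  qed
  finally show ?thesis .
qed

section \<open>Geometry of the slit plane and bounds for J_\<nu> on it\<close>

abbreviation slit_plane :: "complex set" where "slit_plane \<equiv> - \<real>\<^sub>\<le>\<^sub>0"

text \<open>The quantity is 2 (Re (csqrt z))^2. In this form membership becomes positivity of a
  continuous function, which serves for the lower bounds on |c z| and for Re (csqrt z) > 0.\<close>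

lemma slit_plane_iff: "z \<in> slit_plane \<longleftrightarrow> norm z + Re z > 0"
proof -
  have "norm z + Re z \<ge> 0" using abs_Re_le_cmod[of z] by linarith
  moreover have "norm z + Re z = 0 \<longleftrightarrow> Re z \<le> 0 \<and> Im z = 0"
  proof
    assume eq: "norm z + Re z = 0"
    then have "norm z ^ 2 = (Re z) ^ 2" by (simp add: add_eq_0_iff)
    then have "Im z = 0" by (simp add: cmod_power2)
    moreover have "Re z \<le> 0" using eq norm_ge_zero[of z] by linarith
    ultimately show "Re z \<le> 0 \<and> Im z = 0" by simp
  qed (auto simp: cmod_eq_Re)
  ultimately have "norm z + Re z > 0 \<longleftrightarrow> \<not> (Re z \<le> 0 \<and> Im z = 0)" by linarith
  then show ?thesis by (simp add: complex_nonpos_Reals_iff)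
qed

lemma open_slit_plane: "open slit_plane"
  by (simp add: open_Compl closed_nonpos_Reals_complex)

lemma connected_slit_plane: "connected slit_plane"
proof -
  have "slit_plane = - (complex_of_real ` {..0})"
    by (auto simp: nonpos_Reals_def)
  then show ?thesis by (metis starlike_slotted_complex_plane_left starlike_imp_connected)
qed

text \<open>In terms of angles: with \<open>\<phi> = Arg z\<close>, the first factor is \<open>cos (\<phi>/2)\<close>.\<close>

lemma norm_ray_plus_real_ge:
  assumes "z \<noteq> 0" "a > 0" "s \<ge> 0"
  shows "sqrt ((norm z + Re z) / (2 * norm z)) * (a * norm z + s) \<le> norm (of_real a * z + of_real s)"
proof (rule power2_le_imp_le)
  define \<rho> where "\<rho> = norm z"
  have \<rho>: "\<rho> > 0" using assms by (simp add: \<rho>_def)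
  have Re: "Re z \<le> \<rho>" "- \<rho> \<le> Re z" using abs_Re_le_cmod[of z] by (auto simp: \<rho>_def abs_le_iff)
  have "(norm (of_real a * z + of_real s))\<^sup>2 = (a * \<rho>)\<^sup>2 + 2 * a * s * Re z + s\<^sup>2"
    unfolding cmod_power2 \<rho>_def power_mult_distrib by (simp add: power2_eq_square algebra_simps)
  also have "\<dots> = (a * \<rho> + s)\<^sup>2 - 4 * (a * \<rho> * s) * ((\<rho> - Re z) / (2 * \<rho>))"
    using \<rho> by (simp add: power2_eq_square field_simps)
  \<comment> \<open>The inequality of the means, 4 a \<rho> s \<le> (a \<rho> + s)^2; its
    coefficient is sin^2 (\<phi>/2).\<close>
  also have "\<dots> \<ge> (a * \<rho> + s)\<^sup>2 - (a * \<rho> + s)\<^sup>2 * ((\<rho> - Re z) / (2 * \<rho>))"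
  proof -
    have "0 \<le> (a * \<rho> - s)\<^sup>2" by simp
    then have "4 * (a * \<rho> * s) \<le> (a * \<rho> + s)\<^sup>2" by (simp add: power2_sum power2_diff mult_ac)
    then show ?thesis using Re \<rho> by (intro diff_left_mono mult_right_mono) auto
  qed
  finally have "(norm (of_real a * z + of_real s))\<^sup>2 \<ge> (a * \<rho> + s)\<^sup>2 * (1 - (\<rho> - Re z) / (2 * \<rho>))"
    by (simp add: algebra_simps)
  also have "1 - (\<rho> - Re z) / (2 * \<rho>) = (\<rho> + Re z) / (2 * \<rho>)" using \<rho> by (simp add: field_simps)
  finally show "(sqrt ((norm z + Re z) / (2 * norm z)) * (a * norm z + s))\<^sup>2 \<le> (norm (of_real a * z + of_real s))\<^sup>2"
    using Re \<rho> by (simp add: power_mult_distrib mult.commute flip: \<rho>_def)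
qed simp

lemma slit_plane_ray_plus_real:
  assumes "z \<in> slit_plane" "a > 0" "s \<ge> 0"
  shows "of_real a * z + of_real s \<in> slit_plane"
proof (cases "Im z = 0")
  case True
  then have "Re z > 0" using assms by (auto simp: complex_nonpos_Reals_iff)
  then have "a * Re z + s > 0" using assms by (simp add: add_pos_nonneg)
  then show ?thesis by (simp add: complex_nonpos_Reals_iff)
qed (use assms in \<open>simp add: complex_nonpos_Reals_iff\<close>)

lemma slit_plane_scale: "z \<in> slit_plane \<Longrightarrow> a > 0 \<Longrightarrow> of_real a * z \<in> slit_plane"
  using slit_plane_ray_plus_real[of z a 0] by simp

lemma holomorphic_on_besselJ: "besselJ \<nu> holomorphic_on slit_plane"
proof -
  have "(\<lambda>w. (w / 2) powr of_real \<nu> * bessel_ser \<nu> (- (w\<^sup>2 / 4))) holomorphic_on slit_plane"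
    by (intro holomorphic_intros) (auto simp: complex_nonpos_Reals_iff)
  then show ?thesis by (simp add: besselJ_eq[abs_def])
qed

text \<open>As \<nu> is real, |(w/2)^\<nu>| = |w/2|^\<nu> on either side of the cut and on
  it.\<close>

lemma besselJ_growth:
  assumes "\<nu> \<ge> -1/2"
  obtains C where "C \<ge> 0" "\<And>w. w \<noteq> 0 \<Longrightarrow> norm (besselJ \<nu> w) \<le> C * norm w powr (-1/2) * exp \<bar>Im w\<bar>"
proof -
  obtain C where C: "C \<ge> 0"
    "\<And>w. norm w powr (\<nu> + 1/2) * norm (bessel_ser \<nu> (- (w\<^sup>2 / 4))) \<le> C * exp \<bar>Im w\<bar>"
    using bessel_ser_growth[OF assms] by blast
  have "norm (besselJ \<nu> w) \<le> 2 powr (- \<nu>) * C * norm w powr (-1/2) * exp \<bar>Im w\<bar>" if w: "w \<noteq> 0" for w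
  proof -
    have "norm ((w / 2) powr of_real \<nu>) = (norm w / 2) powr \<nu>"
      by (simp add: norm_powr_real_powr' norm_divide)
    also have "\<dots> = 2 powr (- \<nu>) * norm w powr \<nu>" by (simp add: powr_divide powr_minus_divide)
    also have "norm w powr \<nu> = norm w powr (-1/2) * norm w powr (\<nu> + 1/2)" by (simp flip: powr_add)
    finally have "norm (besselJ \<nu> w) = 2 powr (- \<nu>) * norm w powr (-1/2) * (norm w powr (\<nu> + 1/2) * norm (bessel_ser \<nu> (- (w\<^sup>2 / 4))))"
      by (simp add: besselJ_eq norm_mult)
    also have "\<dots> \<le> 2 powr (- \<nu>) * norm w powr (-1/2) * (C * exp \<bar>Im w\<bar>)"
      by (intro mult_left_mono C) auto
    finally show ?thesis by (simp add: mult_ac)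
  qed
  moreover have "2 powr (- \<nu>) * C \<ge> 0" using C(1) by simp
  ultimately show ?thesis using that by blast
qed

section \<open>The contour integral as a holomorphic function of z\<close>

lemma integrable_powr_tail:
  assumes "a > (0::real)"
  shows "integrable lborel (\<lambda>t. indicator {a<..} t * t powr (-3/2))"
proof -
  have "(\<lambda>t::real. t powr (-3/2)) absolutely_integrable_on {a..}"
    using has_integral_powr_to_inf[of "-3/2" a] assms by (intro nonnegative_absolutely_integrable_1) auto
  then have "(\<lambda>t::real. t powr (-3/2)) absolutely_integrable_on {a<..}"
    by (rule set_integrable_subset) auto
  moreover have "(\<lambda>t. indicator {a<..} t *\<^sub>R t powr (-3/2)) \<in> borel_measurable borel" by measurable
  ultimately show ?thesis
    unfolding set_integrable_def by (simp add: integrable_completion)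
qed

text \<open>On the tail c = w/z with w = a z + (t - a), so exp (-2/c) becomes exp (- 2 z/w) and dc/c
  becomes dt/w: neither Arg z nor |z| remains.\<close>

definition path_integrand :: "real \<Rightarrow> real \<Rightarrow> complex \<Rightarrow> real \<Rightarrow> complex" where
  "path_integrand \<nu> a z t =
     indicator {0<..a} t *\<^sub>R (besselJ \<nu> (of_real t * z) * exp (-2 / of_real t) / of_real t) +
     indicator {a<..} t *\<^sub>R (besselJ \<nu> (of_real a * z + of_real (t - a)) *
       exp (-2 * z / (of_real a * z + of_real (t - a))) / (of_real a * z + of_real (t - a)))"

lemma zero_notin_slit_plane: "z \<in> slit_plane \<Longrightarrow> z \<noteq> 0"
  by auto

lemma path_integrand_measurable [measurable]:
  assumes "z \<in> slit_plane" "a > 0"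
  shows "path_integrand \<nu> a z \<in> borel_measurable lborel"
proof -
  have Jc: "continuous_on A (\<lambda>x. besselJ \<nu> (f x))" if "continuous_on A f" "f ` A \<subseteq> slit_plane" for f and A :: "real set"
    by (rule continuous_on_compose2[OF holomorphic_on_imp_continuous_on[OF holomorphic_on_besselJ] that])
  have 1: "of_real t * z \<in> slit_plane" if "t \<in> {0<..a}" for t
    using that slit_plane_scale[OF assms(1)] by simp
  have 2: "of_real a * z + of_real (t - a) \<in> slit_plane" if "t \<in> {a<..}" for t
    using that by (intro slit_plane_ray_plus_real assms) simp
  have "continuous_on {0<..a} (\<lambda>t. besselJ \<nu> (of_real t * z) * exp (-2 / of_real t) / of_real t)"
    by (intro continuous_intros Jc image_subsetI 1) auto
  moreover have "continuous_on {a<..} (\<lambda>t. besselJ \<nu> (of_real a * z + of_real (t - a)) *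
       exp (-2 * z / (of_real a * z + of_real (t - a))) / (of_real a * z + of_real (t - a)))"
    by (intro continuous_intros Jc image_subsetI 2 ballI zero_notin_slit_plane)
  ultimately show ?thesis
    unfolding measurable_lborel2 path_integrand_def
    by (intro borel_measurable_add borel_measurable_continuous_on_indicator) auto
qed

text \<open>The growth bound and the factor 1/c together produce the exponent -3/2. Near 0 it is
  absorbed by exp (-2/t); beyond \<open>a\<close> the argument of J_\<nu> has constant imaginary
  part, so it gives an integrable tail.\<close>

lemma path_integrand_dominated:
  assumes nu: "\<nu> \<ge> -1/2" and z0: "z0 \<in> slit_plane" and a: "a > 0"
  shows "\<exists>r>0. \<exists>g. ball z0 r \<subseteq> slit_plane \<and> integrable lborel g \<and>
           (\<forall>z\<in>ball z0 r. \<forall>t\<in>space lborel. norm (path_integrand \<nu> a z t) \<le> g t)"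
proof -
  obtain C where C: "C \<ge> 0" "\<And>w. w \<noteq> 0 \<Longrightarrow> norm (besselJ \<nu> w) \<le> C * norm w powr (-1/2) * exp \<bar>Im w\<bar>"
    using besselJ_growth[OF nu] by blast
  \<comment> \<open>A common lower bound for |z| and for |a z + s|/(a + s), the latter by
    \<open>norm_ray_plus_real_ge\<close>. By continuity, half its value at \<open>z0\<close> serves
    for all nearby z.\<close>
  define m where "m = (\<lambda>z. sqrt ((norm z + Re z) / (2 * norm z)) * min (norm z) 1)"
  have m_pos: "m z > 0" if "z \<in> slit_plane" for z
  proof -
    have "z \<noteq> 0" using that by auto
    moreover have "norm z + Re z > 0" using that slit_plane_iff by blast
    ultimately show ?thesis unfolding m_def by (intro mult_pos_pos real_sqrt_gt_zero divide_pos_pos) auto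
  qed
  have "continuous_on slit_plane m"
    unfolding m_def by (intro continuous_intros) auto
  then have "open (slit_plane \<inter> m -` {m z0 / 2<..})"
    by (intro continuous_open_preimage open_slit_plane) auto
  then have "open (ball z0 1 \<inter> (slit_plane \<inter> m -` {m z0 / 2<..}))" by auto
  moreover have "z0 \<in> ball z0 1 \<inter> (slit_plane \<inter> m -` {m z0 / 2<..})"
    using z0 m_pos[OF z0] by simp
  ultimately obtain r where r: "r > 0" "ball z0 r \<subseteq> ball z0 1 \<inter> (slit_plane \<inter> m -` {m z0 / 2<..})"
    by (meson open_contains_ball)
  define \<eta> where "\<eta> = m z0 / 2"
  have \<eta>: "\<eta> > 0" using m_pos[OF z0] by (simp add: \<eta>_def)
  define B where "B = norm z0 + 1"
  define K1 where "K1 = C * \<eta> powr (-1/2) * exp (a * B)"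
  define K2 where "K2 = C * \<eta> powr (-3/2) * exp (a * B) * exp (2 * B / (\<eta> * a))"
  show ?thesis
  proof (intro exI conjI ballI)
    show "r > 0" by (rule r(1))
    show "ball z0 r \<subseteq> slit_plane" using r(2) by auto
    show "integrable lborel (\<lambda>t. indicator {0<..a} t * K1 + K2 * (indicator {a<..} t * t powr (-3/2)))"
      using a by (intro Bochner_Integration.integrable_add integrable_mult_right integrable_powr_tail) auto
    fix z t assume "z \<in> ball z0 r"
    then have zr: "z \<in> ball z0 1" "z \<in> slit_plane" "m z > \<eta>" using r(2) by (auto simp: \<eta>_def)
    have zB: "norm z \<le> B" using zr(1) norm_triangle_ineq2[of z z0] by (simp add: B_def dist_norm norm_minus_commute)
    have z: "z \<noteq> 0" using zr(2) by auto
    have c1: "sqrt ((norm z + Re z) / (2 * norm z)) \<le> 1"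
      using abs_Re_le_cmod[of z] z by (simp add: divide_le_eq)
    have "m z \<le> 1 * norm z" unfolding m_def using c1 zr(2) slit_plane_iff[of z] by (intro mult_mono) auto
    then have z_lower: "\<eta> \<le> norm z" using zr(3) by simp
    have q_lower: "\<eta> * (a + s) \<le> norm (of_real a * z + of_real s)" if s: "s \<ge> 0" for s
    proof -
      have "\<eta> * (a + s) \<le> m z * (a + s)" using zr(3) a s by (intro mult_right_mono) auto
      also have "\<dots> = sqrt ((norm z + Re z) / (2 * norm z)) * (min (norm z) 1 * a + min (norm z) 1 * s)"
        by (simp add: m_def algebra_simps)
      also have "\<dots> \<le> sqrt ((norm z + Re z) / (2 * norm z)) * (norm z * a + 1 * s)"
        using a s zr(2) slit_plane_iff[of z] by (intro mult_left_mono add_mono mult_right_mono) auto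
      also have "\<dots> = sqrt ((norm z + Re z) / (2 * norm z)) * (a * norm z + s)" by (simp add: mult.commute)
      also have "\<dots> \<le> norm (of_real a * z + of_real s)" by (rule norm_ray_plus_real_ge[OF z a s])
      finally show ?thesis .
    qed
    consider "t \<le> 0" | "0 < t" "t \<le> a" | "t > a" by linarith
    then show "norm (path_integrand \<nu> a z t) \<le> indicator {0<..a} t * K1 + K2 * (indicator {a<..} t * t powr (-3/2))"
    proof cases
      case 1
      then show ?thesis using a by (simp add: path_integrand_def)
    next
      case 2
      have J: "norm (besselJ \<nu> (of_real t * z)) \<le> C * (\<eta> powr (-1/2) * t powr (-1/2)) * exp (a * B)"
      proof -
        have "norm (besselJ \<nu> (of_real t * z)) \<le> C * norm (of_real t * z) powr (-1/2) * exp \<bar>Im (of_real t * z)\<bar>"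
          using 2 z by (intro C) auto
        also have "\<dots> \<le> C * (\<eta> powr (-1/2) * t powr (-1/2)) * exp (a * B)"
        proof (intro mult_mono mult_left_mono)
          have "norm (of_real t * z) powr (-1/2) = t powr (-1/2) * norm z powr (-1/2)"
            using 2 by (simp add: norm_mult powr_mult)
          also have "\<dots> \<le> t powr (-1/2) * \<eta> powr (-1/2)"
            using z_lower \<eta> by (intro mult_left_mono powr_mono2') auto
          finally show "norm (of_real t * z) powr (-1/2) \<le> \<eta> powr (-1/2) * t powr (-1/2)" by (simp add: mult.commute)
          have "\<bar>Im (of_real t * z)\<bar> = t * \<bar>Im z\<bar>" using 2 by (simp add: abs_mult)
          also have "\<dots> \<le> a * B" using 2 zB abs_Im_le_cmod[of z] by (intro mult_mono) auto
          finally show "exp \<bar>Im (of_real t * z)\<bar> \<le> exp (a * B)" by simp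
        qed (use C in auto)
        finally show ?thesis .
      qed
      have "t powr (-1/2) * exp (-2 / t) / t = exp (- (3/2) * ln t - 2 / t)"
      proof -
        have e1: "1 / t = exp (- ln t)" using 2 by (simp add: exp_minus divide_inverse)
        have e2: "t powr (-1/2) = exp (-1/2 * ln t)" using 2 by (simp add: powr_def)
        have "t powr (-1/2) * exp (-2 / t) / t = t powr (-1/2) * exp (-2 / t) * (1 / t)" by simp
        also have "\<dots> = exp (-1/2 * ln t) * exp (-2 / t) * exp (- ln t)" unfolding e1 e2 ..
        also have "\<dots> = exp (- (3/2) * ln t - 2 / t)" unfolding exp_add[symmetric] by simp
        finally show ?thesis .
      qed
      \<comment> \<open>From ln y \<le> y - 1 at y = 1/t: - (3/2) ln t \<le> (3/2)/t < 2/t.\<close>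
      also have "\<dots> \<le> 1"
      proof -
        have "ln (1 / t) \<le> 1 / t - 1" using 2 by (intro ln_le_minus_one) auto
        then have "- ln t \<le> 1 / t" using 2 by (simp add: ln_div)
        moreover have "1 / t > 0" using 2 by simp
        ultimately have "- (3/2) * ln t - 2 / t \<le> 0" by (simp add: field_simps)
        then show ?thesis by simp
      qed
      finally have t1: "t powr (-1/2) * exp (-2 / t) / t \<le> 1" .
      have "norm (path_integrand \<nu> a z t) = norm (besselJ \<nu> (of_real t * z)) * (exp (-2 / t) / t)"
        using 2 by (simp add: path_integrand_def norm_mult norm_divide)
      also have "\<dots> \<le> C * (\<eta> powr (-1/2) * t powr (-1/2)) * exp (a * B) * (exp (-2 / t) / t)"
        using 2 by (intro mult_right_mono J) auto
      also have "\<dots> = K1 * (t powr (-1/2) * exp (-2 / t) / t)" by (simp add: K1_def)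
      also have "\<dots> \<le> K1 * 1" using C(1) by (intro mult_left_mono t1) (auto simp: K1_def)
      finally show ?thesis using 2 by simp
    next
      case 3
      define q where "q = of_real a * z + of_real (t - a)"
      have q: "\<eta> * t \<le> norm q" using q_lower[of "t - a"] 3 by (simp add: q_def)
      have q0: "norm q > 0" using q 3 a \<eta> by (meson less_le_trans less_trans mult_pos_pos)
      have "norm (besselJ \<nu> q) \<le> C * norm q powr (-1/2) * exp \<bar>Im q\<bar>"
        using q0 by (intro C) auto
      also have "\<dots> \<le> C * (\<eta> * t) powr (-1/2) * exp (a * B)"
      proof (intro mult_mono mult_left_mono)
        show "norm q powr (-1/2) \<le> (\<eta> * t) powr (-1/2)"
          using q \<eta> 3 a by (intro powr_mono2') auto
        have "\<bar>Im q\<bar> = a * \<bar>Im z\<bar>" using a by (simp add: q_def abs_mult)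
        also have "\<dots> \<le> a * B" using a zB abs_Im_le_cmod[of z] by (intro mult_left_mono) auto
        finally show "exp \<bar>Im q\<bar> \<le> exp (a * B)" by simp
      qed (use C in auto)
      finally have J: "norm (besselJ \<nu> q) \<le> C * (\<eta> * t) powr (-1/2) * exp (a * B)" .
      \<comment> \<open>As |q| \<ge> \<eta> a, the quotient z/q is bounded and the exponential costs
        only a constant.\<close>
      have e: "norm (exp (-2 * z / q)) \<le> exp (2 * B / (\<eta> * a))"
      proof -
        have "norm (exp (-2 * z / q)) \<le> exp (norm (-2 * z / q))" by (rule norm_exp)
        also have "norm (-2 * z / q) \<le> 2 * B / (\<eta> * a)"
        proof -
          have "\<eta> * a \<le> norm q" using q 3 \<eta> by (smt (verit) mult_left_mono)
          moreover have "0 \<le> B" by (simp add: B_def)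
          ultimately show ?thesis using zB \<eta> a unfolding norm_divide norm_mult by (intro frac_le) auto
        qed
        finally show ?thesis by simp
      qed
      have p: "(\<eta> * t) powr (-1/2) / (\<eta> * t) = \<eta> powr (-3/2) * t powr (-3/2)"
      proof -
        have "(\<eta> * t) powr (-1/2) / (\<eta> * t) = (\<eta> * t) powr (-3/2)"
          using \<eta> a 3 powr_diff[of "\<eta> * t" "-1/2" 1] by simp
        also have "\<dots> = \<eta> powr (-3/2) * t powr (-3/2)" using \<eta> a 3 by (simp add: powr_mult)
        finally show ?thesis .
      qed
      have "norm (path_integrand \<nu> a z t) = norm (besselJ \<nu> q) * norm (exp (-2 * z / q)) / norm q"
        using 3 unfolding path_integrand_def q_def[symmetric] by (simp add: norm_mult norm_divide)
      also have "\<dots> \<le> (C * (\<eta> * t) powr (-1/2) * exp (a * B)) * exp (2 * B / (\<eta> * a)) / (\<eta> * t)"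
        using J e q \<eta> a 3 C(1) by (intro frac_le mult_mono) auto
      also have "\<dots> = C * exp (a * B) * exp (2 * B / (\<eta> * a)) * ((\<eta> * t) powr (-1/2) / (\<eta> * t))" by simp
      also have "\<dots> = K2 * t powr (-3/2)" unfolding p K2_def by (simp only: mult_ac)
      finally show ?thesis using 3 by simp
    qed
  qed
qed

lemma integrable_path_integrand:
  assumes "\<nu> \<ge> -1/2" "z \<in> slit_plane" "a > 0"
  shows "integrable lborel (path_integrand \<nu> a z)"
proof -
  obtain r g where g: "r > 0" "integrable lborel g" "\<forall>w\<in>ball z r. \<forall>t\<in>space lborel. norm (path_integrand \<nu> a w t) \<le> g t"
    using path_integrand_dominated[OF assms] by blast
  show ?thesis
  proof (rule Bochner_Integration.integrable_bound[OF g(2) path_integrand_measurable[OF assms(2,3)]], rule AE_I2)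
    fix t :: real
    have "norm (path_integrand \<nu> a z t) \<le> g t" using g(1,3) by simp
    then show "norm (path_integrand \<nu> a z t) \<le> norm (g t)" by simp
  qed
qed

lemma holomorphic_on_path_integral:
  assumes "\<nu> \<ge> -1/2" "a > 0"
  shows "(\<lambda>z. \<integral>t. path_integrand \<nu> a z t \<partial>lborel) holomorphic_on slit_plane"
proof (rule holomorphic_integral_param[OF open_slit_plane _ path_integrand_measurable path_integrand_dominated])
  fix t :: real
  have Jh: "(\<lambda>z. besselJ \<nu> (f z)) holomorphic_on slit_plane"
    if "f holomorphic_on slit_plane" "f ` slit_plane \<subseteq> slit_plane" for f
    using holomorphic_on_compose_gen[OF that(1) holomorphic_on_besselJ that(2)] by (simp add: o_def)
  consider "t \<le> 0" | "0 < t" "t \<le> a" | "t > a" by linarith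
  then show "(\<lambda>z. path_integrand \<nu> a z t) holomorphic_on slit_plane"
  proof cases
    case 1
    then show ?thesis using assms by (simp add: path_integrand_def)
  next
    case 2
    then have "(\<lambda>z. besselJ \<nu> (of_real t * z) * exp (-2 / of_real t) / of_real t) holomorphic_on slit_plane"
      by (intro holomorphic_intros Jh) (use slit_plane_scale in auto)
    then show ?thesis using 2 by (simp add: path_integrand_def)
  next
    case 3
    have nz: "of_real a * z + of_real (t - a) \<noteq> 0" if "z \<in> slit_plane" for z
      using slit_plane_ray_plus_real[OF that assms(2), of "t - a"] 3 by (intro zero_notin_slit_plane) simp
    have "(\<lambda>z. besselJ \<nu> (of_real a * z + of_real (t - a)) *
       exp (-2 * z / (of_real a * z + of_real (t - a))) / (of_real a * z + of_real (t - a))) holomorphic_on slit_plane"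
      by (intro holomorphic_intros Jh nz image_subsetI slit_plane_ray_plus_real assms) (use 3 in auto)
    then show ?thesis using 3 by (simp add: path_integrand_def)
  qed
qed (use assms in auto)

section \<open>Return to the parametrisation by \<open>bessel_path\<close>, and continuation in
  z\<close>

lemma vector_derivative_bessel_path:
  assumes "t \<noteq> a"
  shows "vector_derivative (bessel_path a z) (at t) = (if t < a then 1 else cis (- Arg z))"
proof (cases "t < a")
  case True
  have "(bessel_path a z has_vector_derivative 1) (at t)"
  proof (rule has_vector_derivative_transform_within_open)
    show "(of_real has_vector_derivative (1 :: complex)) (at t)"
      by (auto intro!: derivative_eq_intros)
  qed (use True in \<open>auto simp: bessel_path_def intro: open_lessThan\<close>)
  then show ?thesis using True by (simp add: vector_derivative_at)
next
  case False
  have "(bessel_path a z has_vector_derivative cis (- Arg z)) (at t)"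
  proof (rule has_vector_derivative_transform_within_open)
    show "((\<lambda>t. of_real a + of_real (t - a) * cis (- Arg z)) has_vector_derivative cis (- Arg z)) (at t)"
      by (auto intro!: derivative_eq_intros)
    show "open {a<..}" "t \<in> {a<..}" using False assms by auto
  qed (auto simp: bessel_path_def)
  then show ?thesis using False by (simp add: vector_derivative_at)
qed

lemma has_integral_bessel_path:
  assumes nu: "\<nu> \<ge> -1/2" and z: "z \<in> slit_plane" and a: "a > 0"
  shows "((\<lambda>t. besselJ \<nu> (bessel_path a z t * z) * exp (-2 / bessel_path a z t)
                     / bessel_path a z t * vector_derivative (bessel_path a z) (at t))
             has_integral (\<integral>t. path_integrand \<nu> a z t \<partial>lborel)) {0<..}"
proof -
  define \<rho> where "\<rho> = norm z"
  have z0: "z \<noteq> 0" using z by auto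
  have \<rho>: "\<rho> > 0" using z0 by (simp add: \<rho>_def)
  have zcis: "cis (- Arg z) * z = of_real \<rho>"
    using rcis_cmod_Arg[of z] by (metis cis_mult rcis_def \<rho>_def add.left_inverse cis_zero mult.commute mult.left_commute mult.right_neutral)
  define G where "G = (\<lambda>A t. indicator A t *\<^sub>R path_integrand \<nu> a z t)"
  have int: "integrable lborel (G A)" if "A \<in> sets borel" for A
    unfolding G_def using that by (intro integrable_mult_indicator integrable_path_integrand assms) auto
  \<comment> \<open>On the tail \<open>bessel_path\<close> has unit speed in c, hence speed \<rho> =
    |z| in c z, against unit speed in \<open>path_integrand\<close>. The affine change t -> a +
    \<rho> (t - a), which fixes \<open>a\<close>, reconciles them.\<close>
  define P where "P = (\<lambda>t. G {..a} t + \<rho> *\<^sub>R G {a<..} (a - \<rho> * a + \<rho> * t))"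
  have Pint: "integrable lborel P"
    unfolding P_def using int[of "{..a}"] int[of "{a<..}"] \<rho>
    by (intro Bochner_Integration.integrable_add integrable_scaleR_right lborel_integrable_real_affine) auto
  have "(\<integral>t. P t \<partial>lborel) = (\<integral>t. G {..a} t \<partial>lborel) + (\<integral>t. \<rho> *\<^sub>R G {a<..} (a - \<rho> * a + \<rho> * t) \<partial>lborel)"
    unfolding P_def using int[of "{..a}"] int[of "{a<..}"] \<rho>
    by (intro Bochner_Integration.integral_add integrable_scaleR_right lborel_integrable_real_affine) auto
  also have "(\<integral>t. \<rho> *\<^sub>R G {a<..} (a - \<rho> * a + \<rho> * t) \<partial>lborel) = (\<integral>t. G {a<..} t \<partial>lborel)"
    using lborel_integral_real_affine[of \<rho> "G {a<..}" "a - \<rho> * a"] \<rho> by simp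
  also have "(\<integral>t. G {..a} t \<partial>lborel) + (\<integral>t. G {a<..} t \<partial>lborel) = (\<integral>t. G {..a} t + G {a<..} t \<partial>lborel)"
    using int[of "{..a}"] int[of "{a<..}"] by (intro Bochner_Integration.integral_add[symmetric]) auto
  also have "(\<lambda>t. G {..a} t + G {a<..} t) = path_integrand \<nu> a z"
    by (auto simp: G_def fun_eq_iff indicator_def)
  finally have Pval: "(\<integral>t. P t \<partial>lborel) = (\<integral>t. path_integrand \<nu> a z t \<partial>lborel)" .
  let ?F = "\<lambda>t. besselJ \<nu> (bessel_path a z t * z) * exp (-2 / bessel_path a z t)
                     / bessel_path a z t * vector_derivative (bessel_path a z) (at t)"
  have eq: "(if t \<in> {0<..} then ?F t else 0) = P t" if ne: "t \<noteq> a" for t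
  proof -
    have cmp: "a < a - \<rho> * a + \<rho> * t \<longleftrightarrow> a < t"
    proof -
      have "a < a - \<rho> * a + \<rho> * t \<longleftrightarrow> \<rho> * a < \<rho> * t" by linarith
      then show ?thesis using \<rho> by simp
    qed
    consider "t \<le> 0" | "0 < t" "t < a" | "t > a" using ne by linarith
    then show ?thesis
    proof cases
      case 1
      then show ?thesis using a cmp by (simp add: P_def G_def path_integrand_def)
    next
      case 2
      then show ?thesis using cmp
        by (simp add: P_def G_def path_integrand_def vector_derivative_bessel_path) (simp add: bessel_path_def)
    next
      case 3
      define c where "c = of_real a + of_real (t - a) * cis (- Arg z)"
      define q where "q = of_real a * z + of_real (\<rho> * (t - a))"
      have cz: "c * z = q" using zcis by (simp add: c_def q_def distrib_right mult.assoc mult.left_commute)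
      have c: "c = q / z" using cz z0 by (simp add: field_simps)
      have "besselJ \<nu> (c * z) * exp (-2 / c) / c * cis (- Arg z) = besselJ \<nu> q * exp (-2 * z / q) / q * (cis (- Arg z) * z)"
        unfolding cz unfolding c by simp
      also have "\<dots> = \<rho> *\<^sub>R (besselJ \<nu> q * exp (-2 * z / q) / q)"
        unfolding zcis by (simp add: scaleR_conv_of_real)
      also have "\<dots> = P t"
      proof -
        have "a - \<rho> * a + \<rho> * t - a = \<rho> * (t - a)" by (simp add: algebra_simps)
        then show ?thesis using 3 cmp
          by (simp add: P_def G_def path_integrand_def q_def del: of_real_diff of_real_mult)
      qed
      also have "besselJ \<nu> (c * z) * exp (-2 / c) / c * cis (- Arg z) = ?F t"
        using 3 by (simp add: vector_derivative_bessel_path bessel_path_def c_def)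
      finally show ?thesis using 3 a by simp
    qed
  qed
  have "(P has_integral (\<integral>t. path_integrand \<nu> a z t \<partial>lborel)) UNIV"
    using has_integral_integral_lborel[OF Pint] unfolding Pval .
  \<comment> \<open>The path may have a corner at \<open>a\<close>, where its derivative is
    unspecified; one point does not affect the integral.\<close>
  then have "((\<lambda>t. if t \<in> {0<..} then ?F t else 0) has_integral (\<integral>t. path_integrand \<nu> a z t \<partial>lborel)) UNIV"
    by (rule has_integral_spike_finite[of "{a}", rotated 2]) (use eq in auto)
  then show ?thesis unfolding has_integral_restrict_UNIV .
qed

text \<open>The continuation uses \<open>besselK_int\<close>, holomorphic on the right half-plane at
  integer orders too, where \<open>besselK\<close> is a limit; \<open>2 * csqrt z\<close> maps the
  slit plane into that half-plane. For z > 0 the path is the identity and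
  \<open>besselJ_integral_pos_real\<close> gives the value.\<close>

lemma path_integral_eq:
  assumes nu: "\<nu> \<ge> -1/2" and z: "z \<in> slit_plane" and a: "a > 0"
  shows "(\<integral>t. path_integrand \<nu> a z t \<partial>lborel) = 2 * besselJ \<nu> (2 * csqrt z) * besselK \<nu> (2 * csqrt z)"
proof -
  have Re: "Re (2 * csqrt z) > 0" if "z \<in> slit_plane" for z
  proof -
    have "cmod z + Re z > 0" using that slit_plane_iff by blast
    then show ?thesis by (simp add: csqrt.simps)
  qed
  have sq: "(\<lambda>z. 2 * csqrt z) holomorphic_on slit_plane"
    by (intro holomorphic_intros) auto
  have "(\<lambda>z. besselJ \<nu> (2 * csqrt z)) holomorphic_on slit_plane"
    using holomorphic_on_compose_gen[OF sq holomorphic_on_besselJ] Re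
    by (force simp: o_def complex_nonpos_Reals_iff)
  moreover have "(\<lambda>z. besselK_int \<nu> (2 * csqrt z)) holomorphic_on slit_plane"
    using holomorphic_on_compose_gen[OF sq holomorphic_on_besselK_int] Re by (force simp: o_def)
  ultimately have hol: "(\<lambda>z. 2 * besselJ \<nu> (2 * csqrt z) * besselK_int \<nu> (2 * csqrt z)) holomorphic_on slit_plane"
    by (intro holomorphic_intros)
  have "(\<integral>t. path_integrand \<nu> a z t \<partial>lborel) = 2 * besselJ \<nu> (2 * csqrt z) * besselK_int \<nu> (2 * csqrt z)"
  proof (rule analytic_continuation_pos_real[OF holomorphic_on_path_integral[OF nu a] hol open_slit_plane connected_slit_plane _ _ z])
    fix x :: real assume x: "x > 0"
    then have xs: "of_real x \<in> slit_plane" by simp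
    have path: "bessel_path a (of_real x) = of_real" by (rule bessel_path_pos_real[OF x])
    have vd: "vector_derivative complex_of_real (at t) = 1" for t
      by (rule vector_derivative_at) (auto intro!: derivative_eq_intros)
    from has_integral_bessel_path[OF nu xs a]
    have "((\<lambda>c. besselJ \<nu> (of_real c * of_real x) * exp (-2 / of_real c) / of_real c)
        has_integral (\<integral>t. path_integrand \<nu> a (of_real x) t \<partial>lborel)) {0<..}"
      unfolding path vd by simp
    from has_integral_unique[OF this besselJ_integral_pos_real[OF nu x]]
    show "(\<integral>t. path_integrand \<nu> a (of_real x) t \<partial>lborel)
        = 2 * besselJ \<nu> (2 * csqrt (of_real x)) * besselK_int \<nu> (2 * csqrt (of_real x))"
      using besselK_eq_int[OF _ Re[OF xs]] nu by simp
  qed auto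
  then show ?thesis using besselK_eq_int[OF _ Re[OF z]] nu by simp
qed

theorem theorem23:
  fixes \<nu> :: real and z :: complex
  assumes "\<nu> \<ge> -1/2" and "z \<notin> \<real>\<^sub>\<le>\<^sub>0"
  shows "(z \<in> \<real> \<longrightarrow>
           ((\<lambda>c::real. besselJ \<nu> (of_real c * z) * exp (-2 / of_real c) / of_real c)
             has_integral 2 * besselJ \<nu> (2 * csqrt z) * besselK \<nu> (2 * csqrt z)) {0<..})
       \<and> (\<forall>a>0. ((\<lambda>t::real. besselJ \<nu> (bessel_path a z t * z) * exp (-2 / bessel_path a z t)
                     / bessel_path a z t * vector_derivative (bessel_path a z) (at t))
             has_integral 2 * besselJ \<nu> (2 * csqrt z) * besselK \<nu> (2 * csqrt z)) {0<..})"
proof (intro conjI impI allI)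
  assume "z \<in> \<real>"
  then obtain x where "z = of_real x" by (auto elim: Reals_cases)
  moreover from this have "x > 0" using assms(2) by simp
  ultimately show "((\<lambda>c::real. besselJ \<nu> (of_real c * z) * exp (-2 / of_real c) / of_real c)
             has_integral 2 * besselJ \<nu> (2 * csqrt z) * besselK \<nu> (2 * csqrt z)) {0<..}"
    using besselJ_integral_pos_real[OF assms(1)] by blast
next
  fix a :: real assume a: "a > 0"
  have z: "z \<in> slit_plane" using assms(2) by simp
  show "((\<lambda>t::real. besselJ \<nu> (bessel_path a z t * z) * exp (-2 / bessel_path a z t)
                     / bessel_path a z t * vector_derivative (bessel_path a z) (at t))
             has_integral 2 * besselJ \<nu> (2 * csqrt z) * besselK \<nu> (2 * csqrt z)) {0<..}"
    using has_integral_bessel_path[OF assms(1) z a] unfolding path_integral_eq[OF assms(1) z a] .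
qed

end
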